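(* For $n\ge 2$, set $$\tau(n):=\min\{m\ge 1 \mid mK_X \text{ is (linearly) trivial for every hyperelliptic manifold } X \text{ of dimension } n\}.$$ Then $\tau(2)=12$, $\tau(3)=60$, and $\tau(4)=1260$.
   Context: A hyperelliptic manifold of dimension $n$ is a quotient $X=T/G$ of an $n$-dimensional complex torus $T=\mathbb{C}^n/\Lambda$ by a finite non-trivial group $G$ of biholomorphic self-maps of $T$ that acts freely on $T$ and contains no translations. $K_X$ denotes the canonical divisor of $X$; $mK_X$ trivial means that the line bundle $\mathcal{O}_X(mK_X)$ (the $m$-th tensor power of the canonical bundle) is trivial. *)

theory Defs
  imports "HOL-Analysis.Analysis" "HOL-Algebra.Bij"
begin

section \<open>Holomorphy in several complex variables\<close>

text \<open>
  On \<open>complex ^ 'n\<close> the library's \<open>has_derivative\<close> is the real Frechet derivative; holomorphy is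
  complex linearity of that derivative. Both notions are only used on open sets.
\<close>

definition holo_map_on :: "(complex ^ 'n \<Rightarrow> complex ^ 'm) \<Rightarrow> (complex ^ 'n) set \<Rightarrow> bool" where
  "holo_map_on f S \<longleftrightarrow>
     (\<forall>z\<in>S. \<exists>D. (f has_derivative D) (at z) \<and> Vector_Spaces.linear (*s) (*s) D)"

definition holo_fun_on :: "(complex ^ 'n \<Rightarrow> complex) \<Rightarrow> (complex ^ 'n) set \<Rightarrow> bool" where
  "holo_fun_on f S \<longleftrightarrow>
     (\<forall>z\<in>S. \<exists>D. (f has_derivative D) (at z) \<and> Vector_Spaces.linear (*s) (*) D)"

definition complex_jacobian :: "(complex ^ 'n \<Rightarrow> complex ^ 'm) \<Rightarrow> complex ^ 'n \<Rightarrow> complex ^ 'n ^ 'm" where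
  "complex_jacobian f z = matrix (frechet_derivative f (at z))"


section \<open>Complex manifolds presented by atlases\<close>

text \<open>
  A chart is a pair \<open>(U, \<phi>)\<close> where \<open>\<phi>\<close> is injective on \<open>U\<close> with open image. A manifold is given by a
  set of charts; its points are the union of the chart domains. All atlases below are closed under
  restricting charts to open subsets, so asking for charts with \<open>g ` U \<subseteq> W\<close> around each point
  includes the continuity of \<open>g\<close>.
\<close>

type_synonym ('a, 'n) chart = "'a set \<times> ('a \<Rightarrow> complex ^ 'n)"

definition points :: "('a, 'n) chart set \<Rightarrow> 'a set" where
  "points A = (\<Union>(U, \<phi>)\<in>A. U)"

definition holomorphic_map ::
    "('a, 'n::finite) chart set \<Rightarrow> ('b, 'm::finite) chart set \<Rightarrow> ('a \<Rightarrow> 'b) \<Rightarrow> bool" where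
  "holomorphic_map A B g \<longleftrightarrow>
     (\<forall>x\<in>points A. \<exists>(U, \<phi>)\<in>A. \<exists>(W, \<psi>)\<in>B.
        x \<in> U \<and> g ` U \<subseteq> W \<and> holo_map_on (\<psi> \<circ> g \<circ> inv_into U \<phi>) (\<phi> ` U))"

definition biholomorphic_map ::
    "('a, 'n::finite) chart set \<Rightarrow> ('b, 'm::finite) chart set \<Rightarrow> ('a \<Rightarrow> 'b) \<Rightarrow> bool" where
  "biholomorphic_map A B g \<longleftrightarrow>
     bij_betw g (points A) (points B) \<and> holomorphic_map A B g \<and>
     holomorphic_map B A (inv_into (points A) g)"

definition affine_atlas :: "(complex ^ 'n, 'n) chart set" where
  "affine_atlas = {(V, \<lambda>z. z) | V. open V}"

text \<open>
  The atlas induced on a quotient by the quotient map \<open>q\<close>: a chart whose domain is mapped injectively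
  by \<open>q\<close> is transported along \<open>q\<close>. For quotients by free, properly discontinuous actions these charts
  cover the quotient, and \<open>q\<close> becomes locally biholomorphic.
\<close>

definition quotient_atlas :: "('a \<Rightarrow> 'b) \<Rightarrow> ('a, 'n) chart set \<Rightarrow> ('b, 'n) chart set" where
  "quotient_atlas q A = {(q ` U, \<phi> \<circ> inv_into U q) | U \<phi>. (U, \<phi>) \<in> A \<and> inj_on q U}"


section \<open>Line bundles and the canonical bundle\<close>

text \<open>
  Line bundles trivialised over the charts are given by transition functions: \<open>L c d\<close> relates the
  coordinates of a section over the charts \<open>c\<close> and \<open>d\<close> by \<open>s\<^sub>c = L c d \<cdot> s\<^sub>d\<close> on the overlap.
  Such a bundle is trivial iff the cocycle \<open>L\<close> is a holomorphic coboundary.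
\<close>

type_synonym ('a, 'n) cocycle = "('a, 'n) chart \<Rightarrow> ('a, 'n) chart \<Rightarrow> 'a \<Rightarrow> complex"

definition trivial_line_bundle :: "('a, 'n::finite) chart set \<Rightarrow> ('a, 'n) cocycle \<Rightarrow> bool" where
  "trivial_line_bundle A L \<longleftrightarrow>
     (\<exists>h :: ('a, 'n) chart \<Rightarrow> 'a \<Rightarrow> complex.
        (\<forall>(U, \<phi>)\<in>A. (\<forall>x\<in>U. h (U, \<phi>) x \<noteq> 0) \<and>
                     holo_fun_on (h (U, \<phi>) \<circ> inv_into U \<phi>) (\<phi> ` U)) \<and>
        (\<forall>c\<in>A. \<forall>d\<in>A. \<forall>x \<in> fst c \<inter> fst d. h c x = L c d x * h d x))"

definition tensor_power :: "nat \<Rightarrow> ('a, 'n) cocycle \<Rightarrow> ('a, 'n) cocycle" where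
  "tensor_power m L = (\<lambda>c d x. L c d x ^ m)"

text \<open>
  Over a chart \<open>(U, \<phi>)\<close> the canonical bundle has the frame \<open>d\<phi>\<^sub>1 \<and> \<dots> \<and> d\<phi>\<^sub>n\<close>, and
  \<open>d\<psi>\<^sub>1 \<and> \<dots> \<and> d\<psi>\<^sub>n = det (D (\<psi> \<circ> \<phi>\<^sup>-\<^sup>1)) d\<phi>\<^sub>1 \<and> \<dots> \<and> d\<phi>\<^sub>n\<close>.
\<close>

definition canonical_bundle :: "('a, 'n::finite) cocycle" where
  "canonical_bundle = (\<lambda>(U, \<phi>) (W, \<psi>) x. det (complex_jacobian (\<psi> \<circ> inv_into U \<phi>) (\<phi> x)))"


section \<open>Complex tori and hyperelliptic manifolds\<close>

text \<open>Here \<open>independent\<close> and \<open>span\<close> refer to the real vector space underlying \<open>complex ^ 'n\<close>.\<close>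

definition full_lattice :: "(complex ^ 'n::finite) set \<Rightarrow> bool" where
  "full_lattice \<Lambda> \<longleftrightarrow>
     (\<exists>B. independent B \<and> span B = UNIV \<and>
          \<Lambda> = {\<Sum>b\<in>B. of_int (k b) *\<^sub>R b | k :: complex ^ 'n \<Rightarrow> int. True})"

definition torus_proj :: "(complex ^ 'n) set \<Rightarrow> complex ^ 'n \<Rightarrow> (complex ^ 'n) set" where
  "torus_proj \<Lambda> z = (\<lambda>l. z + l) ` \<Lambda>"

definition torus :: "(complex ^ 'n) set \<Rightarrow> (complex ^ 'n) set set" where
  "torus \<Lambda> = range (torus_proj \<Lambda>)"

definition torus_atlas :: "(complex ^ 'n::finite) set \<Rightarrow> ((complex ^ 'n) set, 'n) chart set" where
  "torus_atlas \<Lambda> = quotient_atlas (torus_proj \<Lambda>) affine_atlas"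

definition is_translation ::
    "(complex ^ 'n::finite) set \<Rightarrow> ((complex ^ 'n) set \<Rightarrow> (complex ^ 'n) set) \<Rightarrow> bool" where
  "is_translation \<Lambda> g \<longleftrightarrow> (\<exists>a. \<forall>z. g (torus_proj \<Lambda> z) = torus_proj \<Lambda> (z + a))"

text \<open>
  The data \<open>(\<Lambda>, G)\<close> of a hyperelliptic manifold \<open>T / G\<close> with \<open>T = complex ^ 'n / \<Lambda>\<close>. Self-maps of \<open>T\<close> are
  elements of \<open>BijGroup\<close>, hence \<open>undefined\<close> outside \<open>T\<close>, so that \<open>G\<close> has the right cardinality.
  The identity, being translation by \<open>0\<close>, is exempt from the ban on translations.
\<close>

definition hyperelliptic ::
    "(complex ^ 'n::finite) set \<Rightarrow> ((complex ^ 'n) set \<Rightarrow> (complex ^ 'n) set) set \<Rightarrow> bool" where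
  "hyperelliptic \<Lambda> G \<longleftrightarrow>
     full_lattice \<Lambda> \<and>
     subgroup G (BijGroup (torus \<Lambda>)) \<and> finite G \<and> G \<noteq> {\<one>\<^bsub>BijGroup (torus \<Lambda>)\<^esub>} \<and>
     (\<forall>g\<in>G. biholomorphic_map (torus_atlas \<Lambda>) (torus_atlas \<Lambda>) g) \<and>
     (\<forall>g\<in>G. g \<noteq> \<one>\<^bsub>BijGroup (torus \<Lambda>)\<^esub> \<longrightarrow> (\<forall>x\<in>torus \<Lambda>. g x \<noteq> x)) \<and>
     (\<forall>g\<in>G. g \<noteq> \<one>\<^bsub>BijGroup (torus \<Lambda>)\<^esub> \<longrightarrow> \<not> is_translation \<Lambda> g)"

text \<open>The points of \<open>T / G\<close> are the \<open>G\<close>-orbits in \<open>T\<close>.\<close>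

definition orbit_proj :: "('a \<Rightarrow> 'a) set \<Rightarrow> 'a \<Rightarrow> 'a set" where
  "orbit_proj G x = (\<lambda>g. g x) ` G"

definition hyperelliptic_atlas ::
    "(complex ^ 'n::finite) set \<Rightarrow> ((complex ^ 'n) set \<Rightarrow> (complex ^ 'n) set) set
      \<Rightarrow> ((complex ^ 'n) set set, 'n) chart set" where
  "hyperelliptic_atlas \<Lambda> G = quotient_atlas (orbit_proj G) (torus_atlas \<Lambda>)"

text \<open>
  The dimension is \<open>CARD('n)\<close>. Since \<open>Inf {} = 0\<close> on \<open>nat\<close>, a positive value of \<open>tau\<close> is a genuine
  minimum of a nonempty set.
\<close>

definition tau :: "'n::finite itself \<Rightarrow> nat" where
  "tau _ = Inf {m. 1 \<le> m \<and>
     (\<forall>(\<Lambda> :: (complex ^ 'n) set) G. hyperelliptic \<Lambda> G \<longrightarrow>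
        trivial_line_bundle (hyperelliptic_atlas \<Lambda> G) (tensor_power m canonical_bundle))}"

end

theory Submission
  imports Defs "HOL-Complex_Analysis.Cauchy_Integral_Formula" "HOL-Algebra.Multiplicative_Group"
    "Jordan_Normal_Form.Schur_Decomposition"
begin

text \<open>
  Every element of \<open>G\<close> lifts to an affine map \<open>z \<mapsto> A z + b\<close> of \<open>complex ^ 'n\<close>, and the transition
  functions of the canonical bundle of \<open>T / G\<close> are the determinants \<open>det A\<close>; since periodic entire
  functions are constant, \<open>m K\<close> is trivial iff \<open>det A ^ m = 1\<close> for all these \<open>A\<close>.
  Here \<open>A\<close> has finite order, \<open>A \<oplus> cnj A\<close> is integral in a lattice basis, and \<open>A\<close> has the eigenvalue \<open>1\<close>
  because \<open>G\<close> acts freely. The other eigenvalues \<open>a\<close> are unimodular, and the elementary symmetric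
  functions of the numbers \<open>a + cnj a\<close>, which lie in \<open>[-2, 2]\<close>, are integers; this leaves finitely many possibilities.
  Conversely, a root of unity acting on a lattice \<open>\<int>[\<zeta>]\<close>, combined with a translation on
  the fixed part, gives cyclic examples with \<open>det A\<close> of order \<open>3, 4\<close> in dimension \<open>2\<close>,
  \<open>3, 4, 5\<close> in dimension \<open>3\<close>, and \<open>4, 5, 7, 9\<close> in dimension \<open>4\<close>.
\<close>

no_notation Matrix.vec_index (infixl "$" 100)
no_notation Matrix.scalar_prod (infix "\<bullet>" 70)
hide_const (open) Matrix.vec Matrix.mat Determinant.det up_ring.monom up_ring.coeff

section \<open>Full lattices\<close>

text \<open>What counts in the exponents is the order of products of eigenvalues. For n at most 4,
  \<open>a + cnj a\<close> has degree at most n - 1 over the rationals, so an eigenvalue has order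
  1, 2, 3, 4, 6 (degree 1), 5, 8, 10, 12 (degree 2) or 7, 9, 14, 18 (degree 3). The lcm of these
  orders would give 120 and 2520 in dimensions 3 and 4; but eigenvalues of order 8 come in pairs a,
  b with a^4 = b^4 = -1, so (a b)^4 = 1 and the factor 8 shrinks to 4. The condition on m concerns
  one element of G at a time. Hence no classification of the possible groups is needed for the upper
  bounds, and cyclic groups suffice for the lower bounds. In the examples the lattice is Z[x]/(M)
  for a squarefree product M of cyclotomic polynomials. The difficulty is to keep the action free:
  the translation has to vanish on the factors that are moved and must still have exact order d,
  even up to lattice vectors, on a factor that is fixed. This works because the values of suitable
  cyclotomic polynomials at roots of unity of other orders are units.\<close>

locale lattice_basis =
  fixes \<Lambda> B :: "(complex ^ 'n::finite) set"
  assumes indep: "independent B" and spanning: "span B = UNIV"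
    and lattice_eq: "\<Lambda> = {\<Sum>b\<in>B. of_int (k b) *\<^sub>R b | k :: complex ^ 'n \<Rightarrow> int. True}"
begin

lemma finite_basis: "finite B"
  using indep independent_imp_finite by blast

definition crd :: "complex ^ 'n \<Rightarrow> complex ^ 'n \<Rightarrow> real" where
  "crd b z = representation B z b"

lemma linear_crd: "linear (crd b)"
proof (rule linearI)
  show "crd b (x + y) = crd b x + crd b y" for x y
    unfolding crd_def using fun_cong[OF real_vector.representation_add[OF indep, of y x], of b] spanning
    by (simp add: add.commute)
  show "crd b (r *\<^sub>R x) = r *\<^sub>R crd b x" for r x
    unfolding crd_def using real_vector.representation_scale[OF indep, of x r] spanning by simp
qed

lemmas crd_simps = linear_add[OF linear_crd] linear_diff[OF linear_crd] linear_neg[OF linear_crd]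
  linear_0[OF linear_crd] linear_scale[OF linear_crd] linear_sum[OF linear_crd]

lemma continuous_crd [continuous_intros]:
  "continuous_on S f \<Longrightarrow> continuous_on S (\<lambda>x. crd b (f x))"
  by (rule bounded_linear.continuous_on[OF linear_conv_bounded_linear[THEN iffD1, OF linear_crd]])

lemma crd_sum: "(\<Sum>b\<in>B. crd b z *\<^sub>R b) = z"
  unfolding crd_def using real_vector.sum_representation_eq[OF indep, of z B] spanning finite_basis
  by auto

lemma crd_of_sum:
  assumes "c \<in> B"
  shows "crd c (\<Sum>b\<in>B. r b *\<^sub>R b) = r c"
proof -
  have "crd c (\<Sum>b\<in>B. r b *\<^sub>R b) = (\<Sum>b\<in>B. r b * crd c b)"
    by (simp add: crd_simps)
  also have "\<dots> = (\<Sum>b\<in>B. r b * (if b = c then 1 else 0))"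
    by (rule sum.cong) (auto simp: crd_def real_vector.representation_basis[OF indep])
  also have "\<dots> = r c"
    using assms finite_basis by (simp add: if_distrib cong: if_cong)
  finally show ?thesis .
qed

lemma mem_iff: "z \<in> \<Lambda> \<longleftrightarrow> (\<forall>b\<in>B. crd b z \<in> \<int>)"
proof
  assume "z \<in> \<Lambda>"
  then show "\<forall>b\<in>B. crd b z \<in> \<int>"
    by (auto simp: lattice_eq crd_of_sum)
next
  assume *: "\<forall>b\<in>B. crd b z \<in> \<int>"
  have "z = (\<Sum>b\<in>B. of_int \<lfloor>crd b z\<rfloor> *\<^sub>R b)"
    using * by (subst crd_sum[of z, symmetric]) (intro sum.cong, auto simp: Ints_def)
  then show "z \<in> \<Lambda>"
    unfolding lattice_eq by (intro CollectI exI[of _ "\<lambda>b. \<lfloor>crd b z\<rfloor>"]) simp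
qed

lemma zero_mem [simp]: "0 \<in> \<Lambda>"
  and add_mem: "x \<in> \<Lambda> \<Longrightarrow> y \<in> \<Lambda> \<Longrightarrow> x + y \<in> \<Lambda>"
  and neg_mem: "x \<in> \<Lambda> \<Longrightarrow> - x \<in> \<Lambda>"
  by (auto simp: mem_iff crd_simps)

lemma basis_mem: "b \<in> B \<Longrightarrow> b \<in> \<Lambda>"
  by (auto simp: mem_iff crd_def real_vector.representation_basis[OF indep])

lemma closed_lattice: "closed \<Lambda>"
proof -
  have "\<Lambda> = (\<Inter>b\<in>B. crd b -` \<int>)"
    by (auto simp: mem_iff)
  moreover have "closed (crd b -` \<int>)" for b
    by (intro continuous_closed_vimage closed_Ints linear_continuous_at[OF linear_conv_bounded_linear[THEN iffD1, OF linear_crd]])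
  ultimately show ?thesis by auto
qed

lemma discrete: "\<exists>e>0. \<forall>l\<in>\<Lambda>. norm l < e \<longrightarrow> l = 0"
proof -
  have "open ((\<lambda>z. crd b z) -` {-1<..<1})" for b
    by (intro continuous_open_vimage open_greaterThanLessThan linear_continuous_at[OF linear_conv_bounded_linear[THEN iffD1, OF linear_crd]])
  then have "open (\<Inter>b\<in>B. crd b -` {-1<..<1})"
    using finite_basis by auto
  moreover have "0 \<in> (\<Inter>b\<in>B. crd b -` {-1<..<1})"
    by (auto simp: crd_simps)
  ultimately obtain e where e: "e > 0" "ball 0 e \<subseteq> (\<Inter>b\<in>B. crd b -` {-1<..<1})"
    by (meson openE)
  show ?thesis
  proof (intro exI[of _ e] conjI ballI impI e(1))
    fix l assume l: "l \<in> \<Lambda>" "norm l < e"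
    have "crd b l = 0" if "b \<in> B" for b
    proof -
      have "crd b l \<in> \<int>" "\<bar>crd b l\<bar> < 1"
        using l subsetD[OF e(2), of l] that by (auto simp: mem_iff abs_less_iff)
      then show ?thesis
        using Ints_nonzero_abs_less1 by blast
    qed
    then show "l = 0"
      by (subst crd_sum[of l, symmetric]) simp
  qed
qed

text \<open>Integer coordinates that vary continuously cannot jump. This stands in for covering
  space theory: two lifts of one torus map differ by a continuous lattice-valued function, hence by
  a constant.\<close>

lemma continuous_into_lattice_constant:
  assumes "connected S" "continuous_on S f" "\<And>x. x \<in> S \<Longrightarrow> f x \<in> \<Lambda>"
  shows "f constant_on S"
proof -
  have "(\<lambda>x. crd b (f x)) constant_on S" if "b \<in> B" for b
  proof (rule continuous_discrete_range_constant[OF assms(1)])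
    show "continuous_on S (\<lambda>x. crd b (f x))"
      by (intro continuous_intros assms)
    fix x assume x: "x \<in> S"
    have "1 \<le> norm (crd b (f y) - crd b (f x))" if "y \<in> S" "crd b (f y) \<noteq> crd b (f x)" for y
      using Ints_nonzero_abs_ge1[of "crd b (f y) - crd b (f x)"] that x assms(3) \<open>b \<in> B\<close>
      by (auto simp: mem_iff)
    then show "\<exists>e>0. \<forall>y. y \<in> S \<and> crd b (f y) \<noteq> crd b (f x) \<longrightarrow> e \<le> norm (crd b (f y) - crd b (f x))"
      by (intro exI[of _ 1]) auto
  qed
  then obtain c where "\<And>b x. b \<in> B \<Longrightarrow> x \<in> S \<Longrightarrow> crd b (f x) = c b"
    unfolding constant_on_def by metis
  then have "f x = (\<Sum>b\<in>B. c b *\<^sub>R b)" if "x \<in> S" for x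
    using that by (subst crd_sum[of "f x", symmetric]) simp
  then show ?thesis
    unfolding constant_on_def by blast
qed

text \<open>Compactness of the torus in the form that Liouville's theorem needs: subtracting the
  integer parts of the coordinates leaves fractional parts, so the norms of the basis vectors bound
  the remainder.\<close>

lemma bounded_fundamental_domain: "\<exists>K. \<forall>z. \<exists>l\<in>\<Lambda>. norm (z - l) \<le> K"
proof (intro exI allI)
  fix z
  define l where "l = (\<Sum>b\<in>B. of_int \<lfloor>crd b z\<rfloor> *\<^sub>R b)"
  have "z - l = (\<Sum>b\<in>B. frac (crd b z) *\<^sub>R b)"
    unfolding l_def frac_def by (subst crd_sum[of z, symmetric]) (simp add: sum_subtractf scaleR_diff_left)
  also have "norm \<dots> \<le> (\<Sum>b\<in>B. norm b)"
  proof (rule sum_norm_le)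
    fix b show "norm (frac (crd b z) *\<^sub>R b) \<le> norm b"
      using mult_right_mono[of "frac (crd b z)" 1 "norm b"] frac_lt_1[of "crd b z"] by (simp add: abs_of_nonneg)
  qed
  finally have "norm (z - l) \<le> (\<Sum>b\<in>B. norm b)" .
  moreover have "l \<in> \<Lambda>"
    unfolding lattice_eq l_def by (intro CollectI exI[of _ "\<lambda>b. \<lfloor>crd b z\<rfloor>"]) simp
  ultimately show "\<exists>l\<in>\<Lambda>. norm (z - l) \<le> (\<Sum>b\<in>B. norm b)" by blast
qed

lemma torus_proj_eq_iff: "torus_proj \<Lambda> z = torus_proj \<Lambda> w \<longleftrightarrow> z - w \<in> \<Lambda>"
proof
  assume "torus_proj \<Lambda> z = torus_proj \<Lambda> w"
  moreover have "z \<in> torus_proj \<Lambda> z"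
    unfolding torus_proj_def using zero_mem by (metis add.right_neutral image_eqI)
  ultimately obtain l where "l \<in> \<Lambda>" "z = w + l"
    by (auto simp: torus_proj_def)
  then show "z - w \<in> \<Lambda>" by simp
next
  assume *: "z - w \<in> \<Lambda>"
  have "\<exists>l'\<in>\<Lambda>. z + l = w + l'" if "l \<in> \<Lambda>" for l
    using add_mem[OF * that] by (intro bexI[of _ "z - w + l"]) auto
  moreover have "\<exists>l'\<in>\<Lambda>. w + l = z + l'" if "l \<in> \<Lambda>" for l
    using add_mem[OF neg_mem[OF *] that] by (intro bexI[of _ "- (z - w) + l"]) auto
  ultimately show "torus_proj \<Lambda> z = torus_proj \<Lambda> w"
    unfolding torus_proj_def by (auto simp: image_iff)
qed

abbreviation tproj where "tproj \<equiv> torus_proj \<Lambda>"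

lemma tproj_mem [simp]: "tproj z \<in> torus \<Lambda>"
  by (simp add: torus_def)

end

lemma full_lattice_iff: "full_lattice \<Lambda> \<longleftrightarrow> (\<exists>B. lattice_basis \<Lambda> B)"
  unfolding full_lattice_def lattice_basis_def by blast

section \<open>Holomorphic maps between tori are affine\<close>

lemma clinear_vec_iff:
  fixes D :: "complex ^ 'n \<Rightarrow> complex ^ 'm"
  shows "Vector_Spaces.linear (*s) (*s) D \<longleftrightarrow>
    (\<forall>x y. D (x + y) = D x + D y) \<and> (\<forall>c x. D (c *s x) = c *s D x)"
  unfolding Vector_Spaces.linear_iff
  by (simp add: vec.vector_space_axioms)

lemma clinear_fun_iff:
  fixes D :: "complex ^ 'n \<Rightarrow> complex"
  shows "Vector_Spaces.linear (*s) (*) D \<longleftrightarrow>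
    (\<forall>x y. D (x + y) = D x + D y) \<and> (\<forall>c x. D (c *s x) = c * D x)"
  unfolding Vector_Spaces.linear_iff
  by (simp add: vec.vector_space_axioms vector_space_over_itself.vector_space_axioms)

lemma bounded_linear_vector_mult_complex:
  "bounded_linear ((*v) (A :: complex ^ 'n ^ 'm))"
proof -
  have "linear ((*v) A)"
    by (rule linearI) (simp_all add: vec.add vec.scale matrix_vector_mult_def Finite_Cartesian_Product.vec_eq_iff
        sum.distrib distrib_left scaleR_sum_right)
  then show ?thesis
    by (simp add: linear_conv_bounded_linear)
qed

lemma has_derivative_affine:
  "((\<lambda>z. (A :: complex ^ 'n ^ 'm) *v z + b) has_derivative ((*v) A)) (at z within S)"
proof -
  have "((\<lambda>z. A *v z + b) has_derivative (\<lambda>h. A *v h + 0)) (at z within S)"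
    by (intro has_derivative_add has_derivative_const
        bounded_linear_imp_has_derivative bounded_linear_vector_mult_complex)
  then show ?thesis by simp
qed

lemma has_derivative_scalar_line:
  "((\<lambda>t. z + t *s (v :: complex ^ 'n)) has_derivative (\<lambda>t. t *s v)) (at t)"
proof -
  have "linear (\<lambda>t. t *s v)"
    by (rule linearI) (simp_all add: Finite_Cartesian_Product.vec_eq_iff algebra_simps)
  then have "bounded_linear (\<lambda>t. t *s v)"
    by (simp add: linear_conv_bounded_linear)
  then have "((\<lambda>t. z + t *s v) has_derivative (\<lambda>t. 0 + t *s v)) (at t)"
    by (intro has_derivative_add has_derivative_const bounded_linear_imp_has_derivative)
  then show ?thesis by simp
qed

text \<open>Periodicity carries a bound from one ball, which meets every class modulo the lattice,
  to the whole space. Restricting f to the complex line through z and w then reduces the claim to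
  one variable.\<close>

lemma (in lattice_basis) periodic_entire_constant:
  assumes "holo_fun_on f UNIV" and periodic: "\<And>z l. l \<in> \<Lambda> \<Longrightarrow> f (z + l) = f z"
  shows "f z = f w"
proof -
  have diff: "\<exists>D. (f has_derivative D) (at z) \<and> Vector_Spaces.linear (*s) (*) D" for z
    using assms(1) by (simp add: holo_fun_on_def)
  obtain K where K: "\<forall>z. \<exists>l\<in>\<Lambda>. norm (z - l) \<le> K"
    using bounded_fundamental_domain by blast
  have "continuous_on (cball 0 K) f"
    using diff has_derivative_continuous by (blast intro: continuous_at_imp_continuous_on)
  then have "bounded (f ` cball 0 K)"
    using compact_imp_bounded compact_continuous_image compact_cball by blast
  then obtain M where M: "\<And>z. z \<in> cball 0 K \<Longrightarrow> norm (f z) \<le> M"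
    unfolding bounded_iff by blast
  have bound: "norm (f z) \<le> M" for z
  proof -
    obtain l where "l \<in> \<Lambda>" "norm (z - l) \<le> K"
      using K by blast
    then show ?thesis
      using M[of "z - l"] periodic[of l "z - l"] by simp
  qed
  define h where "h = (\<lambda>t. f (z + t *s (w - z)))"
  have "\<exists>d. (h has_field_derivative d) (at t)" for t
  proof -
    obtain D where D: "(f has_derivative D) (at (z + t *s (w - z)))"
      and lin: "Vector_Spaces.linear (*s) (*) D"
      using diff by blast
    have "(h has_derivative (\<lambda>s. D (s *s (w - z)))) (at t)"
      unfolding h_def by (rule has_derivative_compose[OF has_derivative_scalar_line D])
    moreover have "D (s *s (w - z)) = D (w - z) * s" for s
      using lin by (simp only: clinear_fun_iff mult.commute)
    then have "(\<lambda>s. D (s *s (w - z))) = (*) (D (w - z))"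
      by (rule ext)
    ultimately show ?thesis
      unfolding has_field_derivative_def by metis
  qed
  then have "h holomorphic_on UNIV"
    by (auto simp: holomorphic_on_def field_differentiable_def)
  moreover have "bounded (range h)"
    unfolding bounded_iff h_def using bound by blast
  ultimately have "h constant_on UNIV"
    by (rule Liouville_theorem)
  then have "h 0 = h 1"
    by (auto simp: constant_on_def)
  then show ?thesis
    by (simp add: h_def)
qed

lemma holo_fun_on_component:
  assumes "holo_map_on F S"
  shows "holo_fun_on (\<lambda>z. F z $ i) S"
  unfolding holo_fun_on_def
proof
  fix z assume "z \<in> S"
  then obtain D where D: "(F has_derivative D) (at z)" "Vector_Spaces.linear (*s) (*s) D"
    using assms unfolding holo_map_on_def by blast
  have "((\<lambda>z. F z $ i) has_derivative (\<lambda>h. D h $ i)) (at z)"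
    by (rule bounded_linear.has_derivative[OF bounded_linear_vec_nth D(1)])
  moreover have "Vector_Spaces.linear (*s) (*) (\<lambda>h. D h $ i)"
    using D(2) by (simp add: clinear_fun_iff clinear_vec_iff)
  ultimately show "\<exists>D. ((\<lambda>z. F z $ i) has_derivative D) (at z) \<and> Vector_Spaces.linear (*s) (*) D"
    by blast
qed

section \<open>Charts of a torus and lifts of its self-maps\<close>

lemma torus_atlas_iff:
  "(U, \<phi>) \<in> torus_atlas \<Lambda> \<longleftrightarrow>
     (\<exists>V. open V \<and> inj_on (torus_proj \<Lambda>) V \<and> U = torus_proj \<Lambda> ` V \<and>
          \<phi> = (\<lambda>z. z) \<circ> inv_into V (torus_proj \<Lambda>))"
  unfolding torus_atlas_def quotient_atlas_def affine_atlas_def by auto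

lemma points_torus_atlas_subset: "points (torus_atlas \<Lambda>) \<subseteq> torus \<Lambda>"
  by (auto simp: points_def torus_def torus_atlas_iff)

context lattice_basis
begin

lemma inj_on_torus_proj_ball: "\<exists>e>0. \<forall>z. inj_on (torus_proj \<Lambda>) (ball z e)"
proof -
  obtain e where e: "e > 0" "\<forall>l\<in>\<Lambda>. norm l < e \<longrightarrow> l = 0"
    using discrete by blast
  have "inj_on (torus_proj \<Lambda>) (ball z (e / 2))" for z
  proof (rule inj_onI)
    fix x y assume "x \<in> ball z (e / 2)" "y \<in> ball z (e / 2)" "torus_proj \<Lambda> x = torus_proj \<Lambda> y"
    then have "dist x y < e / 2 + e / 2" "x - y \<in> \<Lambda>"
      using dist_triangle2[of x y z] by (auto simp: torus_proj_eq_iff dist_commute)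
    then show "x = y"
      using e(2)[rule_format, of "x - y"] by (simp add: dist_norm)
  qed
  then show ?thesis
    using e(1) by (intro exI[of _ "e / 2"]) auto
qed

lemma points_torus_atlas: "points (torus_atlas \<Lambda>) = torus \<Lambda>"
proof (rule antisym[OF points_torus_atlas_subset])
  obtain e where e: "e > 0" "\<And>z. inj_on (torus_proj \<Lambda>) (ball z e)"
    using inj_on_torus_proj_ball by blast
  have "torus_proj \<Lambda> z \<in> points (torus_atlas \<Lambda>)" for z
    unfolding points_def
    by (rule UN_I[of "(torus_proj \<Lambda> ` ball z e, (\<lambda>z. z) \<circ> inv_into (ball z e) (torus_proj \<Lambda>))"])
       (use e in \<open>auto simp: torus_atlas_iff\<close>)
  then show "torus \<Lambda> \<subseteq> points (torus_atlas \<Lambda>)"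
    by (auto simp: torus_def)
qed

lemma holomorphic_map_torus_local_lift:
  assumes "holomorphic_map (torus_atlas \<Lambda>) (torus_atlas \<Lambda>) g"
  shows "\<exists>V f. open V \<and> z \<in> V \<and> holo_map_on f V \<and>
           (\<forall>y\<in>V. g (torus_proj \<Lambda> y) = torus_proj \<Lambda> (f y))"
proof -
  let ?\<pi> = "torus_proj \<Lambda>"
  have "?\<pi> z \<in> points (torus_atlas \<Lambda>)"
    by (simp add: points_torus_atlas torus_def)
  then have "\<exists>c\<in>torus_atlas \<Lambda>. \<exists>d\<in>torus_atlas \<Lambda>. ?\<pi> z \<in> fst c \<and> g ` fst c \<subseteq> fst d \<and>
      holo_map_on (snd d \<circ> g \<circ> inv_into (fst c) (snd c)) (snd c ` fst c)"
    using assms by (simp add: holomorphic_map_def split_beta)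
  then obtain U \<phi> W \<psi> where U: "(U, \<phi>) \<in> torus_atlas \<Lambda>" and W: "(W, \<psi>) \<in> torus_atlas \<Lambda>"
    and z: "?\<pi> z \<in> U" and g: "g ` U \<subseteq> W"
    and holo: "holo_map_on (\<psi> \<circ> g \<circ> inv_into U \<phi>) (\<phi> ` U)"
    by force
  obtain V where V: "open V" "inj_on ?\<pi> V" "U = ?\<pi> ` V" "\<phi> = (\<lambda>z. z) \<circ> inv_into V ?\<pi>"
    using U unfolding torus_atlas_iff by blast
  obtain V' where V': "open V'" "inj_on ?\<pi> V'" "W = ?\<pi> ` V'" "\<psi> = (\<lambda>z. z) \<circ> inv_into V' ?\<pi>"
    using W unfolding torus_atlas_iff by blast
  have \<phi>: "\<phi> (?\<pi> y) = y" if "y \<in> V" for y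
    using that V by simp
  have image: "\<phi> ` U = V"
    using \<phi> V(3) by (simp add: image_image)
  have inv: "inv_into U \<phi> y = ?\<pi> y" if "y \<in> V" for y
  proof (rule inv_into_f_eq)
    show "inj_on \<phi> U"
      using \<phi> V(3) by (auto intro!: inj_onI)
  qed (use that V(3) \<phi> in auto)
  obtain a where a: "a \<in> V" "?\<pi> z = ?\<pi> a"
    using z V(3) by blast
  let ?h = "\<psi> \<circ> g \<circ> inv_into U \<phi>"
  have lift: "g (?\<pi> y) = ?\<pi> (?h y)" if "y \<in> V" for y
  proof -
    have "g (?\<pi> y) \<in> ?\<pi> ` V'"
      using that g V(3) V'(3) by blast
    then show ?thesis
      using that inv V'(4) by (simp add: f_inv_into_f)
  qed
  \<comment> \<open>The chart inverts the projection on a set V that contains some a congruent to z,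
    not necessarily z itself. Shifting by the lattice vector z - a moves the local lift to a
    neighbourhood of z.\<close>
  define f where "f = (\<lambda>y. ?h (y - (z - a)))"
  have "\<exists>D. (f has_derivative D) (at y) \<and> Vector_Spaces.linear (*s) (*s) D"
    if "y - (z - a) \<in> V" for y
  proof -
    obtain D where D: "(?h has_derivative D) (at (y - (z - a)))" "Vector_Spaces.linear (*s) (*s) D"
      using holo \<open>y - (z - a) \<in> V\<close> unfolding holo_map_on_def image by blast
    have "((\<lambda>y. y - (z - a)) has_derivative (\<lambda>h. h)) (at y)"
      by (auto intro!: derivative_eq_intros)
    from has_derivative_compose[OF this D(1)] have "(f has_derivative D) (at y)"
      unfolding f_def .
    with D(2) show ?thesis by blast
  qed
  then have "holo_map_on f ((\<lambda>y. y + (z - a)) ` V)"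
    unfolding holo_map_on_def by auto
  moreover have "open ((\<lambda>y. y + (z - a)) ` V)"
    using open_translation[OF V(1), of "z - a"] by (simp add: add.commute)
  moreover have "z \<in> (\<lambda>y. y + (z - a)) ` V"
    using a by (auto intro!: image_eqI[of _ _ a])
  moreover have "g (?\<pi> y) = ?\<pi> (f y)" if "y \<in> (\<lambda>y. y + (z - a)) ` V" for y
  proof -
    obtain x where x: "x \<in> V" "y = x + (z - a)"
      using \<open>y \<in> (\<lambda>y. y + (z - a)) ` V\<close> by blast
    have "?\<pi> y = ?\<pi> x"
      using a(2) x(2) by (simp add: torus_proj_eq_iff)
    then show ?thesis
      using lift[OF x(1)] x(2) by (simp add: f_def)
  qed
  ultimately show ?thesis by blast
qed

text \<open>
  Each lattice coordinate of \<open>g\<close> is well defined modulo the integers, so it has a continuous lift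
  because nonvanishing continuous functions on \<open>complex ^ 'n\<close> have continuous logarithms.
\<close>

lemma holomorphic_map_torus_lift:
  assumes "holomorphic_map (torus_atlas \<Lambda>) (torus_atlas \<Lambda>) g"
  shows "\<exists>F. holo_map_on F UNIV \<and> (\<forall>z. g (torus_proj \<Lambda> z) = torus_proj \<Lambda> (F z))"
proof -
  let ?\<pi> = "torus_proj \<Lambda>"
  note local = holomorphic_map_torus_local_lift[OF assms]
  \<comment> \<open>An arbitrary choice of representatives, in general discontinuous. The
    exponentials in \<open>H\<close> do not see the lattice ambiguity and are therefore
    continuous.\<close>
  define R where "R = (\<lambda>z. SOME w. ?\<pi> w = g (?\<pi> z))"
  have R: "?\<pi> (R z) = g (?\<pi> z)" for z
    unfolding R_def by (rule someI_ex) (metis local)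
  define H where "H = (\<lambda>b z. cis (2 * pi * crd b (R z)))"
  have cis_eq: "cis (2 * pi * crd b x) = cis (2 * pi * crd b y)" if "?\<pi> x = ?\<pi> y" "b \<in> B" for b x y
  proof -
    have "crd b x - crd b y \<in> \<int>"
      using that by (simp add: torus_proj_eq_iff mem_iff crd_simps)
    then obtain k where k: "crd b x = crd b y + of_int k"
      by (metis Ints_cases add.commute diff_add_cancel)
    have "cis (2 * pi * crd b x) = cis (2 * pi * crd b y) * cis (2 * pi * of_int k)"
      by (simp only: k cis_mult distrib_left)
    then show ?thesis
      by (simp only: cis_multiple_2pi[OF Ints_of_int] mult_1_right)
  qed
  have cont_H: "continuous_on UNIV (H b)" if "b \<in> B" for b
  proof (rule continuous_at_imp_continuous_on, rule ballI)
    fix z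
    obtain V f where V: "open V" "z \<in> V" "holo_map_on f V" "\<forall>y\<in>V. g (?\<pi> y) = ?\<pi> (f y)"
      using local by blast
    have "H b y = cis (2 * pi * crd b (f y))" if "y \<in> V" for y
      unfolding H_def using cis_eq V(4) R that \<open>b \<in> B\<close> by metis
    moreover have "continuous_on V f"
      using V(3) has_derivative_continuous unfolding holo_map_on_def
      by (blast intro: continuous_at_imp_continuous_on)
    then have "continuous_on V (\<lambda>y. cis (2 * pi * crd b (f y)))"
      by (intro continuous_intros)
    ultimately have "continuous_on V (H b)"
      by (metis (no_types, lifting) continuous_on_cong)
    then show "isCont (H b) z"
      using V(1,2) continuous_on_eq_continuous_at by blast
  qed
  have "\<exists>h. continuous_on UNIV h \<and> (\<forall>z. H b z = exp (h z))" if "b \<in> B" for b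
    by (rule continuous_logarithm_on_contractible[OF cont_H[OF that]])
       (auto simp: H_def convex_imp_contractible)
  then obtain h where h: "\<And>b. b \<in> B \<Longrightarrow> continuous_on UNIV (h b)"
      "\<And>b z. b \<in> B \<Longrightarrow> H b z = exp (h b z)"
    by metis
  \<comment> \<open>Since \<open>H b\<close> has modulus 1, its logarithm is purely imaginary, and
    the imaginary part divided by 2 pi is a continuous version of the coordinate at b.\<close>
  define F where "F = (\<lambda>z. \<Sum>b\<in>B. (Im (h b z) / (2 * pi)) *\<^sub>R b)"
  have cont_F: "continuous_on UNIV F"
    unfolding F_def using h(1) by (intro continuous_intros) auto
  have F: "g (?\<pi> z) = ?\<pi> (F z)" for z
  proof -
    have "crd b (F z - R z) \<in> \<int>" if "b \<in> B" for b
    proof -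
      have "norm (H b z) = 1"
        by (simp add: H_def)
      then have "Re (h b z) = 0"
        using h(2)[OF that] by simp
      then have "H b z = cis (Im (h b z))"
        using h(2)[OF that] by (simp add: exp_eq_polar)
      then have "cis (Im (h b z)) = cis (2 * pi * crd b (R z))"
        by (simp add: H_def)
      then have "sin (Im (h b z)) = sin (2 * pi * crd b (R z)) \<and> cos (Im (h b z)) = cos (2 * pi * crd b (R z))"
        by (simp add: complex_eq_iff)
      then obtain k where "Im (h b z) = 2 * pi * crd b (R z) + 2 * pi * of_int k"
        using sin_cos_eq_iff by blast
      then have "Im (h b z) / (2 * pi) - crd b (R z) = of_int k"
        by (simp add: field_simps)
      moreover have "crd b (F z - R z) = Im (h b z) / (2 * pi) - crd b (R z)"
        unfolding F_def by (simp only: crd_simps(2) crd_of_sum[OF that])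
      ultimately show ?thesis by simp
    qed
    then have "?\<pi> (F z) = ?\<pi> (R z)"
      by (simp add: torus_proj_eq_iff mem_iff)
    then show ?thesis
      using R by simp
  qed
  \<comment> \<open>So far F is only continuous. On a small ball it differs from a holomorphic local
    lift by a constant and so inherits its derivative.\<close>
  have "\<exists>D. (F has_derivative D) (at z) \<and> Vector_Spaces.linear (*s) (*s) D" for z
  proof -
    obtain V f where V: "open V" "z \<in> V" "holo_map_on f V" "\<forall>y\<in>V. g (?\<pi> y) = ?\<pi> (f y)"
      using local by blast
    obtain e where e: "e > 0" "ball z e \<subseteq> V"
      using V(1,2) openE by blast
    have "continuous_on (ball z e) (\<lambda>y. F y - f y)"
    proof (intro continuous_intros)
      show "continuous_on (ball z e) F"
        using cont_F continuous_on_subset by blast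
      show "continuous_on (ball z e) f"
        using V(3) e(2) has_derivative_continuous unfolding holo_map_on_def
        by (blast intro: continuous_at_imp_continuous_on)
    qed
    moreover have "F y - f y \<in> \<Lambda>" if "y \<in> ball z e" for y
    proof -
      have "torus_proj \<Lambda> (F y) = torus_proj \<Lambda> (f y)"
        using F[of y] V(4) that e(2) by auto
      then show ?thesis
        by (simp add: torus_proj_eq_iff)
    qed
    ultimately have "(\<lambda>y. F y - f y) constant_on ball z e"
      by (intro continuous_into_lattice_constant) auto
    then obtain c where "\<And>y. y \<in> ball z e \<Longrightarrow> F y - f y = c"
      unfolding constant_on_def by blast
    then have c: "F y = f y + c" if "y \<in> ball z e" for y
      using that by (simp add: diff_eq_eq add.commute)
    obtain D where D: "(f has_derivative D) (at z)" "Vector_Spaces.linear (*s) (*s) D"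
      using V(2,3) unfolding holo_map_on_def by blast
    have "((\<lambda>y. f y + c) has_derivative (\<lambda>h. D h + 0)) (at z)"
      by (intro has_derivative_add has_derivative_const D)
    then have "(F has_derivative D) (at z)"
      using has_derivative_transform_within_open[of "\<lambda>y. f y + c" D z UNIV "ball z e" F] e(1) c by auto
    with D(2) show ?thesis by blast
  qed
  then show ?thesis
    using F unfolding holo_map_on_def by blast
qed

text \<open>Moving z by a lattice vector changes F z by a constant, so F (z + w) - F z is periodic
  in z and, by Liouville, independent of z. Hence F has the same derivative everywhere, and
  subtracting this linear map leaves a constant.\<close>

lemma holomorphic_map_torus_affine:
  assumes "holomorphic_map (torus_atlas \<Lambda>) (torus_atlas \<Lambda>) g"
  shows "\<exists>A b. \<forall>z. g (torus_proj \<Lambda> z) = torus_proj \<Lambda> (A *v z + b)"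
proof -
  obtain F where holo: "holo_map_on F UNIV"
    and F: "\<And>z. g (torus_proj \<Lambda> z) = torus_proj \<Lambda> (F z)"
    using holomorphic_map_torus_lift[OF assms] by blast
  have diff: "\<exists>D. (F has_derivative D) (at z) \<and> Vector_Spaces.linear (*s) (*s) D" for z
    using holo by (simp add: holo_map_on_def)
  have cont: "continuous_on UNIV F"
    using diff has_derivative_continuous by (blast intro: continuous_at_imp_continuous_on)
  have shift: "\<exists>c. \<forall>z. F (z + l) = F z + c" if "l \<in> \<Lambda>" for l
  proof -
    have "continuous_on UNIV (\<lambda>z. F (z + l) - F z)"
      by (intro continuous_intros continuous_on_compose2[OF cont] cont) auto
    moreover have "F (z + l) - F z \<in> \<Lambda>" for z
    proof -
      have "torus_proj \<Lambda> (z + l) = torus_proj \<Lambda> z"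
        using that by (simp add: torus_proj_eq_iff)
      then have "torus_proj \<Lambda> (F (z + l)) = torus_proj \<Lambda> (F z)"
        using F by metis
      then show ?thesis
        by (simp add: torus_proj_eq_iff)
    qed
    ultimately have "(\<lambda>z. F (z + l) - F z) constant_on UNIV"
      by (intro continuous_into_lattice_constant) auto
    then obtain c where "\<And>z. F (z + l) - F z = c"
      unfolding constant_on_def by blast
    then show ?thesis
      by (auto simp: diff_eq_eq add.commute)
  qed
  have increment: "F (z + w) - F z = F w - F 0" for z w
  proof -
    have "holo_map_on (\<lambda>z. F (z + w) - F z) UNIV"
      unfolding holo_map_on_def
    proof
      fix z
      obtain D D' where D: "(F has_derivative D) (at (z + w))" "Vector_Spaces.linear (*s) (*s) D"
        and D': "(F has_derivative D') (at z)" "Vector_Spaces.linear (*s) (*s) D'"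
        using diff by metis
      have "((\<lambda>z. z + w) has_derivative (\<lambda>h. h)) (at z)"
        by (auto intro!: derivative_eq_intros)
      from has_derivative_diff[OF has_derivative_compose[OF this D(1)] D'(1)]
      have "((\<lambda>z. F (z + w) - F z) has_derivative (\<lambda>h. D h - D' h)) (at z)" .
      moreover have "Vector_Spaces.linear (*s) (*s) (\<lambda>h. D h - D' h)"
        using D(2) D'(2) by (auto simp: clinear_vec_iff vec.scale_right_diff_distrib)
      ultimately show "\<exists>D. ((\<lambda>z. F (z + w) - F z) has_derivative D) (at z) \<and> Vector_Spaces.linear (*s) (*s) D"
        by blast
    qed
    then have "holo_fun_on (\<lambda>z. (F (z + w) - F z) $ i) UNIV" for i
      by (rule holo_fun_on_component)
    moreover have "F (z + l + w) - F (z + l) = F (z + w) - F z" if "l \<in> \<Lambda>" for z l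
    proof -
      obtain c where "\<forall>z. F (z + l) = F z + c"
        using shift[OF \<open>l \<in> \<Lambda>\<close>] by blast
      then have "F (z + w + l) = F (z + w) + c" "F (z + l) = F z + c"
        by auto
      then show ?thesis
        by (simp add: add_ac)
    qed
    ultimately have "(F (z + w) - F z) $ i = (F (0 + w) - F 0) $ i" for i
      by (intro periodic_entire_constant[of "\<lambda>z. (F (z + w) - F z) $ i" z 0]) auto
    then show ?thesis
      by (simp add: Finite_Cartesian_Product.vec_eq_iff)
  qed
  obtain D where D: "(F has_derivative D) (at 0)" "Vector_Spaces.linear (*s) (*s) D"
    using diff by blast
  have "((\<lambda>z. F z - D z) has_derivative (\<lambda>h. 0)) (at z)" for z
  proof -
    have 1: "((\<lambda>y. y - z) has_derivative (\<lambda>h. h)) (at z)"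
      by (auto intro!: derivative_eq_intros)
    have "(F has_derivative D) (at (z - z))"
      using D(1) by simp
    from has_derivative_add[OF has_derivative_compose[OF 1 this] has_derivative_const]
    have "((\<lambda>y. F (y - z) + (F z - F 0)) has_derivative (\<lambda>h. D h + 0)) (at z)" .
    moreover have "F (y - z) + (F z - F 0) = F y" for y
      using increment[of "y - z" z] by (simp add: algebra_simps)
    ultimately have "(F has_derivative D) (at z)"
      by simp
    moreover have "(D has_derivative D) (at z)"
      using D(1) by (intro bounded_linear_imp_has_derivative has_derivative_bounded_linear)
    ultimately show ?thesis
      using has_derivative_diff by fastforce
  qed
  then have "\<exists>c. \<forall>z\<in>UNIV. F z - D z = c"
    by (intro has_derivative_zero_constant) auto
  then obtain c where "\<And>z. F z - D z = c"
    by blast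
  then have "F z = D z + c" for z
    by (simp add: diff_eq_eq add.commute)
  moreover have "matrix D *v z = D z" for z
    by (rule matrix_works[OF D(2)])
  ultimately show ?thesis
    using F by (intro exI[of _ "matrix D"] exI[of _ c]) simp
qed

end

section \<open>The canonical bundle of a hyperelliptic manifold\<close>

locale hyperelliptic_data = lattice_basis +
  fixes G :: "((complex ^ 'a::finite) set \<Rightarrow> (complex ^ 'a) set) set"
  assumes hyp: "hyperelliptic \<Lambda> G"
begin

text \<open>A relation and not a function of g, because b may be changed by any lattice vector. In
  particular all lattice translations represent the identity of G, which is how periodicity
  enters.\<close>

definition affine_rep :: "((complex ^ 'a) set \<Rightarrow> (complex ^ 'a) set) \<Rightarrow> complex ^ 'a ^ 'a \<Rightarrow> complex ^ 'a \<Rightarrow> bool"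
  where "affine_rep g A b \<longleftrightarrow> (\<forall>z. g (tproj z) = tproj (A *v z + b))"

text \<open>The covering map from the vector space onto T / G; the charts of the quotient are local
  inverses of it.\<close>

definition uproj :: "complex ^ 'a \<Rightarrow> (complex ^ 'a) set set" where
  "uproj z = orbit_proj G (tproj z)"

lemma subgroup_G: "subgroup G (BijGroup (torus \<Lambda>))" and finite_G: "finite G"
  using hyp by (auto simp: hyperelliptic_def)

lemma affine_rep_exists:
  assumes "g \<in> G"
  shows "\<exists>A b. affine_rep g A b"
proof -
  have "biholomorphic_map (torus_atlas \<Lambda>) (torus_atlas \<Lambda>) g"
    using hyp assms by (simp add: hyperelliptic_def)
  then show ?thesis
    using holomorphic_map_torus_affine by (simp add: biholomorphic_map_def affine_rep_def)
qed

lemma one_eq: "\<one>\<^bsub>BijGroup (torus \<Lambda>)\<^esub> = (\<lambda>x\<in>torus \<Lambda>. x)"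
  by (simp add: BijGroup_def)

lemma one_mem: "(\<lambda>x\<in>torus \<Lambda>. x) \<in> G"
  using subgroup.one_closed[OF subgroup_G] by (simp add: one_eq)

lemma mult_eq: "g \<in> G \<Longrightarrow> h \<in> G \<Longrightarrow> g \<otimes>\<^bsub>BijGroup (torus \<Lambda>)\<^esub> h = compose (torus \<Lambda>) g h"
  using subgroup.subset[OF subgroup_G] by (auto simp: BijGroup_def)

lemma compose_mem: "g \<in> G \<Longrightarrow> h \<in> G \<Longrightarrow> compose (torus \<Lambda>) g h \<in> G"
  using subgroup.m_closed[OF subgroup_G] mult_eq by metis

lemma inverse_ex:
  assumes "g \<in> G"
  shows "\<exists>h\<in>G. compose (torus \<Lambda>) h g = (\<lambda>x\<in>torus \<Lambda>. x)"
proof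
  let ?S = "BijGroup (torus \<Lambda>)"
  show inv: "inv\<^bsub>?S\<^esub> g \<in> G"
    using subgroup.m_inv_closed[OF subgroup_G assms] .
  have "inv\<^bsub>?S\<^esub> g \<otimes>\<^bsub>?S\<^esub> g = \<one>\<^bsub>?S\<^esub>"
    using group.l_inv[OF group_BijGroup] subgroup.mem_carrier[OF subgroup_G assms] by blast
  then show "compose (torus \<Lambda>) (inv\<^bsub>?S\<^esub> g) g = (\<lambda>x\<in>torus \<Lambda>. x)"
    using mult_eq[OF inv assms] one_eq by simp
qed

lemma uproj_eq_iff: "uproj z = uproj w \<longleftrightarrow> (\<exists>g\<in>G. g (tproj z) = tproj w)"
proof
  assume eq: "uproj z = uproj w"
  have "tproj w \<in> uproj w"
    unfolding uproj_def orbit_proj_def using one_mem by (intro image_eqI) auto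
  then show "\<exists>g\<in>G. g (tproj z) = tproj w"
    unfolding eq[symmetric] by (auto simp: uproj_def orbit_proj_def)
next
  assume "\<exists>g\<in>G. g (tproj z) = tproj w"
  then obtain g where g: "g \<in> G" "g (tproj z) = tproj w" by blast
  obtain h where h: "h \<in> G" "compose (torus \<Lambda>) h g = (\<lambda>x\<in>torus \<Lambda>. x)"
    using inverse_ex[OF g(1)] by blast
  have hw: "h (tproj w) = tproj z"
    using fun_cong[OF h(2), of "tproj z"] g(2) by (simp add: compose_def)
  have sub: "uproj y \<subseteq> uproj x" if "k \<in> G" "k (tproj x) = tproj y" for k x y
  proof
    fix p assume "p \<in> uproj y"
    then obtain f where f: "f \<in> G" "p = f (tproj y)"
      by (auto simp: uproj_def orbit_proj_def)
    then have "p = compose (torus \<Lambda>) f k (tproj x)"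
      using that by (simp add: compose_def)
    then show "p \<in> uproj x"
      unfolding uproj_def orbit_proj_def using compose_mem[OF f(1) that(1)] by blast
  qed
  show "uproj z = uproj w"
    using sub[OF g] sub[OF h(1) hw] by blast
qed

lemma affine_rep_uproj:
  assumes "g \<in> G" "affine_rep g A b"
  shows "uproj (A *v z + b) = uproj z"
  using assms uproj_eq_iff[of z "A *v z + b"] unfolding affine_rep_def by metis

text \<open>An arbitrary lift of g sends z only into the class of w. Correcting b by a lattice
  vector makes it hit w itself, as the comparison of two charts at a common point requires.\<close>

lemma affine_rep_through:
  assumes "uproj z = uproj w"
  shows "\<exists>g\<in>G. \<exists>A b. affine_rep g A b \<and> A *v z + b = w"
proof -
  obtain g where g: "g \<in> G" "g (tproj z) = tproj w"
    using assms unfolding uproj_eq_iff by blast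
  obtain A b where Ab: "affine_rep g A b"
    using affine_rep_exists[OF g(1)] by blast
  define c where "c = b + (w - (A *v z + b))"
  have "tproj w = tproj (A *v z + b)"
    using g(2) Ab by (simp add: affine_rep_def)
  then have l: "w - (A *v z + b) \<in> \<Lambda>"
    by (simp add: torus_proj_eq_iff)
  have "tproj (A *v y + c) = tproj (A *v y + b)" for y
    using l by (simp add: torus_proj_eq_iff c_def algebra_simps)
  then have "affine_rep g A c"
    using Ab by (simp add: affine_rep_def)
  moreover have "A *v z + c = w"
    by (simp add: c_def)
  ultimately show ?thesis
    using g(1) by blast
qed

text \<open>The nested \<open>inv_into\<close> is what two applications of
  \<open>quotient_atlas\<close> to the identity chart on V produce. If \<open>uproj\<close> is
  injective on V, it is simply the inverse of \<open>uproj\<close> there.\<close>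

definition hchart :: "(complex ^ 'a) set \<Rightarrow> ((complex ^ 'a) set set, 'a) chart" where
  "hchart V = (orbit_proj G ` tproj ` V,
     ((\<lambda>z. z) \<circ> inv_into V tproj) \<circ> inv_into (tproj ` V) (orbit_proj G))"

lemma inj_on_uproj_iff: "inj_on uproj V \<longleftrightarrow> inj_on tproj V \<and> inj_on (orbit_proj G) (tproj ` V)"
  by (auto simp: uproj_def comp_inj_on_iff inj_on_def)

lemma hyperelliptic_atlas_eq:
  "hyperelliptic_atlas \<Lambda> G = {hchart V | V. open V \<and> inj_on uproj V}"
  unfolding hyperelliptic_atlas_def quotient_atlas_def[of "orbit_proj G"] torus_atlas_iff
    hchart_def inj_on_uproj_iff by blast

lemma fst_hchart: "fst (hchart V) = uproj ` V"
  by (auto simp: hchart_def uproj_def image_image)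

lemma hchart_uproj:
  assumes "inj_on uproj V" "z \<in> V"
  shows "snd (hchart V) (uproj z) = z"
  using assms unfolding inj_on_uproj_iff by (simp add: hchart_def uproj_def)

lemma hchart_image:
  assumes "inj_on uproj V"
  shows "snd (hchart V) ` fst (hchart V) = V"
  using hchart_uproj[OF assms] by (simp add: fst_hchart image_image)

lemma inv_hchart:
  assumes "inj_on uproj V" "z \<in> V"
  shows "inv_into (fst (hchart V)) (snd (hchart V)) z = uproj z"
proof (rule inv_into_f_eq)
  show "inj_on (snd (hchart V)) (fst (hchart V))"
    using hchart_uproj[OF assms(1)] by (auto simp: fst_hchart intro!: inj_onI)
qed (use assms hchart_uproj in \<open>auto simp: fst_hchart\<close>)

text \<open>Near z the change of charts is the affine map with linear part A, so its Jacobian is A.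
  The two maps are known to agree only where the affine image stays in W, hence the open set
  \<open>?N\<close>.\<close>

lemma canonical_bundle_hchart:
  assumes V: "open V" "inj_on uproj V" and W: "open W" "inj_on uproj W"
    and g: "g \<in> G" "affine_rep g A b" and z: "z \<in> V" "A *v z + b \<in> W"
  shows "canonical_bundle (hchart V) (hchart W) (uproj z) = det A"
proof -
  let ?T = "snd (hchart W) \<circ> inv_into (fst (hchart V)) (snd (hchart V))"
  let ?N = "V \<inter> (\<lambda>y. A *v y + b) -` W"
  have cont: "isCont (\<lambda>y. A *v y + b) y" for y
    by (rule has_derivative_continuous[OF has_derivative_affine])
  have "open ((\<lambda>y. A *v y + b) -` W)"
    by (rule continuous_open_vimage[OF W(1) cont])
  then have "open ?N"
    using V(1) by blast
  moreover have "A *v y + b = ?T y" if "y \<in> ?N" for y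
    using that inv_hchart[OF V(2)] hchart_uproj[OF W(2)] affine_rep_uproj[OF g, of y, symmetric] by simp
  moreover have "z \<in> ?N"
    using z by simp
  ultimately have "(?T has_derivative ((*v) A)) (at z)"
    using has_derivative_transform_within_open[OF has_derivative_affine] by blast
  then have "frechet_derivative ?T (at z) = (*v) A"
    using frechet_derivative_at by metis
  then have "complex_jacobian ?T z = A"
    by (simp add: complex_jacobian_def)
  then show ?thesis
    using hchart_uproj[OF V(2) z(1)] by (simp add: canonical_bundle_def split_beta)
qed

text \<open>The m-th tensor power of the form dz_1 ... dz_n is multiplied by
  \<open>det A ^ m\<close> under an affine lift, so here it descends to the quotient. Its coordinate
  in every chart is the constant 1.\<close>

lemma trivial_if_det_power_eq_1:
  assumes "\<And>g A b. g \<in> G \<Longrightarrow> affine_rep g A b \<Longrightarrow> det A ^ m = 1"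
  shows "trivial_line_bundle (hyperelliptic_atlas \<Lambda> G) (tensor_power m canonical_bundle)"
  unfolding trivial_line_bundle_def
proof (intro exI[of _ "\<lambda>_ _. 1"] conjI ballI)
  fix c assume "c \<in> hyperelliptic_atlas \<Lambda> G"
  have "\<exists>D. ((\<lambda>x. 1) has_derivative D) (at z) \<and> Vector_Spaces.linear (*s) (*) D" for z :: "complex ^ 'a"
    by (rule exI[of _ "\<lambda>_. 0"]) (simp add: clinear_fun_iff)
  then show "case c of (U, \<phi>) \<Rightarrow> (\<forall>x\<in>U. (1 :: complex) \<noteq> 0) \<and>
      holo_fun_on ((\<lambda>_. 1) \<circ> inv_into U \<phi>) (\<phi> ` U)"
    by (simp add: holo_fun_on_def split_beta comp_def)
next
  fix c d x
  assume "c \<in> hyperelliptic_atlas \<Lambda> G" "d \<in> hyperelliptic_atlas \<Lambda> G" and x: "x \<in> fst c \<inter> fst d"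
  then obtain V W where V: "open V" "inj_on uproj V" "c = hchart V"
    and W: "open W" "inj_on uproj W" "d = hchart W"
    unfolding hyperelliptic_atlas_eq by blast
  obtain z w where z: "z \<in> V" "x = uproj z" and w: "w \<in> W" "x = uproj w"
    using x V(3) W(3) by (auto simp: fst_hchart)
  obtain g A b where g: "g \<in> G" "affine_rep g A b" "A *v z + b = w"
    using affine_rep_through[of z w] z(2) w(2) by auto
  have "canonical_bundle c d x = det A"
    unfolding V(3) W(3) z(2) by (rule canonical_bundle_hchart) (use V W g z w in auto)
  then show "1 = tensor_power m canonical_bundle c d x * 1"
    using assms[OF g(1,2)] by (simp add: tensor_power_def)
qed

text \<open>By freeness A z + b - z lies outside the closed set of lattice vectors for each g other
  than the identity, and this persists near z. As G is finite, the resulting neighbourhoods can be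
  intersected.\<close>

lemma inj_on_uproj_neighbourhood: "\<exists>V. open V \<and> z \<in> V \<and> inj_on uproj V"
proof -
  obtain e where e: "e > 0" "\<And>z. inj_on tproj (ball z e)"
    using inj_on_torus_proj_ball by blast
  define G' where "G' = G - {\<lambda>x\<in>torus \<Lambda>. x}"
  have "\<exists>d>0. \<forall>x\<in>ball z d. \<forall>y\<in>ball z d. g (tproj x) \<noteq> tproj y" if "g \<in> G'" for g
  proof -
    have g: "g \<in> G" "g \<noteq> (\<lambda>x\<in>torus \<Lambda>. x)"
      using that by (auto simp: G'_def)
    obtain A b where Ab: "affine_rep g A b"
      using affine_rep_exists[OF g(1)] by blast
    have "g (tproj z) \<noteq> tproj z"
      using hyp g unfolding hyperelliptic_def one_eq by simp
    then have notin: "A *v z + b - z \<notin> \<Lambda>"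
      using Ab by (simp add: affine_rep_def torus_proj_eq_iff)
    have "continuous_on UNIV (\<lambda>x. A *v x + b)"
      by (rule continuous_at_imp_continuous_on) (blast intro: has_derivative_continuous has_derivative_affine)
    \<comment> \<open>The two points vary independently: injectivity must also exclude that g takes
      the class of one point to the class of a different point.\<close>
    then have "continuous_on UNIV (\<lambda>p. A *v fst p + b - snd p)"
      by (intro continuous_intros continuous_on_compose2[of UNIV "\<lambda>x. A *v x + b"]) auto
    then have "open ((\<lambda>p. A *v fst p + b - snd p) -` (- \<Lambda>))"
      using closed_lattice by (intro open_vimage) auto
    moreover have "(z, z) \<in> (\<lambda>p. A *v fst p + b - snd p) -` (- \<Lambda>)"
      using notin by simp
    ultimately obtain X Y where XY: "open X" "open Y" "z \<in> X" "z \<in> Y"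
      "X \<times> Y \<subseteq> (\<lambda>p. A *v fst p + b - snd p) -` (- \<Lambda>)"
      by (rule open_prod_elim) (auto simp del: vimage_Compl)
    obtain d where d: "d > 0" "ball z d \<subseteq> X \<inter> Y"
      using openE[OF open_Int[OF XY(1,2)]] XY(3,4) by blast
    have "g (tproj x) \<noteq> tproj y" if "x \<in> ball z d" "y \<in> ball z d" for x y
    proof -
      have "(x, y) \<in> X \<times> Y"
        using that d(2) by blast
      then have "A *v x + b - y \<notin> \<Lambda>"
        using XY(5) by auto
      then show ?thesis
        using Ab by (simp add: affine_rep_def torus_proj_eq_iff)
    qed
    then show ?thesis using d(1) by blast
  qed
  then obtain d where d: "\<And>g. g \<in> G' \<Longrightarrow> d g > 0"
    "\<And>g x y. g \<in> G' \<Longrightarrow> x \<in> ball z (d g) \<Longrightarrow> y \<in> ball z (d g) \<Longrightarrow> g (tproj x) \<noteq> tproj y"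
    by metis
  define V where "V = ball z e \<inter> (\<Inter>g\<in>G'. ball z (d g))"
  have "finite G'"
    using finite_G by (simp add: G'_def)
  then have "open V"
    by (auto simp: V_def)
  moreover have "z \<in> V"
    using e(1) d(1) by (auto simp: V_def)
  moreover have "inj_on uproj V"
  proof (rule inj_onI)
    fix x y assume x: "x \<in> V" and y: "y \<in> V" and "uproj x = uproj y"
    then obtain g where g: "g \<in> G" "g (tproj x) = tproj y"
      unfolding uproj_eq_iff by blast
    have "g \<notin> G'"
      using d(2)[of g x y] g(2) x y by (auto simp: V_def)
    then have "tproj x = tproj y"
      using g by (auto simp: G'_def)
    then show "x = y"
      using e(2)[of z] x y by (auto simp: V_def inj_on_def)
  qed
  ultimately show ?thesis by blast
qed

lemma affine_rep_translation:
  assumes "l \<in> \<Lambda>"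
  shows "affine_rep (\<lambda>x\<in>torus \<Lambda>. x) (Finite_Cartesian_Product.mat 1) l"
  using assms by (simp add: affine_rep_def torus_proj_eq_iff neg_mem)

text \<open>
  The trivialisation pulls back to a nowhere vanishing entire function \<open>f\<close> with
  \<open>f z = det A ^ m * f (A z + b)\<close> for every affine representative \<open>(A, b)\<close> of an element of \<open>G\<close>;
  translations by lattice vectors show that \<open>f\<close> is periodic, hence constant.
\<close>

lemma det_power_eq_1_if_trivial:
  assumes "trivial_line_bundle (hyperelliptic_atlas \<Lambda> G) (tensor_power m canonical_bundle)"
    and g: "g \<in> G" "affine_rep g A b"
  shows "det A ^ m = 1"
proof -
  obtain h where
    h1: "\<forall>c\<in>hyperelliptic_atlas \<Lambda> G. (\<forall>x\<in>fst c. h c x \<noteq> 0) \<and>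
       holo_fun_on (h c \<circ> inv_into (fst c) (snd c)) (snd c ` fst c)"
    and h2: "\<forall>c\<in>hyperelliptic_atlas \<Lambda> G. \<forall>d\<in>hyperelliptic_atlas \<Lambda> G. \<forall>x\<in>fst c \<inter> fst d.
       h c x = tensor_power m canonical_bundle c d x * h d x"
    using assms(1) unfolding trivial_line_bundle_def case_prod_beta' prod.collapse by (elim exE conjE)
  obtain N where N: "\<And>z. open (N z)" "\<And>z. z \<in> N z" "\<And>z. inj_on uproj (N z)"
    using inj_on_uproj_neighbourhood by metis
  have chart: "hchart (N z) \<in> hyperelliptic_atlas \<Lambda> G" for z
    using N unfolding hyperelliptic_atlas_eq by blast
  define f where "f = (\<lambda>z. h (hchart (N z)) (uproj z))"
  have key: "h (hchart V) (uproj z) = det A ^ m * f (A *v z + b)"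
    if "open V" "inj_on uproj V" "z \<in> V" "g \<in> G" "affine_rep g A b" for V z g A b
  proof -
    let ?w = "A *v z + b"
    have "hchart V \<in> hyperelliptic_atlas \<Lambda> G"
      using that(1,2) unfolding hyperelliptic_atlas_eq by blast
    moreover have "uproj z \<in> fst (hchart V) \<inter> fst (hchart (N ?w))"
      using that N(2)[of ?w] affine_rep_uproj[OF that(4,5), of z] by (auto simp: fst_hchart)
    ultimately have "h (hchart V) (uproj z) =
        tensor_power m canonical_bundle (hchart V) (hchart (N ?w)) (uproj z) * h (hchart (N ?w)) (uproj z)"
      using h2 chart by blast
    also have "canonical_bundle (hchart V) (hchart (N ?w)) (uproj z) = det A"
      by (rule canonical_bundle_hchart) (use that N in auto)
    then have "tensor_power m canonical_bundle (hchart V) (hchart (N ?w)) (uproj z) = det A ^ m"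
      by (simp add: tensor_power_def)
    finally show ?thesis
      using affine_rep_uproj[OF that(4,5), of z] by (simp add: f_def)
  qed
  \<comment> \<open>The identity of G with zero translation turns \<open>key\<close> into
    independence of the chart, so \<open>f\<close> is holomorphic if its chart expressions
    are.\<close>
  have f_on: "h (hchart V) (uproj z) = f z" if "open V" "inj_on uproj V" "z \<in> V" for V z
    using key[OF that one_mem affine_rep_translation[OF zero_mem]] by simp
  have eq: "f z = det A ^ m * f (A *v z + b)" if "g \<in> G" "affine_rep g A b" for z g A b
    using key[OF N(1)[of z] N(3)[of z] N(2)[of z] that] f_on[OF N(1)[of z] N(3)[of z] N(2)[of z]]
    by (simp only:)
  have "holo_fun_on f UNIV"
    unfolding holo_fun_on_def
  proof
    fix z
    let ?c = "hchart (N z)"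
    let ?F = "h ?c \<circ> inv_into (fst ?c) (snd ?c)"
    have "holo_fun_on ?F (N z)"
      using bspec[OF h1 chart[of z]] hchart_image[OF N(3)[of z]] by simp
    then obtain D where D: "(?F has_derivative D) (at z)" "Vector_Spaces.linear (*s) (*) D"
      using N(2) unfolding holo_fun_on_def by blast
    have "?F y = f y" if "y \<in> N z" for y
      using inv_hchart[OF N(3) that] f_on[OF N(1) N(3) that] by (simp only: comp_apply)
    then have "(f has_derivative D) (at z)"
      using has_derivative_transform_within_open[OF D(1) N(1) N(2)] by blast
    with D(2) show "\<exists>D. (f has_derivative D) (at z) \<and> Vector_Spaces.linear (*s) (*) D"
      by blast
  qed
  moreover have "f (z + l) = f z" if "l \<in> \<Lambda>" for z l
    using eq[OF one_mem affine_rep_translation[OF that], of z] by simp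
  ultimately have "f (A *v 0 + b) = f 0"
    by (rule periodic_entire_constant)
  moreover have "f 0 \<noteq> 0"
    using bspec[OF h1 chart[of 0]] N(2)[of 0] by (simp add: f_def fst_hchart)
  ultimately show ?thesis
    using eq[OF g, of 0] by simp
qed

end

section \<open>Eigenvalues of lattice endomorphisms\<close>

text \<open>Triangularisation and characteristic polynomials are used for matrices indexed by an
  initial segment of the naturals, so determinants must be moved along an enumeration f of the index
  type. Conjugation with f matches the permutations and preserves their signs.\<close>

lemma jnf_det_eq:
  fixes A :: "'a::comm_ring_1 ^ 'n ^ 'n"
  assumes f: "bij_betw f {0..<n} (UNIV :: 'n set)"
  shows "Determinant.det (Matrix.mat n n (\<lambda>(i, j). A $ f i $ f j)) = det A"
proof -
  let ?S = "{0..<n}"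
  have bij: "bij_betw (map_permutation ?S f) {p. p permutes ?S} {p. p permutes (UNIV :: 'n set)}"
  proof (rule bij_betw_byWitness[where f' = "map_permutation UNIV (inv_into ?S f)"])
    show "\<forall>p\<in>{p. p permutes ?S}. map_permutation UNIV (inv_into ?S f) (map_permutation ?S f p) = p"
      using f map_permutation_compose_inv[of f ?S UNIV _ "inv_into ?S f"] by (auto simp: bij_betw_def)
    show "\<forall>p\<in>{p. p permutes UNIV}. map_permutation ?S f (map_permutation UNIV (inv_into ?S f) p) = p"
      using f map_permutation_compose_inv[OF bij_betw_inv_into[OF f], of _ f] f_inv_into_f[of _ f ?S]
      by (auto simp: bij_betw_def)
    show "map_permutation ?S f ` {p. p permutes ?S} \<subseteq> {p. p permutes UNIV}"
      using map_permutation_permutes[OF f] by blast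
    show "map_permutation UNIV (inv_into ?S f) ` {p. p permutes UNIV} \<subseteq> {p. p permutes ?S}"
      using map_permutation_permutes[OF bij_betw_inv_into[OF f]] by blast
  qed
  have "det A = (\<Sum>q | q permutes UNIV. of_int (sign q) * (\<Prod>i\<in>UNIV. A $ i $ q i))"
    by (simp add: Determinants.det_def)
  also have "\<dots> = (\<Sum>p | p permutes ?S. of_int (sign (map_permutation ?S f p)) *
      (\<Prod>i\<in>UNIV. A $ i $ map_permutation ?S f p i))"
    by (rule sum.reindex_bij_betw[OF bij, symmetric])
  also have "\<dots> = (\<Sum>p | p permutes ?S. of_int (sign p) * (\<Prod>i = 0..<n. A $ f i $ f (p i)))"
  proof (rule sum.cong[OF refl])
    fix p assume "p \<in> {p. p permutes ?S}"
    then have p: "p permutes ?S" by simp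
    have inj: "inj_on f ?S"
      using f by (auto simp: bij_betw_def)
    have "(\<Prod>i\<in>UNIV. A $ i $ map_permutation ?S f p i) = (\<Prod>i\<in>?S. A $ f i $ map_permutation ?S f p (f i))"
      by (rule prod.reindex_bij_betw[OF f, symmetric])
    also have "\<dots> = (\<Prod>i = 0..<n. A $ f i $ f (p i))"
      by (rule prod.cong) (auto simp: map_permutation_apply[OF inj])
    finally show "of_int (sign (map_permutation ?S f p)) * (\<Prod>i\<in>UNIV. A $ i $ map_permutation ?S f p i) =
        of_int (sign p) * (\<Prod>i = 0..<n. A $ f i $ f (p i))"
      by (simp add: sign_map_permutation[OF inj p])
  qed
  also have "\<dots> = Determinant.det (Matrix.mat n n (\<lambda>(i, j). A $ f i $ f j))"
    unfolding Determinant.det_def by (auto intro!: sum.cong prod.cong simp: permutes_in_image[of _ ?S, simplified])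
  finally show ?thesis ..
qed

lemma jnf_eigenvalue_iff:
  fixes A :: "'a::comm_ring_1 ^ 'n ^ 'n"
  assumes f: "bij_betw f {0..<n} (UNIV :: 'n set)"
  shows "eigenvalue (Matrix.mat n n (\<lambda>(i, j). A $ f i $ f j)) k \<longleftrightarrow> (\<exists>v. v \<noteq> 0 \<and> A *v v = k *s v)"
proof -
  let ?A = "Matrix.mat n n (\<lambda>(i, j). A $ f i $ f j)"
  let ?vec = "\<lambda>v :: 'a ^ 'n. Matrix.vec n (\<lambda>i. v $ f i)"
  have all_f: "(\<forall>i<n. P (f i)) \<longleftrightarrow> (\<forall>i. P i)" for P
    using f unfolding bij_betw_def by (metis UNIV_I atLeastLessThan_iff imageE le0)
  have zero: "?vec v = 0\<^sub>v n \<longleftrightarrow> v = 0" for v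
    using all_f[of "\<lambda>i. v $ i = 0"] by (auto simp: Matrix.vec_eq_iff Finite_Cartesian_Product.vec_eq_iff)
  have mult: "?A *\<^sub>v ?vec v = ?vec (A *v v)" for v
  proof (rule eq_vecI)
    fix i assume "i < dim_vec (?vec (A *v v))"
    then have i: "i < n" by simp
    have "(\<Sum>j = 0..<n. A $ f i $ f j * v $ f j) = (\<Sum>j\<in>UNIV. A $ f i $ j * v $ j)"
      by (rule sum.reindex_bij_betw[OF f])
    then show "vec_index (?A *\<^sub>v ?vec v) i = vec_index (?vec (A *v v)) i"
      using i by (simp add: scalar_prod_def matrix_vector_mult_def)
  qed simp
  have eq: "?vec v = ?vec w \<longleftrightarrow> v = w" for v w
    using all_f[of "\<lambda>i. v $ i = w $ i"] by (auto simp: Matrix.vec_eq_iff Finite_Cartesian_Product.vec_eq_iff)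
  have smult: "k \<cdot>\<^sub>v ?vec v = ?vec (k *s v)" for v
    by (rule eq_vecI) auto
  have onto: "\<exists>v. w = ?vec v" if "w \<in> carrier_vec n" for w
  proof
    show "w = ?vec (\<chi> i. vec_index w (inv_into {0..<n} f i))"
      using that f by (intro eq_vecI) (auto simp: bij_betw_def inv_into_f_f)
  qed
  show ?thesis
  proof
    assume "eigenvalue ?A k"
    then obtain w where w: "w \<in> carrier_vec n" "w \<noteq> 0\<^sub>v n" "?A *\<^sub>v w = k \<cdot>\<^sub>v w"
      by (auto simp: eigenvalue_def eigenvector_def)
    obtain v where v: "w = ?vec v"
      using onto[OF w(1)] by blast
    have "v \<noteq> 0"
      using w(2) unfolding v zero .
    moreover have "A *v v = k *s v"
      using w(3) unfolding v mult smult eq .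
    ultimately show "\<exists>v. v \<noteq> 0 \<and> A *v v = k *s v" by blast
  next
    assume "\<exists>v. v \<noteq> 0 \<and> A *v v = k *s v"
    then obtain v where v: "v \<noteq> 0" "A *v v = k *s v" by blast
    have "?vec v \<noteq> 0\<^sub>v n" "?A *\<^sub>v ?vec v = k \<cdot>\<^sub>v ?vec v"
      unfolding zero mult smult eq using v by auto
    then have "eigenvector ?A (?vec v) k"
      by (simp add: eigenvector_def)
    then show "eigenvalue ?A k"
      unfolding eigenvalue_def by blast
  qed
qed

text \<open>One list has to describe both the characteristic polynomial and the determinant, with
  multiplicities; the diagonal of a similar triangular matrix does so.\<close>

lemma char_poly_triangularised:
  assumes A: "(A :: complex Matrix.mat) \<in> carrier_mat n n"
  obtains as where "length as = n" "char_poly A = (\<Prod>a\<leftarrow>as. [:- a, 1:])" "Determinant.det A = prod_list as"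
proof -
  obtain es where "char_poly A = (\<Prod>a\<leftarrow>es. [:- a, 1:])"
    using char_poly_factorized[OF A] by blast
  then obtain T where T: "T \<in> carrier_mat n n" "upper_triangular T" "similar_mat A T"
    using schur_decomposition_exists[OF A] by blast
  show thesis
  proof
    show "length (diag_mat T) = n"
      using T(1) by (simp add: diag_mat_def)
    show "char_poly A = (\<Prod>a\<leftarrow>diag_mat T. [:- a, 1:])"
      using char_poly_similar[OF T(3)] char_poly_upper_triangular[OF T(1,2)] by simp
    show "Determinant.det A = prod_list (diag_mat T)"
      using det_similar[OF T(3)] det_upper_triangular[OF T(2,1)] by simp
  qed
qed

lemma char_poly_cnj:
  assumes A: "(A :: complex Matrix.mat) \<in> carrier_mat n n" and as: "char_poly A = (\<Prod>a\<leftarrow>as. [:- a, 1:])"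
  shows "char_poly (map_mat cnj A) = (\<Prod>a\<leftarrow>as. [:- cnj a, 1:])"
proof -
  interpret cnj: comm_ring_hom cnj
    by unfold_locales auto
  interpret map_poly_cnj: map_poly_comm_ring_hom cnj ..
  have "char_poly (map_mat cnj A) = map_poly cnj (\<Prod>a\<leftarrow>as. [:- a, 1:])"
    by (simp add: cnj.char_poly_hom[OF A] as)
  also have "\<dots> = (\<Prod>a\<leftarrow>as. [:- cnj a, 1:])"
    by (induction as) (simp_all add: map_poly_cnj.hom_mult map_poly_pCons del: mult_pCons_left mult_pCons_right)
  finally show ?thesis .
qed

lemma char_poly_intertwined:
  assumes carrier: "A \<in> carrier_mat n n" "M \<in> carrier_mat n n" "Q \<in> carrier_mat n n"
    and Q: "Determinant.det Q \<noteq> (0 :: 'a :: field)" and AQ: "A * Q = Q * M"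
  shows "char_poly A = char_poly M"
proof -
  have "Q \<in> Units (ring_mat TYPE('a) n ())"
    by (rule det_non_zero_imp_unit[OF carrier(3) Q])
  then obtain R where R: "R \<in> carrier_mat n n" "Q * R = 1\<^sub>m n" "R * Q = 1\<^sub>m n"
    by (auto simp: Units_def ring_mat_def)
  have "Q * M * R = A * Q * R"
    by (simp add: AQ)
  also have "\<dots> = A"
    using carrier R by (simp add: assoc_mult_mat[of A n n Q n R n])
  finally have "similar_mat A M"
    using carrier R by (intro similar_matI[of _ _ Q R n]) auto
  then show ?thesis
    by (rule char_poly_similar)
qed

lemma (in lattice_basis) card_basis: "card B = 2 * CARD('n)"
proof -
  have "card B = dim (UNIV :: (complex ^ 'n) set)"
    using dim_span_eq_card_independent[OF indep] spanning by simp
  then show ?thesis by simp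
qed

text \<open>
  In terms of a lattice basis \<open>A \<oplus> cnj A\<close> becomes an integer matrix: the basis is a basis of \<open>complex ^ 'n\<close>
  over the reals, hence of its complexification.
\<close>

lemma (in lattice_basis) eigenvalues_lattice_endomorphism:
  fixes A :: "complex ^ 'n ^ 'n"
  assumes stable: "\<And>l. l \<in> \<Lambda> \<Longrightarrow> A *v l \<in> \<Lambda>"
  obtains as :: "complex list" and P :: "int poly" where
    "length as = CARD('n)" "det A = prod_list as"
    "map_poly of_int P = (\<Prod>a\<leftarrow>as. [:- a, 1:] * [:- cnj a, 1:])"
    "\<And>a. a \<in> set as \<longleftrightarrow> (\<exists>v. v \<noteq> 0 \<and> A *v v = a *s v)"
proof -
  define n where "n = CARD('n)"
  obtain f where f: "bij_betw f {0..<n} (UNIV :: 'n set)"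
    using ex_bij_betw_nat_finite[of "UNIV :: 'n set"] by (auto simp: n_def)
  obtain g where g: "bij_betw g {0..<n + n} B"
    using ex_bij_betw_nat_finite[OF finite_basis] card_basis by (auto simp: n_def mult_2)
  define A' where "A' = Matrix.mat n n (\<lambda>(i, j). A $ f i $ f j)"
  have A': "A' \<in> carrier_mat n n"
    by (simp add: A'_def)
  \<comment> \<open>A preserves the lattice, so the coordinates are integers already and the floor
    only changes their type.\<close>
  define M where "M = Matrix.mat (n + n) (n + n) (\<lambda>(i, j). \<lfloor>crd (g i) (A *v g j)\<rfloor>)"
  \<comment> \<open>Column j is the basis vector \<open>g j\<close> with its conjugate below, so
    that \<open>A2 * Q = Q * M\<close> says that M describes A in the lattice basis.\<close>
  define Q where "Q = Matrix.mat (n + n) (n + n) (\<lambda>(i, j). if i < n then g j $ f i else cnj (g j $ f (i - n)))"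
  define A2 where "A2 = four_block_mat A' (0\<^sub>m n n) (0\<^sub>m n n) (map_mat cnj A')"
  have carrier: "A2 \<in> carrier_mat (n + n) (n + n)" "M \<in> carrier_mat (n + n) (n + n)"
    "Q \<in> carrier_mat (n + n) (n + n)" "map_mat complex_of_int M \<in> carrier_mat (n + n) (n + n)"
    using A' by (auto simp: A2_def M_def Q_def)
  have gB: "g j \<in> B" if "j < n + n" for j
    using g that by (auto simp: bij_betw_def)
  have expand: "(\<Sum>i = 0..<n + n. complex_of_int \<lfloor>crd (g i) (A *v g j)\<rfloor> * g i $ k) = (A *v g j) $ k"
    if "j < n + n" for j k
  proof -
    have "A *v g j = (\<Sum>b\<in>B. crd b (A *v g j) *\<^sub>R b)"
      by (simp add: crd_sum)
    also have "\<dots> = (\<Sum>i = 0..<n + n. crd (g i) (A *v g j) *\<^sub>R g i)"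
      by (rule sum.reindex_bij_betw[OF g, symmetric])
    finally have "A *v g j = (\<Sum>i = 0..<n + n. crd (g i) (A *v g j) *\<^sub>R g i)" .
    from arg_cong[OF this, of "\<lambda>v. v $ k"]
    have "(A *v g j) $ k = (\<Sum>i = 0..<n + n. crd (g i) (A *v g j) *\<^sub>R g i $ k)"
      by (simp only: sum_component vector_scaleR_component)
    also have "\<dots> = (\<Sum>i = 0..<n + n. complex_of_int \<lfloor>crd (g i) (A *v g j)\<rfloor> * g i $ k)"
    proof (rule sum.cong[OF refl])
      fix i assume "i \<in> {0..<n + n}"
      then have "crd (g i) (A *v g j) \<in> \<int>"
        using stable[OF basis_mem[OF gB[OF that]]] gB[of i] by (auto simp: mem_iff)
      then have "crd (g i) (A *v g j) = of_int \<lfloor>crd (g i) (A *v g j)\<rfloor>"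
        by simp
      then show "crd (g i) (A *v g j) *\<^sub>R g i $ k = complex_of_int \<lfloor>crd (g i) (A *v g j)\<rfloor> * g i $ k"
        by (metis of_real_of_int_eq scaleR_conv_of_real)
    qed
    finally show ?thesis ..
  qed
  have A'g: "(\<Sum>l = 0..<n. A $ f i $ f l * g j $ f l) = (A *v g j) $ f i" for i j
    using sum.reindex_bij_betw[OF f, of "\<lambda>l. A $ f i $ l * g j $ l"]
    by (simp add: matrix_vector_mult_def)
  have "A2 * Q = Q * map_mat complex_of_int M"
  proof (rule eq_matI)
    fix i j assume "i < dim_row (Q * map_mat complex_of_int M)" "j < dim_col (Q * map_mat complex_of_int M)"
    then have ij: "i < n + n" "j < n + n"
      using carrier by auto
    have split: "(\<Sum>l = 0..<n + n. h l) = (\<Sum>l = 0..<n. h l) + (\<Sum>l = 0..<n. h (l + n))" for h :: "nat \<Rightarrow> complex"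
      using sum.atLeastLessThan_concat[of 0 n "n + n" h] sum.shift_bounds_nat_ivl[of h 0 n n] by simp
    have lhs: "(A2 * Q) $$ (i, j) = (\<Sum>l = 0..<n + n. A2 $$ (i, l) * Q $$ (l, j))"
      using ij carrier by (simp add: scalar_prod_def)
    have rhs: "(Q * map_mat complex_of_int M) $$ (i, j) =
        (\<Sum>l = 0..<n + n. Q $$ (i, l) * complex_of_int \<lfloor>crd (g l) (A *v g j)\<rfloor>)"
      using ij carrier by (simp add: scalar_prod_def M_def)
    show "(A2 * Q) $$ (i, j) = (Q * map_mat complex_of_int M) $$ (i, j)"
    proof (cases "i < n")
      case True
      have "(A2 * Q) $$ (i, j) = (\<Sum>l = 0..<n. A $ f i $ f l * g j $ f l)"
        unfolding lhs split using True ij A' by (simp add: A2_def Q_def A'_def)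
      also have "\<dots> = (Q * map_mat complex_of_int M) $$ (i, j)"
        unfolding A'g rhs expand[OF ij(2), symmetric] using True ij
        by (intro sum.cong) (simp_all add: Q_def mult.commute)
      finally show ?thesis .
    next
      case False
      have "(A2 * Q) $$ (i, j) = cnj (\<Sum>l = 0..<n. A $ f (i - n) $ f l * g j $ f l)"
        unfolding lhs split using False ij A' by (simp add: A2_def Q_def A'_def)
      also have "\<dots> = (Q * map_mat complex_of_int M) $$ (i, j)"
        unfolding A'g rhs expand[OF ij(2), symmetric] using False ij
        by (simp add: Q_def mult.commute)
      finally show ?thesis .
    qed
  qed (use carrier in auto)
  \<comment> \<open>A kernel vector c yields a relation between the basis vectors with coefficients
    \<open>c j\<close> and, from the conjugated rows, one with coefficients
    \<open>cnj (c j)\<close>. The real and imaginary parts are then real relations, hence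
    zero.\<close>
  moreover have "Determinant.det Q \<noteq> 0"
  proof
    assume "Determinant.det Q = 0"
    then obtain w where w: "w \<in> carrier_vec (n + n)" "w \<noteq> 0\<^sub>v (n + n)" "Q *\<^sub>v w = 0\<^sub>v (n + n)"
      using det_0_iff_vec_prod_zero[OF carrier(3)] by blast
    define c where "c = vec_index w"
    have entry: "(\<Sum>j = 0..<n + n. Q $$ (i, j) * c j) = 0" if "i < n + n" for i
    proof -
      have "vec_index (Q *\<^sub>v w) i = (\<Sum>j = 0..<n + n. Q $$ (i, j) * c j)"
        using that carrier(3) w(1) by (simp add: scalar_prod_def c_def)
      then show ?thesis
        using w(3) that by simp
    qed
    have sum1: "(\<Sum>j = 0..<n + n. g j $ f i * c j) = 0" if "i < n" for i
      using entry[of i] that by (simp add: Q_def)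
    have sum2: "(\<Sum>j = 0..<n + n. g j $ f i * cnj (c j)) = 0" if "i < n" for i
    proof -
      have "(\<Sum>j = 0..<n + n. cnj (g j $ f i) * c j) = 0"
        using entry[of "i + n"] that by (simp add: Q_def)
      then have "cnj (\<Sum>j = 0..<n + n. cnj (g j $ f i) * c j) = 0"
        by (simp only: complex_cnj_zero)
      then show ?thesis by simp
    qed
    have indep_real: "r j = 0" if "\<And>i. i < n \<Longrightarrow> (\<Sum>j = 0..<n + n. g j $ f i * of_real (r j)) = 0" "j < n + n" for r j
    proof -
      have "(\<Sum>j = 0..<n + n. r j *\<^sub>R g j) $ k = 0" for k
      proof -
        obtain i where "i < n" "k = f i"
          using f by (auto simp: bij_betw_def) (metis UNIV_I atLeastLessThan_iff imageE)
        then show ?thesis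
          unfolding sum_component vector_scaleR_component
          using that(1)[of i] by (simp add: scaleR_conv_of_real mult.commute)
      qed
      then have "(\<Sum>j = 0..<n + n. r j *\<^sub>R g j) = 0"
        by (simp add: Finite_Cartesian_Product.vec_eq_iff)
      then have "(\<Sum>b\<in>B. r (inv_into {0..<n + n} g b) *\<^sub>R b) = 0"
        using g by (subst sum.reindex_bij_betw[OF g, symmetric]) (simp add: bij_betw_def inv_into_f_f)
      then have "crd (g j) 0 = r (inv_into {0..<n + n} g (g j))"
        using crd_of_sum[OF gB[OF that(2)], of "\<lambda>b. r (inv_into {0..<n + n} g b)"] by simp
      then show ?thesis
        using that(2) g by (simp add: crd_simps bij_betw_def inv_into_f_f)
    qed
    have "c j = 0" if "j < n + n" for j
    proof -
      have "Re (c j) = 0"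
      proof (rule indep_real[OF _ that])
        fix i assume i: "i < n"
        have "(\<Sum>j = 0..<n + n. g j $ f i * of_real (Re (c j))) =
            ((\<Sum>j = 0..<n + n. g j $ f i * c j) + (\<Sum>j = 0..<n + n. g j $ f i * cnj (c j))) / 2"
          unfolding sum.distrib[symmetric] sum_divide_distrib
          by (intro sum.cong refl) (simp add: complex_eq_iff)
        then show "(\<Sum>j = 0..<n + n. g j $ f i * of_real (Re (c j))) = 0"
          using sum1[OF i] sum2[OF i] by simp
      qed
      moreover have "Im (c j) = 0"
      proof (rule indep_real[OF _ that])
        fix i assume i: "i < n"
        have "(\<Sum>j = 0..<n + n. g j $ f i * of_real (Im (c j))) =
            ((\<Sum>j = 0..<n + n. g j $ f i * c j) - (\<Sum>j = 0..<n + n. g j $ f i * cnj (c j))) / (2 * \<i>)"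
          unfolding sum_subtractf[symmetric] sum_divide_distrib
          by (intro sum.cong refl) (simp add: complex_eq_iff divide_simps)
        then show "(\<Sum>j = 0..<n + n. g j $ f i * of_real (Im (c j))) = 0"
          using sum1[OF i] sum2[OF i] by simp
      qed
      ultimately show ?thesis by (simp add: complex_eq_iff)
    qed
    then have "w = 0\<^sub>v (n + n)"
      using w(1) by (intro eq_vecI) (auto simp: c_def)
    with w(2) show False by simp
  qed
  ultimately have char: "char_poly A2 = char_poly (map_mat complex_of_int M)"
    using char_poly_intertwined carrier by blast
  obtain as where as: "length as = n" "char_poly A' = (\<Prod>a\<leftarrow>as. [:- a, 1:])" "Determinant.det A' = prod_list as"
    using char_poly_triangularised[OF A'] .
  have cnj: "char_poly (map_mat cnj A') = (\<Prod>a\<leftarrow>as. [:- cnj a, 1:])"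
    by (rule char_poly_cnj[OF A' as(2)])
  have "char_poly A2 = char_poly A' * char_poly (map_mat cnj A')"
  proof (rule char_poly_0_block[OF A2_def _ _ A'])
    show "\<exists>es. char_poly (map_mat cnj A') = (\<Prod>a\<leftarrow>es. [:- a, 1:])"
      using char_poly_factorized[of "map_mat cnj A'" n] A' by auto
  qed (use as A' in auto)
  also have "\<dots> = (\<Prod>a\<leftarrow>as. [:- a, 1:]) * (\<Prod>a\<leftarrow>as. [:- cnj a, 1:])"
    by (simp only: as(2) cnj)
  also have "\<dots> = (\<Prod>a\<leftarrow>as. [:- a, 1:] * [:- cnj a, 1:])"
    by (induction as) (simp_all only: list.map prod_list.Cons prod_list.Nil mult_1_left mult_ac)
  finally have poly: "map_poly complex_of_int (char_poly M) = (\<Prod>a\<leftarrow>as. [:- a, 1:] * [:- cnj a, 1:])"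
    using char of_int_hom.char_poly_hom[OF carrier(2), where ?'a = complex] by simp
  have eig: "a \<in> set as \<longleftrightarrow> (\<exists>v. v \<noteq> 0 \<and> A *v v = a *s v)" for a
  proof -
    have "a \<in> set as \<longleftrightarrow> poly (char_poly A') a = 0"
      unfolding as(2) by (induction as) (auto simp: poly_prod_list)
    also have "\<dots> \<longleftrightarrow> eigenvalue A' a"
      by (rule eigenvalue_root_char_poly[OF A', symmetric])
    also have "\<dots> \<longleftrightarrow> (\<exists>v. v \<noteq> 0 \<and> A *v v = a *s v)"
      unfolding A'_def by (rule jnf_eigenvalue_iff[OF f])
    finally show ?thesis .
  qed
  have "det A = prod_list as"
    using as(3) jnf_det_eq[OF f, of A] by (simp add: A'_def)
  with as(1) show thesis
    using that poly eig unfolding n_def by blast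
qed

section \<open>Unimodular numbers with integral symmetric functions\<close>

lemma unimodular_quadratic:
  assumes "norm (a :: complex) = 1"
  shows "a\<^sup>2 = of_real (2 * Re a) * a - 1"
proof -
  have "a * cnj a = 1"
    using assms by (simp flip: complex_norm_square)
  moreover have "of_real (2 * Re a) = a + cnj a"
    by (simp add: complex_add_cnj)
  ultimately show ?thesis
    by (simp add: algebra_simps power2_eq_square)
qed

text \<open>The values -2, -1, 0, 1, 2 of u belong to roots of unity of order 2, 3, 4, 6, 1.\<close>

lemma power_12_eq_1:
  assumes a: "(a :: complex)\<^sup>2 = of_real u * a - 1" and u: "u \<in> \<int>" "\<bar>u\<bar> \<le> 2"
  shows "a ^ 12 = 1"
proof -
  obtain k where k: "u = of_int k"
    using u(1) Ints_cases by blast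
  have "\<bar>k\<bar> \<le> 2"
    using u(2) k by linarith
  then consider "k = -2" | "k = -1" | "k = 0" | "k = 1" | "k = 2" by linarith
  then show ?thesis
  proof cases
    case 1
    then have "a\<^sup>2 = - 2 * a - 1"
      using a k by simp
    then have "(a + 1)\<^sup>2 = 0"
      by Groebner_Basis.algebra
    then have "a = -1"
      by (simp add: eq_neg_iff_add_eq_0)
    then show ?thesis by simp
  next
    case 2
    then have "a\<^sup>2 = - a - 1"
      using a k by simp
    then have "a ^ 3 = 1"
      by Groebner_Basis.algebra
    then have "(a ^ 3) ^ 4 = 1" by simp
    then show ?thesis by (simp flip: power_mult)
  next
    case 3
    then have "(a\<^sup>2) ^ 6 = 1"
      using a k by simp
    then show ?thesis by (simp flip: power_mult)
  next
    case 4
    then have "a\<^sup>2 = a - 1"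
      using a k by simp
    then have "a ^ 3 = -1"
      by Groebner_Basis.algebra
    then have "(a ^ 3) ^ 4 = 1" by simp
    then show ?thesis by (simp flip: power_mult)
  next
    case 5
    then have "a\<^sup>2 = 2 * a - 1"
      using a k by simp
    then have "(a - 1)\<^sup>2 = 0"
      by Groebner_Basis.algebra
    then have "a = 1" by simp
    then show ?thesis by simp
  qed
qed

text \<open>u and v are the roots of x^2 - s x + p with integral s and p. This polynomial is
  nonnegative at 2 and -2 and has nonnegative discriminant, which leaves finitely many pairs. The
  four irreducible ones have the root \<open>2 * cos (2 * pi / N)\<close> for N = 8, 12, 10, 5, in
  the order of the alternatives.\<close>

lemma int_root_of_quadratic:
  assumes "u + v \<in> \<int>" "u * v \<in> \<int>" "\<bar>u\<bar> \<le> 2" "\<bar>v\<bar> \<le> (2::real)"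
  shows "u \<in> \<int> \<and> v \<in> \<int> \<or> u\<^sup>2 = 2 \<and> v\<^sup>2 = 2 \<or> u\<^sup>2 = 3 \<and> v\<^sup>2 = 3 \<or>
    u\<^sup>2 = u + 1 \<and> v\<^sup>2 = v + 1 \<or> u\<^sup>2 = 1 - u \<and> v\<^sup>2 = 1 - v"
proof -
  obtain s p where sp: "u + v = of_int s" "u * v = of_int p"
    using assms(1,2) by (auto elim!: Ints_cases)
  have u: "u\<^sup>2 = of_int s * u - of_int p" and v: "v\<^sup>2 = of_int s * v - of_int p"
    unfolding sp[symmetric] by (simp_all add: power2_eq_square algebra_simps)
  have "0 \<le> (2 - u) * (2 - v)" "0 \<le> (2 + u) * (2 + v)"
    using assms(3,4) by (auto intro!: mult_nonneg_nonneg)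
  then have "0 \<le> 4 - 2 * real_of_int s + of_int p" "0 \<le> 4 + 2 * real_of_int s + of_int p"
    unfolding sp[symmetric] by (simp_all add: algebra_simps)
  then have bounds: "0 \<le> 4 - 2 * s + p" "0 \<le> 4 + 2 * s + p"
    by linarith+
  have "0 \<le> (u - v)\<^sup>2" by simp
  also have "(u - v)\<^sup>2 = of_int (s\<^sup>2 - 4 * p)"
    unfolding of_int_diff of_int_power of_int_mult sp[symmetric]
    by (simp add: power2_eq_square algebra_simps)
  finally have disc: "4 * p \<le> s\<^sup>2"
    by (simp only: of_int_0_le_iff diff_ge_0_iff_ge)
  have "\<bar>s\<bar> \<le> 4"
    using assms(3,4) sp(1) by linarith
  then have "s \<in> {-4, -3, -2, -1, 0, 1, 2, 3, 4}"
    by auto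
  then have cases: "(s, p) \<in> {(0, -4), (0, -3), (0, -2), (0, -1), (0, 0), (1, -2), (1, -1), (1, 0),
      (-1, -2), (-1, -1), (-1, 0), (2, 0), (2, 1), (-2, 0), (-2, 1), (3, 2), (-3, 2), (4, 4), (-4, 4)}"
    using bounds disc by (elim insertE emptyE; simp; presburger)
  have int: "u \<in> \<int> \<and> v \<in> \<int>" if "u = of_int k" for k
  proof -
    have "v = of_int (s - k)"
      using that sp(1) by simp
    then show ?thesis
      using that by simp
  qed
  have factor: "u \<in> \<int> \<and> v \<in> \<int>" if "s = j + k" "p = j * k" for j k
  proof -
    have "(u - of_int j) * (u - of_int k) = 0"
      using u that by (simp add: power2_eq_square algebra_simps)
    then show ?thesis
      using int[of j] int[of k] by auto
  qed
  \<comment> \<open>Fifteen of the nineteen pairs split over the integers and fall to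
    \<open>factor\<close>; the remaining four are the irrational alternatives.\<close>
  show ?thesis
    using cases u v factor[of 2 "-2"] factor[of 1 "-1"] factor[of 0 0] factor[of 2 "-1"] factor[of 1 0]
      factor[of 1 "-2"] factor[of "-1" 0] factor[of 2 0] factor[of 1 1] factor[of "-2" 0]
      factor[of "-1" "-1"] factor[of 1 2] factor[of "-1" "-2"] factor[of 2 2] factor[of "-2" "-2"]
    by (elim insertE emptyE) auto
qed

text \<open>In the five cases the product has exponent 12, 4, 6, 5, 5. The exponent 4 for a pair of
  order 8, where both fourth powers are -1, is the reason why 60 suffices instead of 120.\<close>

lemma mult_power_60_eq_1:
  assumes a: "(a :: complex)\<^sup>2 = of_real u * a - 1" and b: "(b :: complex)\<^sup>2 = of_real v * b - 1"
    and uv: "u + v \<in> \<int>" "u * v \<in> \<int>" "\<bar>u\<bar> \<le> 2" "\<bar>v\<bar> \<le> (2::real)"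
  shows "(a * b) ^ 60 = 1"
proof -
  consider "u \<in> \<int>" "v \<in> \<int>" | "u\<^sup>2 = 2" "v\<^sup>2 = 2" | "u\<^sup>2 = 3" "v\<^sup>2 = 3"
    | "u\<^sup>2 = u + 1" "v\<^sup>2 = v + 1" | "u\<^sup>2 = 1 - u" "v\<^sup>2 = 1 - v"
    using int_root_of_quadratic[OF uv] by blast
  then show ?thesis
  proof cases
    case 1
    then have "a ^ 12 = 1" "b ^ 12 = 1"
      using power_12_eq_1 a b uv by blast+
    then have "((a * b) ^ 12) ^ 5 = 1"
      by (simp add: power_mult_distrib)
    then show ?thesis by (simp flip: power_mult)
  next
    case 2
    have *: "c ^ 4 = -1" if "c\<^sup>2 = of_real t * c - 1" "t\<^sup>2 = 2" for c :: complex and t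
    proof -
      have "(complex_of_real t)\<^sup>2 = 2"
        using arg_cong[OF that(2), of complex_of_real] by simp
      with that(1) show ?thesis by Groebner_Basis.algebra
    qed
    then have "((a * b) ^ 4) ^ 15 = 1"
      using *[OF a] *[OF b] 2 by (simp add: power_mult_distrib)
    then show ?thesis by (simp flip: power_mult)
  next
    case 3
    have *: "c ^ 6 = -1" if "c\<^sup>2 = of_real t * c - 1" "t\<^sup>2 = 3" for c :: complex and t
    proof -
      have "(complex_of_real t)\<^sup>2 = 3"
        using arg_cong[OF that(2), of complex_of_real] by simp
      with that(1) show ?thesis by Groebner_Basis.algebra
    qed
    then have "((a * b) ^ 6) ^ 10 = 1"
      using *[OF a] *[OF b] 3 by (simp add: power_mult_distrib)
    then show ?thesis by (simp flip: power_mult)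
  next
    case 4
    have *: "c ^ 5 = -1" if "c\<^sup>2 = of_real t * c - 1" "t\<^sup>2 = t + 1" for c :: complex and t
    proof -
      have "(complex_of_real t)\<^sup>2 = of_real t + 1"
        using arg_cong[OF that(2), of complex_of_real] by simp
      with that(1) show ?thesis by Groebner_Basis.algebra
    qed
    then have "((a * b) ^ 5) ^ 12 = 1"
      using *[OF a] *[OF b] 4 by (simp add: power_mult_distrib)
    then show ?thesis by (simp flip: power_mult)
  next
    case 5
    have *: "c ^ 5 = 1" if "c\<^sup>2 = of_real t * c - 1" "t\<^sup>2 = 1 - t" for c :: complex and t
    proof -
      have "(complex_of_real t)\<^sup>2 = 1 - of_real t"
        using arg_cong[OF that(2), of complex_of_real] by simp
      with that(1) show ?thesis by Groebner_Basis.algebra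
    qed
    then have "((a * b) ^ 5) ^ 12 = 1"
      using *[OF a] *[OF b] 5 by (simp add: power_mult_distrib)
    then show ?thesis by (simp flip: power_mult)
  qed
qed

text \<open>The triple stands for x^3 - s x^2 + p x - q with three irrational roots in (-2, 2). The
  hypotheses record the signs of the cubic and of its derivative at 2 and -2, that 0, 1, -1 are not
  roots, and that the discriminant is nonnegative. The survivors are the minimal polynomials of
  \<open>2 * cos (2 * pi / N)\<close> for N = 7, 9, 18, 14.\<close>

lemma totally_real_cubics_in_interval:
  fixes s p q :: int
  assumes "\<bar>s\<bar> \<le> 5" "\<bar>p\<bar> \<le> 12" "\<bar>q\<bar> \<le> 8" "3 * p \<le> s * s" "0 < 12 - 4 * s + p" "0 < 12 + 4 * s + p"
    and "0 < 8 - 4 * s + 2 * p - q" "0 < 8 + 4 * s + 2 * p + q"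
    and "1 - s + p - q \<noteq> 0" "1 + s + p + q \<noteq> 0" "q \<noteq> 0"
    and "0 \<le> s * s * p * p - 4 * p * p * p - 4 * s * s * s * q + 18 * s * p * q - 27 * q * q"
  shows "(s, p, q) \<in> {(-1, -2, 1), (0, -3, -1), (0, -3, 1), (1, -2, -1)}"
proof -
  define C where "C = (\<lambda>(s::int) (p::int). 3 * p \<le> s * s \<and> 0 < 12 - 4 * s + p \<and> 0 < 12 + 4 * s + p)"
  define D where "D = (\<lambda>(s::int) (p::int) (q::int). 0 < 8 - 4 * s + 2 * p - q \<and> 0 < 8 + 4 * s + 2 * p + q \<and>
    1 - s + p - q \<noteq> 0 \<and> 1 + s + p + q \<noteq> 0 \<and> q \<noteq> 0 \<and>
    0 \<le> s * s * p * p - 4 * p * p * p - 4 * s * s * s * q + 18 * s * p * q - 27 * q * q)"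
  define R where "R = (\<lambda>(s::int) (p::int) (q::int). (s = -1 \<and> p = -2 \<and> q = 1) \<or>
    (s = 0 \<and> p = -3 \<and> (q = -1 \<or> q = 1)) \<or> (s = 1 \<and> p = -2 \<and> q = -1))"
  \<comment> \<open>An exhaustive evaluation over the box. \<open>C\<close> depends on s and p only
    and is tested before q is enumerated.\<close>
  have "list_all (\<lambda>s. list_all (\<lambda>p. if C s p then
      list_all (\<lambda>q. if D s p q then R s p q else True) [-8..8] else True) [-12..12]) [-5..5]"
    unfolding C_def D_def R_def by code_simp
  moreover have "s \<in> set [-5..5]" "p \<in> set [-12..12]" "q \<in> set [-8..8]"
    unfolding set_upto atLeastAtMost_iff using assms(1-3) by linarith+
  moreover have "C s p" "D s p q"
    unfolding C_def D_def using assms(4-) by blast+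
  ultimately have "R s p q"
    unfolding list_all_iff by metis
  then show ?thesis
    by (auto simp: R_def)
qed

text \<open>If one of u, v, w is an integer, the other two have integral sum and product, and 1260
  is a multiple of 12 and 60. Otherwise the cubic with these roots is one of the four exceptional
  ones, the orders are 7, 9, 14 or 18, and 1260 is a multiple of their lcm 126.\<close>

lemma mult_power_1260_eq_1:
  assumes a: "(a :: complex)\<^sup>2 = of_real u * a - 1" and b: "(b :: complex)\<^sup>2 = of_real v * b - 1"
    and c: "(c :: complex)\<^sup>2 = of_real w * c - 1"
    and ints: "u + v + w \<in> \<int>" "u * v + v * w + w * u \<in> \<int>" "u * v * w \<in> \<int>"
    and le: "\<bar>u\<bar> \<le> 2" "\<bar>v\<bar> \<le> 2" "\<bar>w\<bar> \<le> (2::real)"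
  shows "(a * b * c) ^ 1260 = 1"
proof -
  \<comment> \<open>Stated for fresh variables, so that it applies to the cyclic rotations of the
    triple, whichever entry is integral.\<close>
  have int_case: "(a * b * c) ^ 1260 = 1"
    if a: "(a :: complex)\<^sup>2 = of_real u * a - 1" and b: "(b :: complex)\<^sup>2 = of_real v * b - 1"
      and c: "(c :: complex)\<^sup>2 = of_real w * c - 1"
      and ints: "u + v + w \<in> \<int>" "u * v + v * w + w * u \<in> \<int>"
      and le: "\<bar>u\<bar> \<le> 2" "\<bar>v\<bar> \<le> 2" "\<bar>w\<bar> \<le> (2::real)" and u: "u \<in> \<int>"
    for a b c u v w
  proof -
    have vw: "v + w \<in> \<int>"
      using Ints_diff[OF ints(1) u] by simp
    have "v * w = (u * v + v * w + w * u) - u * (v + w)"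
      by (simp add: algebra_simps)
    then have "v * w \<in> \<int>"
      using ints(2) u vw by (metis Ints_diff Ints_mult)
    then have "(b * c) ^ 60 = 1"
      using mult_power_60_eq_1[OF b c vw] le by blast
    moreover have "a ^ 12 = 1"
      using power_12_eq_1[OF a u] le by blast
    ultimately have "((b * c) ^ 60) ^ 21 * (a ^ 12) ^ 105 = 1"
      by simp
    then show ?thesis
      by (simp add: power_mult_distrib mult_ac flip: power_mult)
  qed
  show ?thesis
  proof (cases "u \<in> \<int> \<or> v \<in> \<int> \<or> w \<in> \<int>")
    case True
    then consider "u \<in> \<int>" | "v \<in> \<int>" | "w \<in> \<int>" by blast
    then show ?thesis
    proof cases
      case 1
      show ?thesis
        by (rule int_case[OF a b c ints(1,2) le 1])
    next
      case 2
      have "(b * c * a) ^ 1260 = 1"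
        by (rule int_case[OF b c a _ _ le(2,3,1) 2]) (use ints in \<open>simp_all add: add_ac\<close>)
      then show ?thesis by (simp add: mult_ac)
    next
      case 3
      have "(c * a * b) ^ 1260 = 1"
        by (rule int_case[OF c a b _ _ le(3,1,2) 3]) (use ints in \<open>simp_all add: add_ac\<close>)
      then show ?thesis by (simp add: mult_ac)
    qed
  next
    case False
    obtain s p q where s: "u + v + w = of_int s" and p: "u * v + v * w + w * u = of_int p"
      and q: "u * v * w = of_int q"
      using ints by (auto elim!: Ints_cases)
    have neq: "t \<noteq> of_int k" if "t \<in> {u, v, w}" for t k
      using False that by auto
    have strict: "\<bar>u\<bar> < 2" "\<bar>v\<bar> < 2" "\<bar>w\<bar> < 2"
      using le neq[of u 2] neq[of u "-2"] neq[of v 2] neq[of v "-2"] neq[of w 2] neq[of w "-2"]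
      by (auto simp: abs_if split: if_splits)
    \<comment> \<open>The cubic at an integer k. The values at 0, 1, -1 give the nonvanishing
      conditions, those at 2, -2 the positivity conditions.\<close>
    have eval: "of_int (k * k * k - s * k * k + p * k - q) = (of_int k - u) * (of_int k - v) * (of_int k - w)" for k
      unfolding of_int_diff of_int_add of_int_mult s[symmetric] p[symmetric] q[symmetric]
      by (simp add: algebra_simps)
    have nz: "k * k * k - s * k * k + p * k - q \<noteq> 0" for k
    proof -
      have "(of_int k - u) * (of_int k - v) * (of_int k - w) \<noteq> 0"
        using neq[of _ k] by auto
      then show ?thesis
        unfolding eval[symmetric] by (simp only: of_int_eq_0_iff not_False_eq_True)
    qed
    have pos: "0 < 2 - u" "0 < 2 - v" "0 < 2 - w" "0 < 2 + u" "0 < 2 + v" "0 < 2 + w"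
      using strict by linarith+
    have "\<bar>s\<bar> \<le> 5"
      using strict s by linarith
    have le4: "\<bar>x * y\<bar> \<le> 4" if "\<bar>x\<bar> \<le> 2" "\<bar>y\<bar> \<le> 2" for x y :: real
      using mult_mono[OF that] by (simp add: abs_mult)
    have "\<bar>real_of_int p\<bar> \<le> 12"
      using le4[OF le(1,2)] le4[OF le(2,3)] le4[OF le(3,1)] unfolding p[symmetric] by linarith
    then have "\<bar>p\<bar> \<le> 12" by linarith
    have "\<bar>real_of_int q\<bar> \<le> 8"
      using mult_mono[OF le4[OF le(1,2)] le(3)] unfolding q[symmetric] by (simp add: abs_mult)
    then have "\<bar>q\<bar> \<le> 8" by linarith
    have "0 \<le> (u - v)\<^sup>2 + (v - w)\<^sup>2 + (w - u)\<^sup>2"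
      by simp
    also have "\<dots> = 2 * ((u + v + w) * (u + v + w) - 3 * (u * v + v * w + w * u))"
      by (simp add: power2_eq_square algebra_simps)
    also have "\<dots> = of_int (2 * (s * s - 3 * p))"
      unfolding s p by simp
    finally have "3 * p \<le> s * s"
      by (simp only: of_int_0_le_iff) simp
    have "0 < (2 - u) * (2 - v) + (2 - v) * (2 - w) + (2 - w) * (2 - u)"
      using mult_pos_pos[OF pos(1,2)] mult_pos_pos[OF pos(2,3)] mult_pos_pos[OF pos(3,1)] by linarith
    also have "\<dots> = 12 - 4 * (u + v + w) + (u * v + v * w + w * u)"
      by (simp add: algebra_simps)
    also have "\<dots> = of_int (12 - 4 * s + p)"
      unfolding s p by simp
    finally have "0 < 12 - 4 * s + p"
      by (simp only: of_int_0_less_iff)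
    have "0 < (2 + u) * (2 + v) + (2 + v) * (2 + w) + (2 + w) * (2 + u)"
      using mult_pos_pos[OF pos(4,5)] mult_pos_pos[OF pos(5,6)] mult_pos_pos[OF pos(6,4)] by linarith
    also have "\<dots> = 12 + 4 * (u + v + w) + (u * v + v * w + w * u)"
      by (simp add: algebra_simps)
    also have "\<dots> = of_int (12 + 4 * s + p)"
      unfolding s p by simp
    finally have "0 < 12 + 4 * s + p"
      by (simp only: of_int_0_less_iff)
    have "0 < (2 - u) * (2 - v) * (2 - w)"
      using pos by (intro mult_pos_pos)
    also have "\<dots> = of_int (8 - 4 * s + 2 * p - q)"
      using eval[of 2] by (simp add: algebra_simps)
    finally have "0 < 8 - 4 * s + 2 * p - q"
      by (simp only: of_int_0_less_iff)
    have "0 < (2 + u) * (2 + v) * (2 + w)"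
      using pos by (intro mult_pos_pos)
    also have "\<dots> = of_int (8 + 4 * s + 2 * p + q)"
      using eval[of "-2"] by (simp add: algebra_simps)
    finally have "0 < 8 + 4 * s + 2 * p + q"
      by (simp only: of_int_0_less_iff)
    \<comment> \<open>The discriminant of the cubic, next rewritten in the elementary symmetric
      functions.\<close>
    have "0 \<le> ((u - v) * (v - w) * (w - u))\<^sup>2"
      by simp
    also have "\<dots> = (u + v + w) * (u + v + w) * (u * v + v * w + w * u) * (u * v + v * w + w * u)
        - 4 * (u * v + v * w + w * u) * (u * v + v * w + w * u) * (u * v + v * w + w * u)
        - 4 * (u + v + w) * (u + v + w) * (u + v + w) * (u * v * w)
        + 18 * (u + v + w) * (u * v + v * w + w * u) * (u * v * w) - 27 * (u * v * w) * (u * v * w)"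
      by Groebner_Basis.algebra
    also have "\<dots> = of_int (s * s * p * p - 4 * p * p * p - 4 * s * s * s * q + 18 * s * p * q - 27 * q * q)"
      unfolding s p q by simp
    finally have "0 \<le> s * s * p * p - 4 * p * p * p - 4 * s * s * s * q + 18 * s * p * q - 27 * q * q"
      by (simp only: of_int_0_le_iff)
    with \<open>\<bar>s\<bar> \<le> 5\<close> \<open>\<bar>p\<bar> \<le> 12\<close> \<open>\<bar>q\<bar> \<le> 8\<close> \<open>3 * p \<le> s * s\<close> \<open>0 < 12 - 4 * s + p\<close> \<open>0 < 12 + 4 * s + p\<close>
      \<open>0 < 8 - 4 * s + 2 * p - q\<close> \<open>0 < 8 + 4 * s + 2 * p + q\<close>
    have spq: "(s, p, q) \<in> {(-1, -2, 1), (0, -3, -1), (0, -3, 1), (1, -2, -1)}"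
      using nz[of 1] nz[of "-1"] nz[of 0] by (intro totally_real_cubics_in_interval) auto
    have "d ^ 126 = 1" if d: "(d :: complex)\<^sup>2 = of_real t * d - 1" and t: "t \<in> {u, v, w}" for d t
    proof -
      have "(t - u) * (t - v) * (t - w) = 0"
        using t by auto
      then have "t * t * t = (u + v + w) * t * t - (u * v + v * w + w * u) * t + u * v * w"
        by Groebner_Basis.algebra
      then have "t * t * t = of_int s * t * t - of_int p * t + of_int q"
        unfolding s p q .
      then have "complex_of_real (t * t * t) = complex_of_real (of_int s * t * t - of_int p * t + of_int q)"
        by (rule arg_cong)
      then have cub: "complex_of_real t * of_real t * of_real t =
          of_int s * of_real t * of_real t - of_int p * of_real t + of_int q"
        by simp
      define T where "T = complex_of_real t"
      have dT: "d\<^sup>2 = T * d - 1"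
        using d by (simp add: T_def)
      consider "s = -1" "p = -2" "q = 1" | "s = 0" "p = -3" "q = -1" | "s = 0" "p = -3" "q = 1" | "s = 1" "p = -2" "q = -1"
        using spq by auto
      then show ?thesis
      proof cases
        case 1
        then have "T * T * T = - T * T + 2 * T + 1"
          using cub by (simp add: T_def)
        with dT have "d ^ 7 = 1"
          by Groebner_Basis.algebra
        then have "(d ^ 7) ^ 18 = 1" by simp
        then show ?thesis by (simp flip: power_mult)
      next
        case 2
        then have "T * T * T = 3 * T - 1"
          using cub by (simp add: T_def)
        with dT have "d ^ 9 = 1"
          by Groebner_Basis.algebra
        then have "(d ^ 9) ^ 14 = 1" by simp
        then show ?thesis by (simp flip: power_mult)
      next
        case 3
        then have "T * T * T = 3 * T + 1"
          using cub by (simp add: T_def)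
        with dT have "d ^ 9 = -1"
          by Groebner_Basis.algebra
        then have "(d ^ 9) ^ 14 = 1" by simp
        then show ?thesis by (simp flip: power_mult)
      next
        case 4
        then have "T * T * T = T * T + 2 * T - 1"
          using cub by (simp add: T_def)
        with dT have "d ^ 7 = -1"
          by Groebner_Basis.algebra
        then have "(d ^ 7) ^ 18 = 1" by simp
        then show ?thesis by (simp flip: power_mult)
      qed
    qed
    then have "a ^ 126 = 1" "b ^ 126 = 1" "c ^ 126 = 1"
      using a b c by blast+
    then have "((a * b * c) ^ 126) ^ 10 = 1"
      by (simp add: power_mult_distrib)
    then show ?thesis by (simp flip: power_mult)
  qed
qed

section \<open>Integrality of symmetric functions from polynomial coefficients\<close>

lemma Ints_of_complex: "complex_of_int k = complex_of_real x \<Longrightarrow> x \<in> \<int>"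
  by (metis Ints_of_int of_real_eq_iff of_real_of_int_eq)

text \<open>All factors are palindromic, so the low coefficients carry the full information. Each
  further coefficient brings in one new symmetric function, with factor 1 or -1, next to integer
  combinations of the earlier ones; the quartic and sextic cases go the same way.\<close>

lemma int_poly_quadratic_factor:
  assumes "map_poly complex_of_int P = [:-1, 1:]\<^sup>2 * [:1, - of_real u, 1:]"
  shows "u \<in> \<int>"
proof -
  have "complex_of_int (coeff P 1) = coeff (map_poly complex_of_int P) 1"
    by (simp add: coeff_map_poly)
  also have "\<dots> = of_real (- u - 2)"
    unfolding assms by (simp add: power2_eq_square numeral_eq_Suc algebra_simps)
  finally have "complex_of_int (coeff P 1) = of_real (- u - 2)" .
  then have "- u - 2 \<in> \<int>"
    by (rule Ints_of_complex)
  then have "- (- u - 2) - 2 \<in> \<int>"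
    by (rule Ints_diff[OF Ints_minus Ints_numeral])
  then show ?thesis by simp
qed

lemma int_poly_quartic_factor:
  assumes "map_poly complex_of_int P = [:-1, 1:]\<^sup>2 * ([:1, - of_real u, 1:] * [:1, - of_real v, 1:])"
  shows "u + v \<in> \<int>" "u * v \<in> \<int>"
proof -
  have "complex_of_int (coeff P 1) = coeff (map_poly complex_of_int P) 1"
    by (simp add: coeff_map_poly)
  also have "\<dots> = of_real (- (u + v) - 2)"
    unfolding assms by (simp add: power2_eq_square numeral_eq_Suc algebra_simps)
  finally have "complex_of_int (coeff P 1) = of_real (- (u + v) - 2)" .
  then have "- (u + v) - 2 \<in> \<int>"
    by (rule Ints_of_complex)
  then have "- (- (u + v) - 2) - 2 \<in> \<int>"
    by (rule Ints_diff[OF Ints_minus Ints_numeral])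
  moreover have "- (- (u + v) - 2) - 2 = u + v"
    by simp
  ultimately show uv: "u + v \<in> \<int>"
    by (simp only:)
  have "complex_of_int (coeff P 2) = coeff (map_poly complex_of_int P) 2"
    by (simp add: coeff_map_poly)
  also have "\<dots> = of_real (u * v + 2 * (u + v) + 3)"
    unfolding assms by (simp add: power2_eq_square numeral_eq_Suc algebra_simps)
  finally have "complex_of_int (coeff P 2) = of_real (u * v + 2 * (u + v) + 3)" .
  then have "u * v + 2 * (u + v) + 3 \<in> \<int>"
    by (rule Ints_of_complex)
  then have "u * v + 2 * (u + v) + 3 - 2 * (u + v) - 3 \<in> \<int>"
    using Ints_diff[OF Ints_diff[OF _ Ints_mult[OF Ints_numeral uv]] Ints_numeral] by blast
  then show "u * v \<in> \<int>" by simp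
qed

lemma int_poly_sextic_factor:
  assumes "map_poly complex_of_int P =
    [:-1, 1:]\<^sup>2 * ([:1, - of_real u, 1:] * [:1, - of_real v, 1:] * [:1, - of_real w, 1:])"
  shows "u + v + w \<in> \<int>" "u * v + v * w + w * u \<in> \<int>" "u * v * w \<in> \<int>"
proof -
  have "complex_of_int (coeff P 1) = coeff (map_poly complex_of_int P) 1"
    by (simp add: coeff_map_poly)
  also have "\<dots> = of_real (- (u + v + w) - 2)"
    unfolding assms by (simp add: power2_eq_square numeral_eq_Suc algebra_simps)
  finally have "complex_of_int (coeff P 1) = of_real (- (u + v + w) - 2)" .
  then have "- (u + v + w) - 2 \<in> \<int>"
    by (rule Ints_of_complex)
  then have "- (- (u + v + w) - 2) - 2 \<in> \<int>"
    by (rule Ints_diff[OF Ints_minus Ints_numeral])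
  moreover have "- (- (u + v + w) - 2) - 2 = u + v + w"
    by simp
  ultimately show s: "u + v + w \<in> \<int>"
    by (simp only:)
  have "complex_of_int (coeff P 2) = coeff (map_poly complex_of_int P) 2"
    by (simp add: coeff_map_poly)
  also have "\<dots> = of_real ((u * v + v * w + w * u) + 2 * (u + v + w) + 4)"
    unfolding assms by (simp add: power2_eq_square numeral_eq_Suc algebra_simps)
  finally have "complex_of_int (coeff P 2) = of_real ((u * v + v * w + w * u) + 2 * (u + v + w) + 4)" .
  then have "(u * v + v * w + w * u) + 2 * (u + v + w) + 4 \<in> \<int>"
    by (rule Ints_of_complex)
  then have "(u * v + v * w + w * u) + 2 * (u + v + w) + 4 - 2 * (u + v + w) - 4 \<in> \<int>"
    using Ints_diff[OF Ints_diff[OF _ Ints_mult[OF Ints_numeral s]] Ints_numeral] by blast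
  then show p: "u * v + v * w + w * u \<in> \<int>" by (simp add: add.assoc)
  have "complex_of_int (coeff P 3) = coeff (map_poly complex_of_int P) 3"
    by (simp add: coeff_map_poly)
  also have "\<dots> = of_real (- (u * v * w) - 3 * (u + v + w) - 2 * (u * v + v * w + w * u) - 6)"
    unfolding assms by (simp add: power2_eq_square numeral_eq_Suc algebra_simps)
  finally have "complex_of_int (coeff P 3) = of_real (- (u * v * w) - 3 * (u + v + w) - 2 * (u * v + v * w + w * u) - 6)" .
  then have "- (u * v * w) - 3 * (u + v + w) - 2 * (u * v + v * w + w * u) - 6 \<in> \<int>"
    by (rule Ints_of_complex)
  then have "- (- (u * v * w) - 3 * (u + v + w) - 2 * (u * v + v * w + w * u) - 6)
      - 3 * (u + v + w) - 2 * (u * v + v * w + w * u) - 6 \<in> \<int>"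
    by (rule Ints_diff[OF Ints_diff[OF Ints_diff[OF Ints_minus Ints_mult[OF Ints_numeral s]]
          Ints_mult[OF Ints_numeral p]] Ints_numeral])
  then show "u * v * w \<in> \<int>" by simp
qed

section \<open>Holonomy of a hyperelliptic manifold\<close>

context hyperelliptic_data
begin

lemma affine_rep_stable:
  assumes "affine_rep g A b" "l \<in> \<Lambda>"
  shows "A *v l \<in> \<Lambda>"
proof -
  have "tproj l = tproj 0"
    using assms(2) by (simp add: torus_proj_eq_iff)
  then have "tproj (A *v l + b) = tproj (A *v 0 + b)"
    using assms(1) unfolding affine_rep_def by metis
  then show ?thesis
    by (simp add: torus_proj_eq_iff)
qed

lemma affine_rep_power:
  assumes "g \<in> G" "affine_rep g A b"
  shows "(g [^]\<^bsub>BijGroup (torus \<Lambda>)\<^esub> k) (tproj z) = tproj (((\<lambda>z. A *v z + b) ^^ k) z)"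
proof (induction k arbitrary: z)
  case 0
  then show ?case by (simp add: one_eq)
next
  case (Suc k)
  interpret group "BijGroup (torus \<Lambda>)"
    by (rule group_BijGroup)
  have g: "g \<in> carrier (BijGroup (torus \<Lambda>))"
    using subgroup.subset[OF subgroup_G] assms(1) by blast
  have "g [^]\<^bsub>BijGroup (torus \<Lambda>)\<^esub> Suc k = compose (torus \<Lambda>) (g [^]\<^bsub>BijGroup (torus \<Lambda>)\<^esub> k) g"
    using g nat_pow_closed[OF g, of k] by (simp add: BijGroup_def)
  then have "(g [^]\<^bsub>BijGroup (torus \<Lambda>)\<^esub> Suc k) (tproj z) = (g [^]\<^bsub>BijGroup (torus \<Lambda>)\<^esub> k) (g (tproj z))"
    by (simp add: compose_def)
  also have "\<dots> = (g [^]\<^bsub>BijGroup (torus \<Lambda>)\<^esub> k) (tproj (A *v z + b))"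
    using assms(2) by (simp add: affine_rep_def)
  finally show ?case
    by (simp only: Suc funpow_Suc_right comp_apply)
qed

text \<open>With N the order of G, g^N is the identity, so the N-th iterate of the lift minus the
  identity map is lattice-valued and hence constant. Comparison with the value at 0 removes the
  translation part.\<close>

lemma affine_rep_finite_order:
  assumes "g \<in> G" "affine_rep g A b"
  shows "\<exists>N>0. \<forall>z. (((*v) A) ^^ N) z = z"
proof -
  let ?S = "BijGroup (torus \<Lambda>)"
  let ?F = "\<lambda>z. A *v z + b"
  interpret S: group ?S by (rule group_BijGroup)
  interpret G: group "?S\<lparr>carrier := G\<rparr>"
    by (rule subgroup.subgroup_is_group[OF subgroup_G S.group_axioms])
  define N where "N = Coset.order (?S\<lparr>carrier := G\<rparr>)"
  have "N > 0"
    using finite_G assms(1) by (auto simp: N_def Coset.order_def card_gt_0_iff)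
  have "g [^]\<^bsub>?S\<lparr>carrier := G\<rparr>\<^esub> N = \<one>\<^bsub>?S\<lparr>carrier := G\<rparr>\<^esub>"
    unfolding N_def by (rule G.pow_order_eq_1) (use assms(1) in simp)
  then have one: "g [^]\<^bsub>?S\<^esub> N = (\<lambda>x\<in>torus \<Lambda>. x)"
    using S.nat_pow_consistent[of g N G] by (simp add: one_eq)
  have diff: "(?F ^^ k) z - (?F ^^ k) 0 = (((*v) A) ^^ k) z" for k z
  proof (induction k)
    case (Suc k)
    have "(?F ^^ Suc k) z - (?F ^^ Suc k) 0 = A *v ((?F ^^ k) z - (?F ^^ k) 0)"
      by (simp add: matrix_vector_mult_diff_distrib)
    then show ?case
      using Suc by simp
  qed simp
  have F_cont: "continuous_on UNIV ?F"
    by (rule continuous_at_imp_continuous_on) (blast intro: has_derivative_continuous has_derivative_affine)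
  have "continuous_on UNIV (?F ^^ k)" for k
  proof (induction k)
    case (Suc k)
    then show ?case
      using continuous_on_compose2[OF F_cont] by (simp add: comp_def)
  qed simp
  then have "continuous_on UNIV (\<lambda>z. (?F ^^ N) z - z)"
    by (intro continuous_intros)
  moreover have "(?F ^^ N) z - z \<in> \<Lambda>" for z
  proof -
    have "tproj ((?F ^^ N) z) = tproj z"
      unfolding affine_rep_power[OF assms, symmetric] one by simp
    then show ?thesis
      by (simp add: torus_proj_eq_iff)
  qed
  ultimately have "(\<lambda>z. (?F ^^ N) z - z) constant_on UNIV"
    by (intro continuous_into_lattice_constant) auto
  then obtain c where c: "\<And>z. (?F ^^ N) z - z = c"
    unfolding constant_on_def by blast
  have "(((*v) A) ^^ N) z = z" for z
    using c[of z] c[of 0] diff[of N z] by (simp add: algebra_simps)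
  then show ?thesis
    using \<open>N > 0\<close> by blast
qed

text \<open>Otherwise \<open>z = A z + b\<close> would be solvable and \<open>g\<close> would have a fixed point.\<close>

lemma affine_rep_eigenvalue_1:
  assumes "g \<in> G" "affine_rep g A b" "g \<noteq> \<one>\<^bsub>BijGroup (torus \<Lambda>)\<^esub>"
  shows "\<exists>v. v \<noteq> 0 \<and> A *v v = 1 *s v"
proof (rule ccontr)
  assume no: "\<not> (\<exists>v. v \<noteq> 0 \<and> A *v v = 1 *s v)"
  let ?M = "Finite_Cartesian_Product.mat 1 - A"
  have M: "?M *v v = v - A *v v" for v
    by (simp add: matrix_vector_mult_diff_rdistrib)
  have "\<forall>v. ?M *v v = 0 \<longrightarrow> v = 0"
    using no by (auto simp: M)
  then obtain N where "N ** ?M = Finite_Cartesian_Product.mat 1"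
    using matrix_left_invertible_ker by blast
  then have "?M ** N = Finite_Cartesian_Product.mat 1"
    by (simp add: matrix_left_right_inverse)
  then have "?M *v (N *v b) = b"
    by (simp add: matrix_vector_mul_assoc)
  then have "A *v (N *v b) + b = N *v b"
    by (simp add: M algebra_simps)
  then have "g (tproj (N *v b)) = tproj (N *v b)"
    using assms(2) unfolding affine_rep_def by metis
  then show False
    using hyp assms(1,3) unfolding hyperelliptic_def by simp
qed

text \<open>By continuity every lift of the identity is a translation. This covers the one element
  of G to which the eigenvalue argument, resting on freeness, does not apply.\<close>

lemma affine_rep_one_det:
  assumes "affine_rep \<one>\<^bsub>BijGroup (torus \<Lambda>)\<^esub> A b"
  shows "det A = 1"
proof -
  have "A *v z + b - z \<in> \<Lambda>" for z
    using assms by (simp add: affine_rep_def one_eq torus_proj_eq_iff[symmetric])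
  moreover have "continuous_on UNIV (\<lambda>z. A *v z + b)"
    by (rule continuous_at_imp_continuous_on) (blast intro: has_derivative_continuous has_derivative_affine)
  then have "continuous_on UNIV (\<lambda>z. A *v z + b - z)"
    by (intro continuous_intros)
  ultimately have "(\<lambda>z. A *v z + b - z) constant_on UNIV"
    by (intro continuous_into_lattice_constant) auto
  then obtain c where c: "\<And>z. A *v z + b - z = c"
    unfolding constant_on_def by blast
  have "A *v z = Finite_Cartesian_Product.mat 1 *v z" for z
    using c[of z] c[of 0] by (simp add: algebra_simps)
  then have "A = Finite_Cartesian_Product.mat 1"
    by (metis matrix_eq)
  then show ?thesis by simp
qed

text \<open>Finite order makes the eigenvalues unimodular, so a linear factor and its conjugate
  combine to x^2 - 2 Re(a) x + 1. One eigenvalue 1 is split off and, with its conjugate, accounts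
  for (x - 1)^2.\<close>

lemma holonomy_eigenvalues:
  assumes "g \<in> G" "affine_rep g A b" "g \<noteq> \<one>\<^bsub>BijGroup (torus \<Lambda>)\<^esub>"
  obtains bs :: "complex list" and P :: "int poly" where
    "length bs = CARD('a) - 1" "det A = prod_list bs" "\<And>a. a \<in> set bs \<Longrightarrow> norm a = 1"
    "map_poly complex_of_int P = [:-1, 1:]\<^sup>2 * (\<Prod>a\<leftarrow>bs. [:1, - of_real (2 * Re a), 1:])"
proof -
  obtain as P where as: "length as = CARD('a)" "det A = prod_list as"
    "map_poly complex_of_int P = (\<Prod>a\<leftarrow>as. [:- a, 1:] * [:- cnj a, 1:])"
    "\<And>a. a \<in> set as \<longleftrightarrow> (\<exists>v. v \<noteq> 0 \<and> A *v v = a *s v)"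
    by (rule eigenvalues_lattice_endomorphism[OF affine_rep_stable[OF assms(2)]], blast, blast)
  obtain N where N: "N > 0" "\<And>z. (((*v) A) ^^ N) z = z"
    using affine_rep_finite_order[OF assms(1,2)] by blast
  have norm: "norm a = 1" if "a \<in> set as" for a
  proof -
    have "\<exists>v. v \<noteq> 0 \<and> A *v v = a *s v"
      using that by (simp only: as(4))
    then obtain v where v: "v \<noteq> 0" "A *v v = a *s v"
      by (elim exE conjE)
    have "(((*v) A) ^^ k) v = a ^ k *s v" for k
      by (induction k) (simp_all add: v(2) vector_scalar_commute vector_smult_assoc mult.commute)
    then have "a ^ N *s v = 1 *s v"
      using N(2)[of v] by simp
    then have "a ^ N = 1"
      using v(1) by (simp only: vector_mul_rcancel) simp
    then have "norm a ^ N = 1"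
      by (metis norm_one norm_power)
    then show ?thesis
      using power_eq_imp_eq_base[of "norm a" N 1] N(1) by simp
  qed
  have one: "1 \<in> set as"
    unfolding as(4) by (rule affine_rep_eigenvalue_1[OF assms])
  \<comment> \<open>Only one occurrence is removed: 1 may be an eigenvalue of higher
    multiplicity.\<close>
  define bs where "bs = remove1 1 as"
  have bs: "set bs \<subseteq> set as"
    unfolding bs_def by (rule set_remove1_subset)
  have quad: "[:- a, 1:] * [:- cnj a, 1:] = [:1, - of_real (2 * Re a), 1:]" if "norm a = 1" for a
  proof -
    have "a * cnj a = 1"
      using that by (simp flip: complex_norm_square)
    moreover have "of_real (2 * Re a) = a + cnj a"
      by (simp add: complex_add_cnj)
    ultimately show ?thesis
      by (simp add: mult.commute del: of_real_mult)
  qed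
  show thesis
  proof
    show "length bs = CARD('a) - 1"
      using as(1) one by (simp add: bs_def length_remove1)
    show "det A = prod_list bs"
      using prod_list_map_remove1[OF one, of "\<lambda>x. x"] as(2) by (simp add: bs_def)
    show "norm a = 1" if "a \<in> set bs" for a
      using norm bs that by blast
    have "map_poly complex_of_int P = ([:- 1, 1:] * [:- cnj 1, 1:]) * (\<Prod>a\<leftarrow>bs. [:- a, 1:] * [:- cnj a, 1:])"
      unfolding as(3) bs_def by (rule prod_list_map_remove1[OF one])
    also have "(\<Prod>a\<leftarrow>bs. [:- a, 1:] * [:- cnj a, 1:]) = (\<Prod>a\<leftarrow>bs. [:1, - of_real (2 * Re a), 1:])"
      by (rule arg_cong[of _ _ prod_list], rule map_cong[OF refl], rule quad) (use norm bs in blast)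
    finally show "map_poly complex_of_int P = [:-1, 1:]\<^sup>2 * (\<Prod>a\<leftarrow>bs. [:1, - of_real (2 * Re a), 1:])"
      by (simp only: complex_cnj_one power2_eq_square)
  qed
qed

text \<open>Separates geometry from arithmetic: only a claim about n - 1 unimodular numbers and one
  integer polynomial remains.\<close>

lemma trivial_canonical_power:
  assumes "\<And>bs :: complex list. \<And>P :: int poly. length bs = CARD('a) - 1 \<Longrightarrow> (\<And>a. a \<in> set bs \<Longrightarrow> norm a = 1) \<Longrightarrow>
    map_poly complex_of_int P = [:-1, 1:]\<^sup>2 * (\<Prod>a\<leftarrow>bs. [:1, - of_real (2 * Re a), 1:]) \<Longrightarrow>
    prod_list bs ^ m = 1"
  shows "trivial_line_bundle (hyperelliptic_atlas \<Lambda> G) (tensor_power m canonical_bundle)"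
proof (rule trivial_if_det_power_eq_1)
  fix g A b assume g: "g \<in> G" "affine_rep g A b"
  show "det A ^ m = 1"
  proof (cases "g = \<one>\<^bsub>BijGroup (torus \<Lambda>)\<^esub>")
    case True
    then show ?thesis
      using affine_rep_one_det g(2) by simp
  next
    case False
    show ?thesis
      by (rule holonomy_eigenvalues[OF g False]) (simp only: assms)
  qed
qed

end

section \<open>The upper bounds in dimensions 2, 3 and 4\<close>

lemma hyperelliptic_data_exists:
  assumes "hyperelliptic \<Lambda> G"
  shows "\<exists>B. hyperelliptic_data \<Lambda> B G"
  using assms full_lattice_iff[of \<Lambda>]
  by (auto simp: hyperelliptic_def hyperelliptic_data_def hyperelliptic_data_axioms_def)

lemma abs_twice_Re_le: "norm a = 1 \<Longrightarrow> \<bar>2 * Re a\<bar> \<le> 2"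
  using abs_Re_le_cmod[of a] by simp

lemma trivial_dim_2:
  assumes "hyperelliptic (\<Lambda> :: (complex ^ 2) set) G"
  shows "trivial_line_bundle (hyperelliptic_atlas \<Lambda> G) (tensor_power 12 canonical_bundle)"
proof -
  obtain B where "hyperelliptic_data \<Lambda> B G"
    using hyperelliptic_data_exists[OF assms] by blast
  then interpret hyperelliptic_data \<Lambda> B G .
  show ?thesis
  proof (rule trivial_canonical_power)
    fix bs :: "complex list" and P :: "int poly"
    assume "length bs = CARD(2) - 1" and norm: "\<And>a. a \<in> set bs \<Longrightarrow> norm a = 1"
      and P: "map_poly complex_of_int P = [:-1, 1:]\<^sup>2 * (\<Prod>a\<leftarrow>bs. [:1, - of_real (2 * Re a), 1:])"
    then have "length bs = Suc 0" by simp
    then obtain a where bs: "bs = [a]"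
      by (auto simp: length_Suc_conv)
    have a: "norm a = 1"
      using norm by (simp add: bs)
    have "2 * Re a \<in> \<int>"
      by (rule int_poly_quadratic_factor) (use P in \<open>simp only: bs list.map prod_list.Cons prod_list.Nil mult_1_right\<close>)
    then have "a ^ 12 = 1"
      by (rule power_12_eq_1[OF unimodular_quadratic[OF a] _ abs_twice_Re_le[OF a]])
    then show "prod_list bs ^ 12 = 1"
      by (simp add: bs)
  qed
qed

lemma trivial_dim_3:
  assumes "hyperelliptic (\<Lambda> :: (complex ^ 3) set) G"
  shows "trivial_line_bundle (hyperelliptic_atlas \<Lambda> G) (tensor_power 60 canonical_bundle)"
proof -
  obtain B where "hyperelliptic_data \<Lambda> B G"
    using hyperelliptic_data_exists[OF assms] by blast
  then interpret hyperelliptic_data \<Lambda> B G .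
  show ?thesis
  proof (rule trivial_canonical_power)
    fix bs :: "complex list" and P :: "int poly"
    assume "length bs = CARD(3) - 1" and norm: "\<And>a. a \<in> set bs \<Longrightarrow> norm a = 1"
      and P: "map_poly complex_of_int P = [:-1, 1:]\<^sup>2 * (\<Prod>a\<leftarrow>bs. [:1, - of_real (2 * Re a), 1:])"
    then have "length bs = Suc (Suc 0)" by simp
    then obtain a b where bs: "bs = [a, b]"
      by (auto simp: length_Suc_conv)
    have ab: "norm a = 1" "norm b = 1"
      using norm by (simp_all add: bs)
    have "map_poly complex_of_int P =
        [:-1, 1:]\<^sup>2 * ([:1, - of_real (2 * Re a), 1:] * [:1, - of_real (2 * Re b), 1:])"
      using P by (simp only: bs list.map prod_list.Cons prod_list.Nil mult_1_right)
    from int_poly_quartic_factor[OF this] have "(a * b) ^ 60 = 1"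
      by (rule mult_power_60_eq_1[OF unimodular_quadratic[OF ab(1)] unimodular_quadratic[OF ab(2)]
            _ _ abs_twice_Re_le[OF ab(1)] abs_twice_Re_le[OF ab(2)]])
    then show "prod_list bs ^ 60 = 1"
      by (simp add: bs)
  qed
qed

lemma trivial_dim_4:
  assumes "hyperelliptic (\<Lambda> :: (complex ^ 4) set) G"
  shows "trivial_line_bundle (hyperelliptic_atlas \<Lambda> G) (tensor_power 1260 canonical_bundle)"
proof -
  obtain B where "hyperelliptic_data \<Lambda> B G"
    using hyperelliptic_data_exists[OF assms] by blast
  then interpret hyperelliptic_data \<Lambda> B G .
  show ?thesis
  proof (rule trivial_canonical_power)
    fix bs :: "complex list" and P :: "int poly"
    assume "length bs = CARD(4) - 1" and norm: "\<And>a. a \<in> set bs \<Longrightarrow> norm a = 1"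
      and P: "map_poly complex_of_int P = [:-1, 1:]\<^sup>2 * (\<Prod>a\<leftarrow>bs. [:1, - of_real (2 * Re a), 1:])"
    then have "length bs = Suc (Suc (Suc 0))" by simp
    then obtain a b c where bs: "bs = [a, b, c]"
      by (auto simp: length_Suc_conv)
    have abc: "norm a = 1" "norm b = 1" "norm c = 1"
      using norm by (simp_all add: bs)
    have "map_poly complex_of_int P = [:-1, 1:]\<^sup>2 *
        ([:1, - of_real (2 * Re a), 1:] * [:1, - of_real (2 * Re b), 1:] * [:1, - of_real (2 * Re c), 1:])"
      using P by (simp only: bs list.map prod_list.Cons prod_list.Nil mult_1_right mult.assoc)
    from int_poly_sextic_factor[OF this] have "(a * b * c) ^ 1260 = 1"
      by (rule mult_power_1260_eq_1[OF unimodular_quadratic[OF abc(1)] unimodular_quadratic[OF abc(2)]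
            unimodular_quadratic[OF abc(3)] _ _ _ abs_twice_Re_le[OF abc(1)] abs_twice_Re_le[OF abc(2)]
            abs_twice_Re_le[OF abc(3)]])
    then show "prod_list bs ^ 1260 = 1"
      by (simp add: bs mult.assoc)
  qed
qed

section \<open>Cyclic hyperelliptic manifolds\<close>

text \<open>U is shrunk until its affine image lies in a ball on which the projection is injective;
  in these charts the map is the affine map itself.\<close>

lemma (in lattice_basis) affine_holomorphic_map_torus:
  assumes h: "\<And>z. h (torus_proj \<Lambda> z) = torus_proj \<Lambda> (M *v z + c)"
  shows "holomorphic_map (torus_atlas \<Lambda>) (torus_atlas \<Lambda>) h"
  unfolding holomorphic_map_def points_torus_atlas
proof
  let ?\<pi> = "torus_proj \<Lambda>"
  fix x assume "x \<in> torus \<Lambda>"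
  then obtain z where z: "x = ?\<pi> z"
    by (auto simp: torus_def)
  obtain e where e: "e > 0" "\<And>z. inj_on ?\<pi> (ball z e)"
    using inj_on_torus_proj_ball by blast
  define W where "W = ball (M *v z + c) e"
  define U where "U = ball z e \<inter> (\<lambda>y. M *v y + c) -` W"
  have "open ((\<lambda>y. M *v y + c) -` W)"
    unfolding W_def by (rule continuous_open_vimage[OF open_ball has_derivative_continuous[OF has_derivative_affine]])
  then have U: "open U" "inj_on ?\<pi> U" "z \<in> U"
    using e(1) inj_on_subset[OF e(2)[of z], of U] by (auto simp: U_def W_def)
  have W: "open W" "inj_on ?\<pi> W"
    using e by (auto simp: W_def)
  let ?\<phi> = "(\<lambda>z. z) \<circ> inv_into U ?\<pi>"
  let ?\<psi> = "(\<lambda>z. z) \<circ> inv_into W ?\<pi>"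
  have charts: "(?\<pi> ` U, ?\<phi>) \<in> torus_atlas \<Lambda>" "(?\<pi> ` W, ?\<psi>) \<in> torus_atlas \<Lambda>"
    unfolding torus_atlas_iff using U W by auto
  have \<phi>: "?\<phi> (?\<pi> y) = y" if "y \<in> U" for y
    using that U(2) by simp
  have image: "?\<phi> ` ?\<pi> ` U = U"
    using \<phi> by (simp add: image_image)
  have inv: "inv_into (?\<pi> ` U) ?\<phi> y = ?\<pi> y" if "y \<in> U" for y
    by (rule inv_into_f_eq) (use that U(2) in \<open>auto intro!: inj_onI\<close>)
  have maps: "h ` ?\<pi> ` U \<subseteq> ?\<pi> ` W"
    by (auto simp: h U_def)
  have "(\<lambda>y. M *v y + c) y = (?\<psi> \<circ> h \<circ> inv_into (?\<pi> ` U) ?\<phi>) y" if "y \<in> U" for y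
    using inv[OF that] that W(2) by (simp add: h U_def)
  then have "((?\<psi> \<circ> h \<circ> inv_into (?\<pi> ` U) ?\<phi>) has_derivative ((*v) M)) (at y)" if "y \<in> U" for y
    using has_derivative_transform_within_open[OF has_derivative_affine U(1) that] by blast
  moreover have "Vector_Spaces.linear (*s) (*s) ((*v) M)"
    by (simp add: clinear_vec_iff matrix_vector_right_distrib vector_scalar_commute)
  ultimately have "holo_map_on (?\<psi> \<circ> h \<circ> inv_into (?\<pi> ` U) ?\<phi>) (?\<phi> ` ?\<pi> ` U)"
    unfolding image holo_map_on_def by blast
  moreover have "x \<in> ?\<pi> ` U"
    using z U(3) by blast
  ultimately show "\<exists>(U, \<phi>)\<in>torus_atlas \<Lambda>. \<exists>(W, \<psi>)\<in>torus_atlas \<Lambda>.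
      x \<in> U \<and> h ` U \<subseteq> W \<and> holo_map_on (\<psi> \<circ> h \<circ> inv_into U \<phi>) (\<phi> ` U)"
    using maps by (intro bexI[OF _ charts(1)] bexI[OF _ charts(2)] case_prodI conjI)
qed

text \<open>Since A fixes t, the k-th iterate of z -> A z + t is z -> A^k z + k t. Freeness and the
  absence of translations in the generated group thus become the explicit conditions
  \<open>free\<close> and \<open>nontrivial\<close> for 0 < k < d.\<close>

locale cyclic_action = lattice_basis +
  fixes A :: "complex ^ 'a::finite ^ 'a" and t :: "complex ^ 'a" and d :: nat
  assumes stable: "l \<in> \<Lambda> \<Longrightarrow> A *v l \<in> \<Lambda>"
    and d: "1 < d"
    and order_d: "(((*v) A) ^^ d) z = z"
    and fixed: "A *v t = t"
    and period: "of_nat d *s t \<in> \<Lambda>"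
    and free: "0 < k \<Longrightarrow> k < d \<Longrightarrow> (((*v) A) ^^ k) z + of_nat k *s t - z \<notin> \<Lambda>"
    and nontrivial: "0 < k \<Longrightarrow> k < d \<Longrightarrow> \<exists>z. (((*v) A) ^^ k) z \<noteq> z"
begin

definition F :: "complex ^ 'a \<Rightarrow> complex ^ 'a" where
  "F z = A *v z + t"

text \<open>Points of the torus are cosets, so the map acts on them by images; the restriction makes
  it extensional, as \<open>BijGroup\<close> demands.\<close>

definition gen_pow :: "nat \<Rightarrow> (complex ^ 'a) set \<Rightarrow> (complex ^ 'a) set" where
  "gen_pow k = (\<lambda>x\<in>torus \<Lambda>. (F ^^ k) ` x)"

definition cyclic_group where
  "cyclic_group = range gen_pow"

lemma F_power: "(F ^^ k) z = (((*v) A) ^^ k) z + of_nat k *s t"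
proof (induction k)
  case (Suc k)
  have "(F ^^ Suc k) z = F ((((*v) A) ^^ k) z + of_nat k *s t)"
    using Suc by simp
  also have "\<dots> = (((*v) A) ^^ Suc k) z + of_nat (Suc k) *s t"
    by (simp add: F_def matrix_vector_right_distrib vector_scalar_commute fixed vector_sadd_rdistrib algebra_simps)
  finally show ?case .
qed simp

lemma F_power_affine: "\<exists>M c. \<forall>z. (F ^^ k) z = M *v z + c"
proof (induction k)
  case 0
  then show ?case
    by (intro exI[of _ "Finite_Cartesian_Product.mat 1"] exI[of _ 0]) simp
next
  case (Suc k)
  then obtain M c where M: "\<And>z. (F ^^ k) z = M *v z + c" by blast
  have "(F ^^ Suc k) z = (A ** M) *v z + (A *v c + t)" for z
  proof -
    have "(F ^^ Suc k) z = F (M *v z + c)"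
      by (simp add: M)
    also have "\<dots> = (A ** M) *v z + (A *v c + t)"
      by (simp add: F_def matrix_vector_right_distrib matrix_vector_mul_assoc add.assoc)
    finally show ?thesis .
  qed
  then show ?case by blast
qed

lemma A_power_stable: "l \<in> \<Lambda> \<Longrightarrow> (((*v) A) ^^ k) l \<in> \<Lambda>"
  by (induction k) (simp_all add: stable)

lemma F_image: "F ` tproj z = tproj (F z)"
proof
  show "F ` tproj z \<subseteq> tproj (F z)"
    by (auto simp: torus_proj_def F_def matrix_vector_right_distrib algebra_simps intro!: imageI stable)
  show "tproj (F z) \<subseteq> F ` tproj z"
  proof
    fix y assume "y \<in> tproj (F z)"
    then obtain l where l: "l \<in> \<Lambda>" "y = A *v z + t + l"
      by (auto simp: torus_proj_def F_def)
    \<comment> \<open>The power d - 1 of A serves as the inverse of A, which maps the lattice into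
      itself.\<close>
    obtain j where j: "d = Suc j"
      using d by (cases d) auto
    have "A *v ((((*v) A) ^^ j) l) = l"
      using order_d[of l] by (simp add: j)
    then have "y = F (z + (((*v) A) ^^ j) l)"
      by (simp add: l(2) F_def matrix_vector_right_distrib algebra_simps)
    then show "y \<in> F ` tproj z"
      using A_power_stable[OF l(1)] by (auto simp: torus_proj_def)
  qed
qed

lemma gen_pow_tprojoj: "gen_pow k (tproj z) = tproj ((F ^^ k) z)"
proof -
  have "(F ^^ k) ` tproj z = tproj ((F ^^ k) z)"
  proof (induction k)
    case (Suc k)
    have "(F ^^ Suc k) ` tproj z = F ` (F ^^ k) ` tproj z"
      by (simp add: image_comp)
    also have "\<dots> = tproj ((F ^^ Suc k) z)"
      by (simp add: Suc F_image)
    finally show ?case .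
  qed simp
  then show ?thesis
    by (simp add: gen_pow_def)
qed

lemma gen_pow_extensional: "gen_pow k \<in> extensional (torus \<Lambda>)"
  by (simp add: gen_pow_def)

lemma gen_pow_eqI:
  assumes "\<And>z. tproj ((F ^^ k) z) = h (tproj z)" "h \<in> extensional (torus \<Lambda>)"
  shows "gen_pow k = h"
proof (rule extensionalityI[of _ "torus \<Lambda>"])
  show "gen_pow k \<in> extensional (torus \<Lambda>)"
    by (rule gen_pow_extensional)
  show "h \<in> extensional (torus \<Lambda>)" by fact
  fix x assume "x \<in> torus \<Lambda>"
  then obtain z where "x = tproj z"
    by (auto simp: torus_def)
  then show "gen_pow k x = h x"
    by (simp add: gen_pow_tprojoj assms(1))
qed

lemma gen_pow_closed: "x \<in> torus \<Lambda> \<Longrightarrow> gen_pow k x \<in> torus \<Lambda>"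
  by (auto simp: torus_def gen_pow_tprojoj)

lemma gen_pow_add: "gen_pow (j + k) = compose (torus \<Lambda>) (gen_pow j) (gen_pow k)"
  by (rule gen_pow_eqI) (simp_all add: compose_def gen_pow_tprojoj funpow_add)

lemma F_power_d: "(F ^^ (d * m)) z - z \<in> \<Lambda>"
proof (induction m)
  case (Suc m)
  have "(F ^^ (d * Suc m)) z = (F ^^ d) ((F ^^ (d * m)) z)"
    by (simp add: funpow_add)
  also have "\<dots> = (F ^^ (d * m)) z + of_nat d *s t"
    by (simp add: F_power[of d] order_d)
  finally have "(F ^^ (d * Suc m)) z - z = ((F ^^ (d * m)) z - z) + of_nat d *s t"
    by simp
  then show ?case
    using add_mem[OF Suc period] by (simp only:)
qed simp

lemma gen_pow_multiple: "gen_pow (d * m) = (\<lambda>x\<in>torus \<Lambda>. x)"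
  by (rule gen_pow_eqI) (simp_all add: torus_proj_eq_iff F_power_d)

lemma gen_pow_mod: "gen_pow k = gen_pow (k mod d)"
proof -
  have "gen_pow k = compose (torus \<Lambda>) (gen_pow (d * (k div d))) (gen_pow (k mod d))"
    using gen_pow_add[of "d * (k div d)" "k mod d"] by simp
  also have "\<dots> = gen_pow (k mod d)"
    by (rule extensionalityI[of _ "torus \<Lambda>"])
       (simp_all add: gen_pow_multiple compose_def gen_pow_closed gen_pow_extensional)
  finally show ?thesis .
qed

text \<open>A natural number that represents -k modulo d.\<close>

definition inv_exp :: "nat \<Rightarrow> nat" where
  "inv_exp k = (d - 1) * k"

lemma gen_pow_inverse:
  "compose (torus \<Lambda>) (gen_pow (inv_exp k)) (gen_pow k) = (\<lambda>x\<in>torus \<Lambda>. x)"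
  "compose (torus \<Lambda>) (gen_pow k) (gen_pow (inv_exp k)) = (\<lambda>x\<in>torus \<Lambda>. x)"
proof -
  have "inv_exp k + k = (d - 1 + 1) * k"
    by (simp only: inv_exp_def add_mult_distrib mult_1)
  also have "d - 1 + 1 = d"
    using d by simp
  finally have sum: "inv_exp k + k = d * k" "k + inv_exp k = d * k"
    by (simp_all only: add.commute)
  show "compose (torus \<Lambda>) (gen_pow (inv_exp k)) (gen_pow k) = (\<lambda>x\<in>torus \<Lambda>. x)"
    "compose (torus \<Lambda>) (gen_pow k) (gen_pow (inv_exp k)) = (\<lambda>x\<in>torus \<Lambda>. x)"
    by (simp_all only: gen_pow_add[symmetric] sum gen_pow_multiple)
qed

lemma gen_pow_inverse_apply:
  assumes "x \<in> torus \<Lambda>"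
  shows "gen_pow (inv_exp k) (gen_pow k x) = x" "gen_pow k (gen_pow (inv_exp k) x) = x"
  using fun_cong[OF gen_pow_inverse(1)[of k], of x] fun_cong[OF gen_pow_inverse(2)[of k], of x] assms
  by (simp_all add: compose_def)

lemma gen_pow_bij: "bij_betw (gen_pow k) (torus \<Lambda>) (torus \<Lambda>)"
  by (rule bij_betw_byWitness[where f' = "gen_pow (inv_exp k)"])
     (auto simp: gen_pow_inverse_apply gen_pow_closed)

lemma gen_pow_Bij: "gen_pow k \<in> Bij (torus \<Lambda>)"
  using gen_pow_bij by (simp add: Bij_def gen_pow_def)

lemma subgroup_cyclic_group: "subgroup cyclic_group (BijGroup (torus \<Lambda>))"
proof (rule group.subgroupI[OF group_BijGroup])
  show "cyclic_group \<subseteq> carrier (BijGroup (torus \<Lambda>))"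
    using gen_pow_Bij by (auto simp: cyclic_group_def BijGroup_def)
  show "cyclic_group \<noteq> {}"
    by (simp add: cyclic_group_def)
next
  fix a assume "a \<in> cyclic_group"
  then obtain k where k: "a = gen_pow k"
    by (auto simp: cyclic_group_def)
  have "inv\<^bsub>BijGroup (torus \<Lambda>)\<^esub> a = gen_pow (inv_exp k)"
    by (rule group.inv_equality[OF group_BijGroup])
       (use gen_pow_Bij in \<open>auto simp: k BijGroup_def gen_pow_inverse\<close>)
  then show "inv\<^bsub>BijGroup (torus \<Lambda>)\<^esub> a \<in> cyclic_group"
    by (simp add: cyclic_group_def)
next
  fix a b assume "a \<in> cyclic_group" "b \<in> cyclic_group"
  then obtain j k where "a = gen_pow j" "b = gen_pow k"
    by (auto simp: cyclic_group_def)
  then have "a \<otimes>\<^bsub>BijGroup (torus \<Lambda>)\<^esub> b = gen_pow (j + k)"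
    using gen_pow_Bij by (simp add: BijGroup_def gen_pow_add)
  then show "a \<otimes>\<^bsub>BijGroup (torus \<Lambda>)\<^esub> b \<in> cyclic_group"
    by (simp add: cyclic_group_def)
qed

lemma biholomorphic_gen_pow: "biholomorphic_map (torus_atlas \<Lambda>) (torus_atlas \<Lambda>) (gen_pow k)"
  unfolding biholomorphic_map_def points_torus_atlas
proof (intro conjI)
  show "bij_betw (gen_pow k) (torus \<Lambda>) (torus \<Lambda>)"
    by (rule gen_pow_bij)
  have holo: "holomorphic_map (torus_atlas \<Lambda>) (torus_atlas \<Lambda>) h"
    if "\<And>z. h (tproj z) = tproj ((F ^^ j) z)" for h j
    using F_power_affine[of j] affine_holomorphic_map_torus[of h] that by metis
  show "holomorphic_map (torus_atlas \<Lambda>) (torus_atlas \<Lambda>) (gen_pow k)"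
    by (rule holo) (rule gen_pow_tprojoj)
  show "holomorphic_map (torus_atlas \<Lambda>) (torus_atlas \<Lambda>) (inv_into (torus \<Lambda>) (gen_pow k))"
  proof (rule holo)
    fix z
    have "inv_into (torus \<Lambda>) (gen_pow k) (tproj z) = gen_pow (inv_exp k) (tproj z)"
      using gen_pow_bij gen_pow_closed gen_pow_inverse_apply
      by (intro inv_into_f_eq) (auto simp: bij_betw_def)
    then show "inv_into (torus \<Lambda>) (gen_pow k) (tproj z) = tproj ((F ^^ (inv_exp k)) z)"
      by (simp add: gen_pow_tprojoj)
  qed
qed

lemma cyclic_group_mod:
  assumes "g \<in> cyclic_group" "g \<noteq> (\<lambda>x\<in>torus \<Lambda>. x)"
  obtains k where "0 < k" "k < d" "g = gen_pow k"
proof -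
  obtain j where j: "g = gen_pow j"
    using assms(1) by (auto simp: cyclic_group_def)
  have "j mod d \<noteq> 0"
    using assms(2) gen_pow_mod[of j] gen_pow_multiple[of 0] j by auto
  then show thesis
    using that[of "j mod d"] gen_pow_mod[of j] j d by auto
qed

lemma gen_pow_no_fixed_point:
  assumes "0 < k" "k < d" "x \<in> torus \<Lambda>"
  shows "gen_pow k x \<noteq> x"
proof -
  obtain z where z: "x = tproj z"
    using assms(3) by (auto simp: torus_def)
  have "(F ^^ k) z - z \<notin> \<Lambda>"
    using free[OF assms(1,2), of z] by (simp only: F_power not_False_eq_True)
  then show ?thesis
    by (simp add: z gen_pow_tprojoj torus_proj_eq_iff)
qed

text \<open>A power equal to a translation would have the identity as its linear part, against
  \<open>nontrivial\<close>.\<close>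

lemma gen_pow_no_translation:
  assumes k: "0 < k" "k < d"
  shows "\<not> is_translation \<Lambda> (gen_pow k)"
proof
  assume "is_translation \<Lambda> (gen_pow k)"
  then obtain a where a: "\<And>z. gen_pow k (tproj z) = tproj (z + a)"
    by (auto simp: is_translation_def)
  obtain M c where M: "\<And>z. (F ^^ k) z = M *v z + c"
    using F_power_affine by blast
  have "(F ^^ k) z - (z + a) \<in> \<Lambda>" for z
    using a[of z] by (simp only: gen_pow_tprojoj torus_proj_eq_iff)
  moreover have "continuous_on UNIV (\<lambda>z. M *v z + c)"
    by (rule continuous_at_imp_continuous_on) (blast intro: has_derivative_continuous has_derivative_affine)
  then have "continuous_on UNIV (\<lambda>z. M *v z + c - (z + a))"
    by (intro continuous_intros)
  ultimately have "(\<lambda>z. M *v z + c - (z + a)) constant_on UNIV"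
    unfolding M by (intro continuous_into_lattice_constant) auto
  then obtain e where e: "\<And>z. M *v z + c - (z + a) = e"
    unfolding constant_on_def by blast
  have "(((*v) A) ^^ k) z = z" for z
  proof -
    have zero: "(((*v) A) ^^ k) 0 = 0"
      by (induction k) simp_all
    have "(F ^^ k) z - z = (F ^^ k) 0 - 0"
      using e[of z] e[of 0] by (simp add: M algebra_simps)
    then show ?thesis
      by (simp add: F_power zero)
  qed
  then show False
    using nontrivial[OF k] by blast
qed

lemma hyperelliptic_cyclic_group: "hyperelliptic \<Lambda> cyclic_group"
  unfolding hyperelliptic_def
proof (intro conjI)
  have one: "\<one>\<^bsub>BijGroup (torus \<Lambda>)\<^esub> = (\<lambda>x\<in>torus \<Lambda>. x)"
    by (simp add: BijGroup_def)
  show "full_lattice \<Lambda>"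
    unfolding full_lattice_iff using lattice_basis_axioms by blast
  show "subgroup cyclic_group (BijGroup (torus \<Lambda>))"
    by (rule subgroup_cyclic_group)
  have "cyclic_group \<subseteq> gen_pow ` {..<d}"
  proof
    fix g assume "g \<in> cyclic_group"
    then obtain k where "g = gen_pow (k mod d)"
      using gen_pow_mod by (auto simp: cyclic_group_def)
    then show "g \<in> gen_pow ` {..<d}"
      using d by auto
  qed
  then show "finite cyclic_group"
    by (rule finite_subset) simp
  have "gen_pow 1 (tproj 0) \<noteq> (\<lambda>x\<in>torus \<Lambda>. x) (tproj 0)"
    using gen_pow_no_fixed_point[of 1 "tproj 0"] d by simp
  then have "gen_pow 1 \<noteq> (\<lambda>x\<in>torus \<Lambda>. x)"
    by metis
  then show "cyclic_group \<noteq> {\<one>\<^bsub>BijGroup (torus \<Lambda>)\<^esub>}"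
    unfolding one cyclic_group_def by (metis rangeI singletonD)
  show "\<forall>g\<in>cyclic_group. biholomorphic_map (torus_atlas \<Lambda>) (torus_atlas \<Lambda>) g"
    using biholomorphic_gen_pow by (auto simp: cyclic_group_def)
  show "\<forall>g\<in>cyclic_group. g \<noteq> \<one>\<^bsub>BijGroup (torus \<Lambda>)\<^esub> \<longrightarrow> (\<forall>x\<in>torus \<Lambda>. g x \<noteq> x)"
    unfolding one using gen_pow_no_fixed_point cyclic_group_mod by metis
  show "\<forall>g\<in>cyclic_group. g \<noteq> \<one>\<^bsub>BijGroup (torus \<Lambda>)\<^esub> \<longrightarrow> \<not> is_translation \<Lambda> g"
    unfolding one using gen_pow_no_translation cyclic_group_mod by metis
qed

lemma det_power_eq_1:
  assumes "trivial_line_bundle (hyperelliptic_atlas \<Lambda> cyclic_group) (tensor_power m canonical_bundle)"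
  shows "det A ^ m = 1"
proof -
  interpret hyperelliptic_data \<Lambda> B cyclic_group
    by unfold_locales (rule hyperelliptic_cyclic_group)
  have "affine_rep (gen_pow 1) A t"
    unfolding affine_rep_def by (simp add: gen_pow_tprojoj F_def)
  moreover have "gen_pow 1 \<in> cyclic_group"
    by (simp add: cyclic_group_def)
  ultimately show ?thesis
    using det_power_eq_1_if_trivial[OF assms] by blast
qed

end

section \<open>Lattices from roots of unity\<close>

definition ipoly :: "int poly \<Rightarrow> complex \<Rightarrow> complex" where
  "ipoly q z = poly (map_poly of_int q) z"

lemma ipoly_0 [simp]: "ipoly 0 z = 0"
  and ipoly_pCons [simp]: "ipoly (pCons c q) z = of_int c + z * ipoly q z"
  and ipoly_1 [simp]: "ipoly 1 z = 1"
  and ipoly_add [simp]: "ipoly (p + q) z = ipoly p z + ipoly q z"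
  and ipoly_mult [simp]: "ipoly (p * q) z = ipoly p z * ipoly q z"
  by (simp_all add: ipoly_def of_int_hom.map_poly_pCons_hom of_int_poly_hom.hom_add of_int_poly_hom.hom_mult)

lemma ipoly_monom [simp]: "ipoly (monom c k) z = of_int c * z ^ k"
  by (simp add: ipoly_def map_poly_monom poly_monom)

lemma ipoly_sum [simp]: "ipoly (sum p S) z = (\<Sum>i\<in>S. ipoly (p i) z)"
  by (induction S rule: infinite_finite_induct) simp_all

text \<open>For a quadratic integer z the ring Z[z] is just Z + Z z. This serves to see that a
  rational number in Z[z], with z not real, is an integer.\<close>

lemma ipoly_quadratic:
  assumes "z\<^sup>2 = of_int s * z + of_int p"
  shows "\<exists>a b. ipoly q z = of_int a + of_int b * z"
proof (induction q)
  case 0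
  show ?case
    by (intro exI[of _ 0]) simp
next
  case (pCons c q)
  then obtain a b where ab: "ipoly q z = of_int a + of_int b * z" by blast
  have "ipoly (pCons c q) z = of_int c + of_int a * z + of_int b * z\<^sup>2"
    by (simp add: ab algebra_simps power2_eq_square)
  also have "\<dots> = of_int (c + b * p) + of_int (a + b * s) * z"
    by (simp add: assms algebra_simps)
  finally show ?case by blast
qed

text \<open>\<open>\<delta>\<close> selects one root from each conjugate pair of M; the case i = j
  of \<open>nonconj\<close> excludes real roots. Evaluation at these roots makes Z[x]/(M) a full
  lattice, also when M is a product of several cyclotomic polynomials.\<close>

locale root_lattice =
  fixes \<delta> :: "'n::finite \<Rightarrow> complex" and M :: "int poly"
  assumes inj_\<delta>: "inj \<delta>" and nonconj: "\<delta> i \<noteq> cnj (\<delta> j)"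
    and monic: "lead_coeff M = 1" and degree_M: "degree M = 2 * CARD('n)"
    and root: "ipoly M (\<delta> i) = 0"
begin

definition ev :: "int poly \<Rightarrow> complex ^ 'n" where
  "ev q = (\<chi> i. ipoly q (\<delta> i))"

definition pow :: "nat \<Rightarrow> complex ^ 'n" where
  "pow k = (\<chi> i. \<delta> i ^ k)"

definition \<Lambda> :: "(complex ^ 'n) set" where
  "\<Lambda> = range ev"

lemma ev_reduce: "\<exists>r. ev q = ev r \<and> degree r < 2 * CARD('n)"
proof -
  \<comment> \<open>Pseudo-division stays within the integers, and for monic M it is ordinary
    division with remainder.\<close>
  obtain s r where sr: "pseudo_divmod q M = (s, r)"
    by fastforce
  have "M \<noteq> 0"
    using monic by auto
  then have "Polynomial.smult (coeff M (degree M) ^ (Suc (degree q) - degree M)) q = M * s + r"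
    and deg: "r = 0 \<or> degree r < degree M"
    using pseudo_divmod[OF _ sr] by blast+
  then have "q = M * s + r"
    using monic by simp
  then have "ev q = ev r"
    by (simp add: ev_def Finite_Cartesian_Product.vec_eq_iff root)
  moreover have "degree r < 2 * CARD('n)"
    using deg degree_M by auto
  ultimately show ?thesis by blast
qed

text \<open>A real polynomial of degree less than \<open>2 n\<close> cannot vanish at all the \<open>\<delta> i\<close> and their conjugates.\<close>

lemma pow_independent:
  assumes "(\<Sum>k\<in>{..<2 * CARD('n)}. r k *\<^sub>R pow k) = 0" "k \<in> {..<2 * CARD('n)}"
  shows "r k = 0"
proof -
  define p where "p = (\<Sum>k\<in>{..<2 * CARD('n)}. monom (complex_of_real (r k)) k)"
  have coeff: "coeff p j = (if j \<in> {..<2 * CARD('n)} then of_real (r j) else 0)" for j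
    by (simp add: p_def coeff_sum if_distrib cong: if_cong)
  have root_\<delta>: "poly p (\<delta> i) = 0" for i
  proof -
    have "poly p (\<delta> i) = (\<Sum>k\<in>{..<2 * CARD('n)}. r k *\<^sub>R pow k) $ i"
      unfolding sum_component vector_scaleR_component
      by (simp add: p_def poly_sum poly_monom pow_def scaleR_conv_of_real)
    then show ?thesis
      using assms(1) by simp
  qed
  have root_cnj: "poly p (cnj (\<delta> i)) = 0" for i
  proof -
    have "poly p (cnj (\<delta> i)) = cnj (poly p (\<delta> i))"
      by (simp add: p_def poly_sum poly_monom)
    then show ?thesis
      using root_\<delta> by simp
  qed
  have "p = 0"
  proof (rule ccontr)
    assume "p \<noteq> 0"
    have "inj (cnj \<circ> \<delta>)"
      using inj_\<delta> by (auto simp: inj_on_def)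
    moreover have "range \<delta> \<inter> range (cnj \<circ> \<delta>) = {}"
      using nonconj by auto
    ultimately have "card (range \<delta> \<union> range (cnj \<circ> \<delta>)) = 2 * CARD('n)"
      using card_image[OF inj_\<delta>] card_image[of "cnj \<circ> \<delta>" UNIV]
        card_Un_disjoint[of "range \<delta>" "range (cnj \<circ> \<delta>)"] by simp
    moreover have "card (range \<delta> \<union> range (cnj \<circ> \<delta>)) \<le> card {z. poly p z = 0}"
      using root_\<delta> root_cnj by (intro card_mono poly_roots_finite \<open>p \<noteq> 0\<close>) auto
    moreover have "card {z. poly p z = 0} \<le> degree p"
      using card_poly_roots_bound[OF \<open>p \<noteq> 0\<close>] .
    moreover have "degree p < 2 * CARD('n)"
    proof (rule ccontr)
      assume "\<not> degree p < 2 * CARD('n)"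
      then have "lead_coeff p = 0"
        by (simp add: coeff)
      with \<open>p \<noteq> 0\<close> show False by simp
    qed
    ultimately show False by simp
  qed
  then show ?thesis
    using coeff[of k] assms(2) by simp
qed

text \<open>\<open>pow_independent\<close> is indexed by exponents; injectivity is needed to read it
  as independence of a set of vectors.\<close>

lemma inj_pow: "inj_on pow {..<2 * CARD('n)}"
proof (rule inj_onI, rule ccontr)
  fix j k assume jk: "j \<in> {..<2 * CARD('n)}" "k \<in> {..<2 * CARD('n)}" "pow j = pow k" "j \<noteq> k"
  define r where "r = (\<lambda>i. if i = j then 1 else if i = k then -1 else (0::real))"
  have "(\<Sum>i\<in>{..<2 * CARD('n)}. r i *\<^sub>R pow i) = (\<Sum>i\<in>{j, k}. r i *\<^sub>R pow i)"
    by (rule sum.mono_neutral_right) (use jk in \<open>auto simp: r_def\<close>)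
  also have "\<dots> = 0"
    using jk by (simp add: r_def)
  finally have "r j = 0"
    by (rule pow_independent) (rule jk(1))
  then show False
    by (simp add: r_def)
qed

lemma ev_eq_sum:
  assumes "\<And>i. ipoly q (\<delta> i) = (\<Sum>k\<in>{..<2 * CARD('n)}. of_int (c k) * \<delta> i ^ k)"
  shows "ev q = (\<Sum>k\<in>{..<2 * CARD('n)}. of_int (c k) *\<^sub>R pow k)"
proof -
  have "ev q $ i = (\<Sum>k\<in>{..<2 * CARD('n)}. of_int (c k) *\<^sub>R pow k) $ i" for i
    unfolding sum_component vector_scaleR_component
    by (simp add: ev_def pow_def assms scaleR_conv_of_real)
  then show ?thesis
    by (simp add: Finite_Cartesian_Product.vec_eq_iff)
qed

sublocale lattice_basis \<Lambda> "pow ` {..<2 * CARD('n)}"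
proof
  have sum: "(\<Sum>b\<in>pow ` {..<2 * CARD('n)}. f b) = (\<Sum>k\<in>{..<2 * CARD('n)}. f (pow k))" for f :: "_ \<Rightarrow> complex ^ 'n"
    by (simp add: sum.reindex[OF inj_pow])
  show indep: "independent (pow ` {..<2 * CARD('n)})"
  proof
    assume "dependent (pow ` {..<2 * CARD('n)})"
    then obtain u b where b: "b \<in> pow ` {..<2 * CARD('n)}" "u b \<noteq> 0" and "(\<Sum>b\<in>pow ` {..<2 * CARD('n)}. u b *\<^sub>R b) = 0"
      using real_vector.dependent_finite[of "pow ` {..<2 * CARD('n)}"] by auto
    then have "(\<Sum>k\<in>{..<2 * CARD('n)}. u (pow k) *\<^sub>R pow k) = 0"
      by (simp only: sum)
    then have "u (pow k) = 0" if "k \<in> {..<2 * CARD('n)}" for k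
      using pow_independent[of "\<lambda>k. u (pow k)"] that by blast
    with b show False by blast
  qed
  have "dim (UNIV :: (complex ^ 'n) set) \<le> card (pow ` {..<2 * CARD('n)})"
    by (simp add: card_image[OF inj_pow])
  then have "UNIV \<subseteq> span (pow ` {..<2 * CARD('n)})"
    using indep by (intro card_ge_dim_independent) auto
  then show "span (pow ` {..<2 * CARD('n)}) = UNIV" by blast
  show "\<Lambda> = {\<Sum>b\<in>pow ` {..<2 * CARD('n)}. of_int (c b) *\<^sub>R b | c. True}"
  proof (intro equalityI subsetI)
    fix z assume "z \<in> \<Lambda>"
    then obtain r where r: "z = ev r" "degree r < 2 * CARD('n)"
      using ev_reduce unfolding \<Lambda>_def by blast
    have "ipoly r w = (\<Sum>k\<in>{..<2 * CARD('n)}. of_int (coeff r k) * w ^ k)" for w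
    proof -
      have "ipoly r w = (\<Sum>k\<le>degree r. of_int (coeff r k) * w ^ k)"
        by (simp add: ipoly_def poly_altdef coeff_map_poly)
      also have "\<dots> = (\<Sum>k\<in>{..<2 * CARD('n)}. of_int (coeff r k) * w ^ k)"
        by (rule sum.mono_neutral_left) (use r(2) in \<open>auto intro: coeff_eq_0\<close>)
      finally show ?thesis .
    qed
    then have "z = (\<Sum>k\<in>{..<2 * CARD('n)}. of_int (coeff r k) *\<^sub>R pow k)"
      unfolding r(1) by (rule ev_eq_sum)
    \<comment> \<open>Lattice coefficients are indexed by basis vectors instead of exponents, so the
      exponent is recovered from the vector.\<close>
    also have "\<dots> = (\<Sum>k\<in>{..<2 * CARD('n)}. of_int (coeff r (inv_into {..<2 * CARD('n)} pow (pow k))) *\<^sub>R pow k)"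
      by (rule sum.cong) (simp_all add: inv_into_f_f[OF inj_pow])
    also have "\<dots> = (\<Sum>b\<in>pow ` {..<2 * CARD('n)}. of_int (coeff r (inv_into {..<2 * CARD('n)} pow b)) *\<^sub>R b)"
      by (simp only: sum)
    finally show "z \<in> {\<Sum>b\<in>pow ` {..<2 * CARD('n)}. of_int (c b) *\<^sub>R b | c. True}"
      by (intro CollectI exI[of _ "\<lambda>b. coeff r (inv_into {..<2 * CARD('n)} pow b)"]) simp
  next
    fix z assume "z \<in> {\<Sum>b\<in>pow ` {..<2 * CARD('n)}. of_int (c b) *\<^sub>R b | c. True}"
    then obtain c where "z = (\<Sum>b\<in>pow ` {..<2 * CARD('n)}. of_int (c b) *\<^sub>R b)" by blast
    also have "\<dots> = (\<Sum>k\<in>{..<2 * CARD('n)}. of_int (c (pow k)) *\<^sub>R pow k)"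
      by (simp only: sum)
    also have "\<dots> = ev (\<Sum>k\<in>{..<2 * CARD('n)}. monom (c (pow k)) k)"
      by (rule ev_eq_sum[symmetric]) simp
    finally show "z \<in> \<Lambda>"
      by (simp add: \<Lambda>_def)
  qed
qed

text \<open>Multiplication by x^e on Z[x]/(M) in root coordinates. The exponent e is meant to turn
  the root of the factor that carries the translation into 1, while the order d survives on another
  factor.\<close>

definition diag_power :: "nat \<Rightarrow> complex ^ 'n ^ 'n" where
  "diag_power e = (\<chi> i j. if i = j then \<delta> i ^ e else 0)"

lemma diag_power_mult: "(diag_power e *v z) $ i = \<delta> i ^ e * z $ i"
  by (simp add: diag_power_def matrix_vector_mult_def if_distrib[of "\<lambda>x. x * _"] cong: if_cong)

lemma diag_power_funpow: "((((*v) (diag_power e)) ^^ k) z) $ i = \<delta> i ^ (e * k) * z $ i"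
  by (induction k) (simp_all add: diag_power_mult power_add)

lemma det_diag_power: "det (diag_power e) = (\<Prod>i\<in>UNIV. \<delta> i ^ e)"
  unfolding diag_power_def by (subst det_diagonal) simp_all

text \<open>
  The translation part \<open>ev q / d\<close> acts only where \<open>diag_power e\<close> has eigenvalue \<open>1\<close>. If \<open>q\<close> is a unit at such
  a quadratic \<open>\<delta> j\<close>, then a fixed point of the \<open>k\<close>-th power would make \<open>k / d\<close> an algebraic integer.
\<close>

lemma cyclic_action_diag_power:
  assumes d: "1 < d" and order: "\<And>i. \<delta> i ^ (e * d) = 1"
    and q: "\<And>i. \<delta> i ^ e = 1 \<or> ipoly q (\<delta> i) = 0"
    and j: "\<delta> j ^ e = 1" "ipoly u (\<delta> j) * ipoly q (\<delta> j) = 1"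
      "(\<delta> j)\<^sup>2 = of_int s * \<delta> j + of_int p"
    and i: "\<And>k. \<delta> i ^ (e * k) = 1 \<Longrightarrow> d dvd k"
  shows "cyclic_action \<Lambda> (pow ` {..<2 * CARD('n)}) (diag_power e) ((1 / of_nat d) *s ev q) d"
proof unfold_locales
  let ?t = "(1 / of_nat d) *s ev q"
  show "1 < d" by (rule d)
  show "diag_power e *v l \<in> \<Lambda>" if l: "l \<in> \<Lambda>" for l
  proof -
    obtain r where "l = ev r"
      using l by (auto simp: \<Lambda>_def)
    then have "diag_power e *v l = ev (monom 1 e * r)"
      by (simp add: Finite_Cartesian_Product.vec_eq_iff diag_power_mult ev_def)
    then show ?thesis
      by (simp add: \<Lambda>_def)
  qed
  show "(((*v) (diag_power e)) ^^ d) z = z" for z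
    by (simp add: Finite_Cartesian_Product.vec_eq_iff diag_power_funpow order)
  show "diag_power e *v ?t = ?t"
    using q by (simp add: Finite_Cartesian_Product.vec_eq_iff diag_power_mult ev_def)
      (metis mult_zero_left mult_zero_right mult_1_left)
  have "of_nat d *s ?t = ev q"
    using d by (simp add: Finite_Cartesian_Product.vec_eq_iff)
  then show "of_nat d *s ?t \<in> \<Lambda>"
    by (simp add: \<Lambda>_def)
  fix k :: nat assume k: "0 < k" "k < d"
  show "\<exists>z. (((*v) (diag_power e)) ^^ k) z \<noteq> z"
  proof (rule ccontr)
    assume "\<nexists>z. (((*v) (diag_power e)) ^^ k) z \<noteq> z"
    then have "((((*v) (diag_power e)) ^^ k) (\<chi> i. 1)) $ i = 1" for i
      by simp
    then have "\<delta> i ^ (e * k) = 1"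
      by (simp add: diag_power_funpow)
    then show False
      using i[of k] k by (auto dest: dvd_imp_le)
  qed
  fix z
  show "(((*v) (diag_power e)) ^^ k) z + of_nat k *s ?t - z \<notin> \<Lambda>"
  proof
    assume "(((*v) (diag_power e)) ^^ k) z + of_nat k *s ?t - z \<in> \<Lambda>"
    then obtain r where r: "(((*v) (diag_power e)) ^^ k) z + of_nat k *s ?t - z = ev r"
      by (auto simp: \<Lambda>_def)
    \<comment> \<open>In coordinate j the linear part is the identity, so z cancels and only the
      translation is left.\<close>
    have "((((*v) (diag_power e)) ^^ k) z + of_nat k *s ?t - z) $ j = of_nat k / of_nat d * ipoly q (\<delta> j)"
      by (simp add: diag_power_funpow power_mult j(1) ev_def)
    then have *: "of_nat k / of_nat d * ipoly q (\<delta> j) = ipoly r (\<delta> j)"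
      unfolding r by (simp add: ev_def)
    \<comment> \<open>Multiplication by the inverse of q at \<open>\<delta> j\<close> puts k / d
      itself into Z[\<open>\<delta> j\<close>].\<close>
    have "of_nat k / of_nat d = of_nat k / of_nat d * (ipoly u (\<delta> j) * ipoly q (\<delta> j))"
      using j(2) by simp
    also have "\<dots> = ipoly u (\<delta> j) * (of_nat k / of_nat d * ipoly q (\<delta> j))"
      by (simp only: mult_ac)
    also have "\<dots> = ipoly (u * r) (\<delta> j)"
      by (simp only: * ipoly_mult)
    finally have "of_nat k / of_nat d = ipoly (u * r) (\<delta> j)" .
    moreover obtain a b where ab: "ipoly (u * r) (\<delta> j) = of_int a + of_int b * \<delta> j"
      using ipoly_quadratic[OF j(3)] by blast
    ultimately have eq: "complex_of_real (real k / real d) = of_int a + of_int b * \<delta> j"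
      by simp
    \<comment> \<open>As \<open>\<delta> j\<close> is not real but k / d is, the coefficient b
      vanishes and k / d would be the integer a.\<close>
    have "Im (\<delta> j) \<noteq> 0"
      using nonconj[of j j] by (auto simp: complex_eq_iff)
    moreover have "Im (of_int a + of_int b * \<delta> j) = 0"
      by (simp flip: eq)
    ultimately have "b = 0" by simp
    then have "real k / real d = of_int a"
      using arg_cong[OF eq, of Re] by simp
    then have "real k = of_int (a * int d)"
      using d by (simp add: field_simps)
    then have "int k = a * int d"
      by linarith
    then have "int d dvd int k" by simp
    then have "d dvd k" by simp
    then show False
      using k by (auto dest: dvd_imp_le)
  qed
qed

end

section \<open>Lattices and determinants from powers of one primitive root of unity\<close>

definition unity_root :: "nat \<Rightarrow> complex" where
  "unity_root N = cis (2 * pi / real N)"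

lemma unity_root_power_eq_1_iff:
  assumes "0 < N"
  shows "unity_root N ^ m = 1 \<longleftrightarrow> N dvd m"
proof -
  have "unity_root N ^ m = cis (real m * (2 * pi / real N))"
    by (simp only: unity_root_def Complex.DeMoivre)
  also have "\<dots> = exp (2 * of_real pi * \<i> * of_nat m / of_nat N)"
    by (simp add: cis_conv_exp mult_ac)
  finally show ?thesis
    using complex_root_unity_eq_1[of N m] assms by simp
qed

lemma unity_root_power_inj:
  assumes "a < N" "b < N" "unity_root N ^ a = unity_root N ^ b"
  shows "a = b"
proof -
  have nz: "unity_root N \<noteq> 0"
    by (simp add: unity_root_def)
  have *: "x = y" if "x \<le> y" "y < N" "unity_root N ^ x = unity_root N ^ y" for x y
  proof -
    have "unity_root N ^ y = unity_root N ^ x * unity_root N ^ (y - x)"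
      using that(1) by (simp flip: power_add)
    then have "unity_root N ^ (y - x) = 1"
      using that(3) nz by simp
    then have "N dvd y - x"
      using unity_root_power_eq_1_iff[of N] that(2) by simp
    then show ?thesis
      using that by (auto dest: dvd_imp_le)
  qed
  show ?thesis
    using *[of a b] *[of b a] assms by (cases "a \<le> b") auto
qed

text \<open>All roots are powers of one primitive N-th root of unity, so distinctness and
  nonconjugacy become conditions on exponents: two powers are conjugate when their exponents add up
  to 0 modulo N.\<close>

lemma unity_root_root_lattice:
  fixes a :: "'n::finite \<Rightarrow> nat"
  assumes a: "\<forall>i. a i < N" "\<forall>i j. a i = a j \<longrightarrow> i = j" "\<forall>i j. \<not> N dvd a i + a j"
    and M: "lead_coeff M = 1" "degree M = 2 * CARD('n)" "\<forall>i. ipoly M (unity_root N ^ a i) = 0"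
  shows "root_lattice (\<lambda>i. unity_root N ^ a i) M"
proof
  have N: "0 < N"
    using a(1) by (metis gr0I not_less0)
  show "inj (\<lambda>i. unity_root N ^ a i)"
    using unity_root_power_inj a(1,2) by (blast intro: injI)
  show "unity_root N ^ a i \<noteq> cnj (unity_root N ^ a j)" for i j
  proof
    assume "unity_root N ^ a i = cnj (unity_root N ^ a j)"
    then have "unity_root N ^ (a i + a j) = unity_root N ^ a j * cnj (unity_root N ^ a j)"
      by (simp add: power_add)
    also have "\<dots> = 1"
      using complex_norm_square[of "unity_root N ^ a j"] by (simp add: unity_root_def norm_power)
    finally show False
      using unity_root_power_eq_1_iff[OF N] a(3) by blast
  qed
qed (use M in auto)

text \<open>The determinant of \<open>diag_power e\<close> is the power
  \<open>sum a UNIV * e\<close> of the primitive N-th root, and its m-th power must be 1. The index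
  j marks a coordinate that carries the translation, i one that shows the order d.\<close>

lemma triviality_order_dvd:
  fixes a :: "'n::finite \<Rightarrow> nat"
  assumes triv: "\<And>(\<Lambda> :: (complex ^ 'n) set) G. hyperelliptic \<Lambda> G \<Longrightarrow>
      trivial_line_bundle (hyperelliptic_atlas \<Lambda> G) (tensor_power m canonical_bundle)"
    and lattice: "root_lattice (\<lambda>i. unity_root N ^ a i) M" and N: "0 < N" and d: "1 < d"
    and order: "\<forall>i. N dvd a i * (e * d)"
    and q: "\<forall>i. N dvd a i * e \<or> ipoly q (unity_root N ^ a i) = 0"
    and j: "N dvd a j * e" "ipoly u (unity_root N ^ a j) * ipoly q (unity_root N ^ a j) = 1"
      "(unity_root N ^ a j)\<^sup>2 = of_int s * unity_root N ^ a j + of_int p"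
    and i: "\<And>k. N dvd a i * (e * k) \<Longrightarrow> d dvd k"
  shows "N dvd sum a UNIV * e * m"
proof -
  interpret root_lattice "\<lambda>i. unity_root N ^ a i" M
    by (rule lattice)
  have pow_eq: "(unity_root N ^ a i) ^ k = 1 \<longleftrightarrow> N dvd a i * k" for i k
    by (simp add: unity_root_power_eq_1_iff[OF N] flip: power_mult)
  interpret cyclic_action \<Lambda> "pow ` {..<2 * CARD('n)}" "diag_power e" "(1 / of_nat d) *s ev q" d
    by (rule cyclic_action_diag_power[OF d _ _ _ j(2,3), of e i])
       (use order q j(1) i in \<open>simp_all only: pow_eq\<close>)
  have "det (diag_power e) ^ m = 1"
    by (rule det_power_eq_1) (rule triv[OF hyperelliptic_cyclic_group])
  moreover have "det (diag_power e) ^ m = unity_root N ^ (sum a UNIV * e * m)"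
    by (simp add: det_diag_power power_mult power_sum flip: prod_power_distrib)
  ultimately show ?thesis
    using unity_root_power_eq_1_iff[OF N] by simp
qed

section \<open>Hyperelliptic manifolds of dimensions 2, 3 and 4\<close>

definition phi3 :: "int poly" where "phi3 = [:1, 1, 1:]"
definition phi4 :: "int poly" where "phi4 = [:1, 0, 1:]"
definition phi5 :: "int poly" where "phi5 = [:1, 1, 1, 1, 1:]"
definition phi6 :: "int poly" where "phi6 = [:1, -1, 1:]"
definition phi7 :: "int poly" where "phi7 = [:1, 1, 1, 1, 1, 1, 1:]"
definition phi8 :: "int poly" where "phi8 = [:1, 0, 0, 0, 1:]"
definition phi9 :: "int poly" where "phi9 = [:1, 0, 0, 1, 0, 0, 1:]"

lemmas phi_defs = phi3_def phi4_def phi5_def phi6_def phi7_def phi8_def phi9_def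

lemma phi_degree: "degree phi3 = 2" "degree phi4 = 2" "degree phi5 = 4" "degree phi6 = 2"
    "degree phi7 = 6" "degree phi8 = 4" "degree phi9 = 6"
  and phi_monic: "lead_coeff phi3 = 1" "lead_coeff phi4 = 1" "lead_coeff phi5 = 1" "lead_coeff phi6 = 1"
    "lead_coeff phi7 = 1" "lead_coeff phi8 = 1" "lead_coeff phi9 = 1"
  and phi_nonzero: "phi3 \<noteq> 0" "phi4 \<noteq> 0" "phi5 \<noteq> 0" "phi6 \<noteq> 0" "phi7 \<noteq> 0" "phi8 \<noteq> 0" "phi9 \<noteq> 0"
  by (simp_all add: phi_defs)

lemma ipoly_phi3_eq_0: "z ^ 3 = 1 \<Longrightarrow> z \<noteq> 1 \<Longrightarrow> ipoly phi3 z = 0"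
proof -
  assume z: "z ^ 3 = 1" "z \<noteq> 1"
  have "(z - 1) * ipoly phi3 z = z ^ 3 - 1"
    by (simp add: phi3_def) Groebner_Basis.algebra
  then show "ipoly phi3 z = 0"
    using z by simp
qed

lemma ipoly_phi4_eq_0: "z ^ 4 = 1 \<Longrightarrow> z\<^sup>2 \<noteq> 1 \<Longrightarrow> ipoly phi4 z = 0"
proof -
  assume z: "z ^ 4 = 1" "z\<^sup>2 \<noteq> 1"
  have "(z\<^sup>2 - 1) * ipoly phi4 z = z ^ 4 - 1"
    by (simp add: phi4_def) Groebner_Basis.algebra
  then show "ipoly phi4 z = 0"
    using z by simp
qed

lemma ipoly_phi5_eq_0: "z ^ 5 = 1 \<Longrightarrow> z \<noteq> 1 \<Longrightarrow> ipoly phi5 z = 0"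
proof -
  assume z: "z ^ 5 = 1" "z \<noteq> 1"
  have "(z - 1) * ipoly phi5 z = z ^ 5 - 1"
    by (simp add: phi5_def) Groebner_Basis.algebra
  then show "ipoly phi5 z = 0"
    using z by simp
qed

lemma ipoly_phi7_eq_0: "z ^ 7 = 1 \<Longrightarrow> z \<noteq> 1 \<Longrightarrow> ipoly phi7 z = 0"
proof -
  assume z: "z ^ 7 = 1" "z \<noteq> 1"
  have "(z - 1) * ipoly phi7 z = z ^ 7 - 1"
    by (simp add: phi7_def) Groebner_Basis.algebra
  then show "ipoly phi7 z = 0"
    using z by simp
qed

lemma ipoly_phi8_eq_0: "z ^ 8 = 1 \<Longrightarrow> z ^ 4 \<noteq> 1 \<Longrightarrow> ipoly phi8 z = 0"
proof -
  assume z: "z ^ 8 = 1" "z ^ 4 \<noteq> 1"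
  have "(z ^ 4 - 1) * ipoly phi8 z = z ^ 8 - 1"
    by (simp add: phi8_def) Groebner_Basis.algebra
  then show "ipoly phi8 z = 0"
    using z by simp
qed

lemma ipoly_phi9_eq_0: "z ^ 9 = 1 \<Longrightarrow> z ^ 3 \<noteq> 1 \<Longrightarrow> ipoly phi9 z = 0"
proof -
  assume z: "z ^ 9 = 1" "z ^ 3 \<noteq> 1"
  have "(z ^ 3 - 1) * ipoly phi9 z = z ^ 9 - 1"
    by (simp add: phi9_def) Groebner_Basis.algebra
  then show "ipoly phi9 z = 0"
    using z by simp
qed

lemma ipoly_phi6_eq_0: "z ^ 6 = 1 \<Longrightarrow> z ^ 3 \<noteq> 1 \<Longrightarrow> z\<^sup>2 \<noteq> 1 \<Longrightarrow> ipoly phi6 z = 0"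
proof -
  assume z: "z ^ 6 = 1" "z ^ 3 \<noteq> 1" "z\<^sup>2 \<noteq> 1"
  have "(z ^ 3 - 1) * (z + 1) * ipoly phi6 z = z ^ 6 - 1"
    by (simp add: phi6_def) Groebner_Basis.algebra
  moreover have "z + 1 \<noteq> 0"
  proof
    assume "z + 1 = 0"
    then have "z = -1"
      by (simp add: eq_neg_iff_add_eq_0)
    then show False
      using z(3) by simp
  qed
  ultimately show "ipoly phi6 z = 0"
    using z by simp
qed

lemma unity_root_power_power_eq_1_iff:
  "0 < N \<Longrightarrow> (unity_root N ^ a) ^ k = 1 \<longleftrightarrow> N dvd a * k"
  by (simp add: unity_root_power_eq_1_iff flip: power_mult)

lemma ipoly_phi_unity_root:
  assumes "0 < N"
  shows "N dvd a * 3 \<Longrightarrow> \<not> N dvd a \<Longrightarrow> ipoly phi3 (unity_root N ^ a) = 0"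
    and "N dvd a * 4 \<Longrightarrow> \<not> N dvd a * 2 \<Longrightarrow> ipoly phi4 (unity_root N ^ a) = 0"
    and "N dvd a * 5 \<Longrightarrow> \<not> N dvd a \<Longrightarrow> ipoly phi5 (unity_root N ^ a) = 0"
    and "N dvd a * 6 \<Longrightarrow> \<not> N dvd a * 3 \<Longrightarrow> \<not> N dvd a * 2 \<Longrightarrow> ipoly phi6 (unity_root N ^ a) = 0"
    and "N dvd a * 7 \<Longrightarrow> \<not> N dvd a \<Longrightarrow> ipoly phi7 (unity_root N ^ a) = 0"
    and "N dvd a * 8 \<Longrightarrow> \<not> N dvd a * 4 \<Longrightarrow> ipoly phi8 (unity_root N ^ a) = 0"
    and "N dvd a * 9 \<Longrightarrow> \<not> N dvd a * 3 \<Longrightarrow> ipoly phi9 (unity_root N ^ a) = 0"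
  by (simp_all add: ipoly_phi3_eq_0 ipoly_phi4_eq_0 ipoly_phi5_eq_0 ipoly_phi6_eq_0 ipoly_phi7_eq_0
      ipoly_phi8_eq_0 ipoly_phi9_eq_0 unity_root_power_power_eq_1_iff[OF assms]
      unity_root_power_eq_1_iff[OF assms])

section \<open>Explicit cyclic examples and the divisors of m that they force\<close>

lemma dvd_cancel_coprime:
  assumes "r * c dvd y * c * (m :: nat)" "coprime r y" "0 < c"
  shows "r dvd m"
proof -
  have "c * r dvd c * (y * m)"
    using assms(1) by (simp only: mult_ac)
  then have "r dvd y * m"
    using assms(3) by simp
  then show ?thesis
    using assms(2) by (simp add: coprime_dvd_mult_right_iff)
qed

lemma vector_4:
  "(vector [x, y, z, w] :: ('a::zero) ^ 4) $ 1 = x"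
  "(vector [x, y, z, w] :: ('a::zero) ^ 4) $ 2 = y"
  "(vector [x, y, z, w] :: ('a::zero) ^ 4) $ 3 = z"
  "(vector [x, y, z, w] :: ('a::zero) ^ 4) $ 4 = w"
  unfolding vector_def by simp_all

text \<open>The roots have order 3 and 4; e = 3 leaves the eigenvalue 1 and one of order 4. At a
  primitive cube root z the value of \<open>phi4\<close> is the unit -z, with inverse -z^2.\<close>

lemma dim_2_dvd_4:
  assumes "\<And>(\<Lambda> :: (complex ^ 2) set) G. hyperelliptic \<Lambda> G \<Longrightarrow>
    trivial_line_bundle (hyperelliptic_atlas \<Lambda> G) (tensor_power m canonical_bundle)"
  shows "4 dvd m"
proof -
  define a :: "2 \<Rightarrow> nat" where "a = ($) (vector [4, 3])"
  have a: "a 1 = 4" "a 2 = 3"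
    by (simp_all add: a_def)
  have roots: "ipoly phi3 (unity_root 12 ^ 4) = 0" "ipoly phi4 (unity_root 12 ^ 3) = 0"
    by (rule ipoly_phi_unity_root; simp)+
  have unit: "ipoly ([:0, 0, -1:]) z * ipoly (phi4) z = 1" if "z\<^sup>2 = - z - 1" for z
    by (simp add: phi_defs) (use that in \<open>Groebner_Basis.algebra\<close>)
  have quadratic: "(unity_root 12 ^ a 1)\<^sup>2 = - (unity_root 12 ^ a 1) - 1"
    using roots(1) by (simp add: a phi3_def) Groebner_Basis.algebra
  have "12 dvd sum a UNIV * 3 * m"
  proof (rule triviality_order_dvd[OF assms, where M = "phi3 * phi4" and d = 4 and q = "phi4"
        and u = "[:0, 0, -1:]" and j = 1 and s = "-1" and p = "-1" and i = 2])
    show "root_lattice (\<lambda>i. unity_root 12 ^ a i) (phi3 * phi4)"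
      by (rule unity_root_root_lattice)
         (simp_all only: lead_coeff_mult phi_monic mult_1_left,
          simp_all add: forall_2 a roots degree_mult_eq phi_degree phi_nonzero)
    show "\<forall>i. 12 dvd a i * 3 \<or> ipoly (phi4) (unity_root 12 ^ a i) = 0"
      by (simp add: forall_2 a roots)
    show "ipoly ([:0, 0, -1:]) (unity_root 12 ^ a 1) * ipoly (phi4) (unity_root 12 ^ a 1) = 1"
      by (rule unit[OF quadratic])
    show "(unity_root 12 ^ a 1)\<^sup>2 = of_int (-1) * unity_root 12 ^ a 1 + of_int (-1)"
      using quadratic by simp
    show "4 dvd k" if "12 dvd a 2 * (3 * k)" for k
      using dvd_cancel_coprime[of 4 3 3 k] that
      by (simp add: a coprime_iff_gcd_eq_1 gcd_non_0_nat)
  qed (simp_all add: forall_2 a)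
  then show ?thesis
    using dvd_cancel_coprime[of 4 3 7 m]
    by (simp add: sum_2 a coprime_iff_gcd_eq_1 gcd_non_0_nat)
qed

text \<open>The same lattice with the roles exchanged: e = 4 leaves one eigenvalue of order 3, and
  \<open>phi3\<close> takes the unit value z at a root z of \<open>phi4\<close>.\<close>

lemma dim_2_dvd_3:
  assumes "\<And>(\<Lambda> :: (complex ^ 2) set) G. hyperelliptic \<Lambda> G \<Longrightarrow>
    trivial_line_bundle (hyperelliptic_atlas \<Lambda> G) (tensor_power m canonical_bundle)"
  shows "3 dvd m"
proof -
  define a :: "2 \<Rightarrow> nat" where "a = ($) (vector [4, 3])"
  have a: "a 1 = 4" "a 2 = 3"
    by (simp_all add: a_def)
  have roots: "ipoly phi3 (unity_root 12 ^ 4) = 0" "ipoly phi4 (unity_root 12 ^ 3) = 0"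
    by (rule ipoly_phi_unity_root; simp)+
  have unit: "ipoly ([:0, -1:]) z * ipoly (phi3) z = 1" if "z\<^sup>2 = -1" for z
    by (simp add: phi_defs) (use that in \<open>Groebner_Basis.algebra\<close>)
  have quadratic: "(unity_root 12 ^ a 2)\<^sup>2 = -1"
    using roots(2) by (simp add: a phi4_def) Groebner_Basis.algebra
  have "12 dvd sum a UNIV * 4 * m"
  proof (rule triviality_order_dvd[OF assms, where M = "phi3 * phi4" and d = 3 and q = "phi3"
        and u = "[:0, -1:]" and j = 2 and s = "0" and p = "-1" and i = 1])
    show "root_lattice (\<lambda>i. unity_root 12 ^ a i) (phi3 * phi4)"
      by (rule unity_root_root_lattice)
         (simp_all only: lead_coeff_mult phi_monic mult_1_left,
          simp_all add: forall_2 a roots degree_mult_eq phi_degree phi_nonzero)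
    show "\<forall>i. 12 dvd a i * 4 \<or> ipoly (phi3) (unity_root 12 ^ a i) = 0"
      by (simp add: forall_2 a roots)
    show "ipoly ([:0, -1:]) (unity_root 12 ^ a 2) * ipoly (phi3) (unity_root 12 ^ a 2) = 1"
      by (rule unit[OF quadratic])
    show "(unity_root 12 ^ a 2)\<^sup>2 = of_int (0) * unity_root 12 ^ a 2 + of_int (-1)"
      using quadratic by simp
    show "3 dvd k" if "12 dvd a 1 * (4 * k)" for k
      using dvd_cancel_coprime[of 3 4 4 k] that
      by (simp add: a coprime_iff_gcd_eq_1 gcd_non_0_nat)
  qed (simp_all add: forall_2 a)
  then show ?thesis
    using dvd_cancel_coprime[of 3 4 7 m]
    by (simp add: sum_2 a coprime_iff_gcd_eq_1 gcd_non_0_nat)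
qed

text \<open>For e = 4 the roots of order 3 and 6 both become eigenvalues of order 3;
  \<open>phi6\<close> avoids a repeated root in M. The exponent 10 is taken instead of its conjugate
  2 so that these two eigenvalues agree; with 2 they would be inverse to each other and the
  determinant would be 1.\<close>

lemma dim_3_dvd_3:
  assumes "\<And>(\<Lambda> :: (complex ^ 3) set) G. hyperelliptic \<Lambda> G \<Longrightarrow>
    trivial_line_bundle (hyperelliptic_atlas \<Lambda> G) (tensor_power m canonical_bundle)"
  shows "3 dvd m"
proof -
  define a :: "3 \<Rightarrow> nat" where "a = ($) (vector [4, 3, 10])"
  have a: "a 1 = 4" "a 2 = 3" "a 3 = 10"
    by (simp_all add: a_def)
  have roots: "ipoly phi3 (unity_root 12 ^ 4) = 0" "ipoly phi4 (unity_root 12 ^ 3) = 0" "ipoly phi6 (unity_root 12 ^ 10) = 0"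
    by (rule ipoly_phi_unity_root; simp)+
  have unit: "ipoly (1) z * ipoly (phi3 * phi6) z = 1" if "z\<^sup>2 = -1" for z
    by (simp add: phi_defs) (use that in \<open>Groebner_Basis.algebra\<close>)
  have quadratic: "(unity_root 12 ^ a 2)\<^sup>2 = -1"
    using roots(2) by (simp add: a phi4_def) Groebner_Basis.algebra
  have "12 dvd sum a UNIV * 4 * m"
  proof (rule triviality_order_dvd[OF assms, where M = "phi3 * phi4 * phi6" and d = 3 and q = "phi3 * phi6"
        and u = "1" and j = 2 and s = "0" and p = "-1" and i = 1])
    show "root_lattice (\<lambda>i. unity_root 12 ^ a i) (phi3 * phi4 * phi6)"
      by (rule unity_root_root_lattice)
         (simp_all only: lead_coeff_mult phi_monic mult_1_left,
          simp_all add: forall_3 a roots degree_mult_eq phi_degree phi_nonzero)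
    show "\<forall>i. 12 dvd a i * 4 \<or> ipoly (phi3 * phi6) (unity_root 12 ^ a i) = 0"
      by (simp add: forall_3 a roots)
    show "ipoly (1) (unity_root 12 ^ a 2) * ipoly (phi3 * phi6) (unity_root 12 ^ a 2) = 1"
      by (rule unit[OF quadratic])
    show "(unity_root 12 ^ a 2)\<^sup>2 = of_int (0) * unity_root 12 ^ a 2 + of_int (-1)"
      using quadratic by simp
    show "3 dvd k" if "12 dvd a 1 * (4 * k)" for k
      using dvd_cancel_coprime[of 3 4 4 k] that
      by (simp add: a coprime_iff_gcd_eq_1 gcd_non_0_nat)
  qed (simp_all add: forall_3 a)
  then show ?thesis
    using dvd_cancel_coprime[of 3 4 17 m]
    by (simp add: sum_3 a coprime_iff_gcd_eq_1 gcd_non_0_nat)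
qed

text \<open>The group has order 8, but the determinant only order 4: with e = 3 the roots of order 8
  contribute the exponent 3 * (3 + 15), which is 6 modulo 24. Taking 9, conjugate to 15, would give
  only order 2. At a primitive cube root z, \<open>phi8\<close> has the unit value -z^2.\<close>

lemma dim_3_dvd_4:
  assumes "\<And>(\<Lambda> :: (complex ^ 3) set) G. hyperelliptic \<Lambda> G \<Longrightarrow>
    trivial_line_bundle (hyperelliptic_atlas \<Lambda> G) (tensor_power m canonical_bundle)"
  shows "4 dvd m"
proof -
  define a :: "3 \<Rightarrow> nat" where "a = ($) (vector [8, 3, 15])"
  have a: "a 1 = 8" "a 2 = 3" "a 3 = 15"
    by (simp_all add: a_def)
  have roots: "ipoly phi3 (unity_root 24 ^ 8) = 0" "ipoly phi8 (unity_root 24 ^ 3) = 0" "ipoly phi8 (unity_root 24 ^ 15) = 0"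
    by (rule ipoly_phi_unity_root; simp)+
  have unit: "ipoly ([:0, -1:]) z * ipoly (phi8) z = 1" if "z\<^sup>2 = - z - 1" for z
    by (simp add: phi_defs) (use that in \<open>Groebner_Basis.algebra\<close>)
  have quadratic: "(unity_root 24 ^ a 1)\<^sup>2 = - (unity_root 24 ^ a 1) - 1"
    using roots(1) by (simp add: a phi3_def) Groebner_Basis.algebra
  have "24 dvd sum a UNIV * 3 * m"
  proof (rule triviality_order_dvd[OF assms, where M = "phi3 * phi8" and d = 8 and q = "phi8"
        and u = "[:0, -1:]" and j = 1 and s = "-1" and p = "-1" and i = 2])
    show "root_lattice (\<lambda>i. unity_root 24 ^ a i) (phi3 * phi8)"
      by (rule unity_root_root_lattice)
         (simp_all only: lead_coeff_mult phi_monic mult_1_left,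
          simp_all add: forall_3 a roots degree_mult_eq phi_degree phi_nonzero)
    show "\<forall>i. 24 dvd a i * 3 \<or> ipoly (phi8) (unity_root 24 ^ a i) = 0"
      by (simp add: forall_3 a roots)
    show "ipoly ([:0, -1:]) (unity_root 24 ^ a 1) * ipoly (phi8) (unity_root 24 ^ a 1) = 1"
      by (rule unit[OF quadratic])
    show "(unity_root 24 ^ a 1)\<^sup>2 = of_int (-1) * unity_root 24 ^ a 1 + of_int (-1)"
      using quadratic by simp
    show "8 dvd k" if "24 dvd a 2 * (3 * k)" for k
      using dvd_cancel_coprime[of 8 3 3 k] that
      by (simp add: a coprime_iff_gcd_eq_1 gcd_non_0_nat)
  qed (simp_all add: forall_3 a)
  then show ?thesis
    using dvd_cancel_coprime[of 4 6 13 m]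
    by (simp add: sum_3 a coprime_iff_gcd_eq_1 gcd_non_0_nat)
qed

text \<open>The elliptic factor has multiplication by a root of \<open>phi4\<close>, where
  \<open>phi5\<close> takes the value 1. For e = 4 the two eigenvalues of order 5 have a product of
  order 5.\<close>

lemma dim_3_dvd_5:
  assumes "\<And>(\<Lambda> :: (complex ^ 3) set) G. hyperelliptic \<Lambda> G \<Longrightarrow>
    trivial_line_bundle (hyperelliptic_atlas \<Lambda> G) (tensor_power m canonical_bundle)"
  shows "5 dvd m"
proof -
  define a :: "3 \<Rightarrow> nat" where "a = ($) (vector [5, 4, 8])"
  have a: "a 1 = 5" "a 2 = 4" "a 3 = 8"
    by (simp_all add: a_def)
  have roots: "ipoly phi4 (unity_root 20 ^ 5) = 0" "ipoly phi5 (unity_root 20 ^ 4) = 0" "ipoly phi5 (unity_root 20 ^ 8) = 0"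
    by (rule ipoly_phi_unity_root; simp)+
  have unit: "ipoly (1) z * ipoly (phi5) z = 1" if "z\<^sup>2 = -1" for z
    by (simp add: phi_defs) (use that in \<open>Groebner_Basis.algebra\<close>)
  have quadratic: "(unity_root 20 ^ a 1)\<^sup>2 = -1"
    using roots(1) by (simp add: a phi4_def) Groebner_Basis.algebra
  have "20 dvd sum a UNIV * 4 * m"
  proof (rule triviality_order_dvd[OF assms, where M = "phi4 * phi5" and d = 5 and q = "phi5"
        and u = "1" and j = 1 and s = "0" and p = "-1" and i = 2])
    show "root_lattice (\<lambda>i. unity_root 20 ^ a i) (phi4 * phi5)"
      by (rule unity_root_root_lattice)
         (simp_all only: lead_coeff_mult phi_monic mult_1_left,
          simp_all add: forall_3 a roots degree_mult_eq phi_degree phi_nonzero)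
    show "\<forall>i. 20 dvd a i * 4 \<or> ipoly (phi5) (unity_root 20 ^ a i) = 0"
      by (simp add: forall_3 a roots)
    show "ipoly (1) (unity_root 20 ^ a 1) * ipoly (phi5) (unity_root 20 ^ a 1) = 1"
      by (rule unit[OF quadratic])
    show "(unity_root 20 ^ a 1)\<^sup>2 = of_int (0) * unity_root 20 ^ a 1 + of_int (-1)"
      using quadratic by simp
    show "5 dvd k" if "20 dvd a 2 * (4 * k)" for k
      using dvd_cancel_coprime[of 5 4 4 k] that
      by (simp add: a coprime_iff_gcd_eq_1 gcd_non_0_nat)
  qed (simp_all add: forall_3 a)
  then show ?thesis
    using dvd_cancel_coprime[of 5 4 17 m]
    by (simp add: sum_3 a coprime_iff_gcd_eq_1 gcd_non_0_nat)
qed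

text \<open>One lattice with roots of order 3, 4, 5, 5 serves for the divisors 4 and 5. Here e = 15
  leaves a single eigenvalue of order 4 and makes the other three equal to 1.\<close>

lemma dim_4_dvd_4:
  assumes "\<And>(\<Lambda> :: (complex ^ 4) set) G. hyperelliptic \<Lambda> G \<Longrightarrow>
    trivial_line_bundle (hyperelliptic_atlas \<Lambda> G) (tensor_power m canonical_bundle)"
  shows "4 dvd m"
proof -
  define a :: "4 \<Rightarrow> nat" where "a = ($) (vector [20, 15, 12, 24])"
  have a: "a 1 = 20" "a 2 = 15" "a 3 = 12" "a 4 = 24"
    by (simp_all add: a_def vector_4)
  have roots: "ipoly phi3 (unity_root 60 ^ 20) = 0" "ipoly phi4 (unity_root 60 ^ 15) = 0" "ipoly phi5 (unity_root 60 ^ 12) = 0" "ipoly phi5 (unity_root 60 ^ 24) = 0"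
    by (rule ipoly_phi_unity_root; simp)+
  have unit: "ipoly ([:0, 0, -1:]) z * ipoly (phi4) z = 1" if "z\<^sup>2 = - z - 1" for z
    by (simp add: phi_defs) (use that in \<open>Groebner_Basis.algebra\<close>)
  have quadratic: "(unity_root 60 ^ a 1)\<^sup>2 = - (unity_root 60 ^ a 1) - 1"
    using roots(1) by (simp add: a phi3_def) Groebner_Basis.algebra
  have "60 dvd sum a UNIV * 15 * m"
  proof (rule triviality_order_dvd[OF assms, where M = "phi3 * phi4 * phi5" and d = 4 and q = "phi4"
        and u = "[:0, 0, -1:]" and j = 1 and s = "-1" and p = "-1" and i = 2])
    show "root_lattice (\<lambda>i. unity_root 60 ^ a i) (phi3 * phi4 * phi5)"
      by (rule unity_root_root_lattice)
         (simp_all only: lead_coeff_mult phi_monic mult_1_left,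
          simp_all add: forall_4 a roots degree_mult_eq phi_degree phi_nonzero)
    show "\<forall>i. 60 dvd a i * 15 \<or> ipoly (phi4) (unity_root 60 ^ a i) = 0"
      by (simp add: forall_4 a roots)
    show "ipoly ([:0, 0, -1:]) (unity_root 60 ^ a 1) * ipoly (phi4) (unity_root 60 ^ a 1) = 1"
      by (rule unit[OF quadratic])
    show "(unity_root 60 ^ a 1)\<^sup>2 = of_int (-1) * unity_root 60 ^ a 1 + of_int (-1)"
      using quadratic by simp
    show "4 dvd k" if "60 dvd a 2 * (15 * k)" for k
      using dvd_cancel_coprime[of 4 15 15 k] that
      by (simp add: a coprime_iff_gcd_eq_1 gcd_non_0_nat)
  qed (simp_all add: forall_4 a)
  then show ?thesis
    using dvd_cancel_coprime[of 4 15 71 m]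
    by (simp add: sum_4 a coprime_iff_gcd_eq_1 gcd_non_0_nat)
qed

text \<open>Here e = 12 makes the roots of order 3 and 4 trivial and leaves the pair of order
  5.\<close>

lemma dim_4_dvd_5:
  assumes "\<And>(\<Lambda> :: (complex ^ 4) set) G. hyperelliptic \<Lambda> G \<Longrightarrow>
    trivial_line_bundle (hyperelliptic_atlas \<Lambda> G) (tensor_power m canonical_bundle)"
  shows "5 dvd m"
proof -
  define a :: "4 \<Rightarrow> nat" where "a = ($) (vector [20, 15, 12, 24])"
  have a: "a 1 = 20" "a 2 = 15" "a 3 = 12" "a 4 = 24"
    by (simp_all add: a_def vector_4)
  have roots: "ipoly phi3 (unity_root 60 ^ 20) = 0" "ipoly phi4 (unity_root 60 ^ 15) = 0" "ipoly phi5 (unity_root 60 ^ 12) = 0" "ipoly phi5 (unity_root 60 ^ 24) = 0"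
    by (rule ipoly_phi_unity_root; simp)+
  have unit: "ipoly (1) z * ipoly (phi5) z = 1" if "z\<^sup>2 = -1" for z
    by (simp add: phi_defs) (use that in \<open>Groebner_Basis.algebra\<close>)
  have quadratic: "(unity_root 60 ^ a 2)\<^sup>2 = -1"
    using roots(2) by (simp add: a phi4_def) Groebner_Basis.algebra
  have "60 dvd sum a UNIV * 12 * m"
  proof (rule triviality_order_dvd[OF assms, where M = "phi3 * phi4 * phi5" and d = 5 and q = "phi5"
        and u = "1" and j = 2 and s = "0" and p = "-1" and i = 3])
    show "root_lattice (\<lambda>i. unity_root 60 ^ a i) (phi3 * phi4 * phi5)"
      by (rule unity_root_root_lattice)
         (simp_all only: lead_coeff_mult phi_monic mult_1_left,
          simp_all add: forall_4 a roots degree_mult_eq phi_degree phi_nonzero)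
    show "\<forall>i. 60 dvd a i * 12 \<or> ipoly (phi5) (unity_root 60 ^ a i) = 0"
      by (simp add: forall_4 a roots)
    show "ipoly (1) (unity_root 60 ^ a 2) * ipoly (phi5) (unity_root 60 ^ a 2) = 1"
      by (rule unit[OF quadratic])
    show "(unity_root 60 ^ a 2)\<^sup>2 = of_int (0) * unity_root 60 ^ a 2 + of_int (-1)"
      using quadratic by simp
    show "5 dvd k" if "60 dvd a 3 * (12 * k)" for k
      using dvd_cancel_coprime[of 5 12 12 k] that
      by (simp add: a coprime_iff_gcd_eq_1 gcd_non_0_nat)
  qed (simp_all add: forall_4 a)
  then show ?thesis
    using dvd_cancel_coprime[of 5 12 71 m]
    by (simp add: sum_4 a coprime_iff_gcd_eq_1 gcd_non_0_nat)
qed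

text \<open>The choice of roots from the conjugate pairs matters: the powers 1, 2, 3 of a primitive
  seventh root have a product of order 7, whereas 1, 2, 4 would give the product 1. At a root z of
  \<open>phi4\<close> the value of \<open>phi7\<close> is z.\<close>

lemma dim_4_dvd_7:
  assumes "\<And>(\<Lambda> :: (complex ^ 4) set) G. hyperelliptic \<Lambda> G \<Longrightarrow>
    trivial_line_bundle (hyperelliptic_atlas \<Lambda> G) (tensor_power m canonical_bundle)"
  shows "7 dvd m"
proof -
  define a :: "4 \<Rightarrow> nat" where "a = ($) (vector [7, 4, 8, 12])"
  have a: "a 1 = 7" "a 2 = 4" "a 3 = 8" "a 4 = 12"
    by (simp_all add: a_def vector_4)
  have roots: "ipoly phi4 (unity_root 28 ^ 7) = 0" "ipoly phi7 (unity_root 28 ^ 4) = 0" "ipoly phi7 (unity_root 28 ^ 8) = 0" "ipoly phi7 (unity_root 28 ^ 12) = 0"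
    by (rule ipoly_phi_unity_root; simp)+
  have unit: "ipoly ([:0, -1:]) z * ipoly (phi7) z = 1" if "z\<^sup>2 = -1" for z
    by (simp add: phi_defs) (use that in \<open>Groebner_Basis.algebra\<close>)
  have quadratic: "(unity_root 28 ^ a 1)\<^sup>2 = -1"
    using roots(1) by (simp add: a phi4_def) Groebner_Basis.algebra
  have "28 dvd sum a UNIV * 4 * m"
  proof (rule triviality_order_dvd[OF assms, where M = "phi4 * phi7" and d = 7 and q = "phi7"
        and u = "[:0, -1:]" and j = 1 and s = "0" and p = "-1" and i = 2])
    show "root_lattice (\<lambda>i. unity_root 28 ^ a i) (phi4 * phi7)"
      by (rule unity_root_root_lattice)
         (simp_all only: lead_coeff_mult phi_monic mult_1_left,
          simp_all add: forall_4 a roots degree_mult_eq phi_degree phi_nonzero)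
    show "\<forall>i. 28 dvd a i * 4 \<or> ipoly (phi7) (unity_root 28 ^ a i) = 0"
      by (simp add: forall_4 a roots)
    show "ipoly ([:0, -1:]) (unity_root 28 ^ a 1) * ipoly (phi7) (unity_root 28 ^ a 1) = 1"
      by (rule unit[OF quadratic])
    show "(unity_root 28 ^ a 1)\<^sup>2 = of_int (0) * unity_root 28 ^ a 1 + of_int (-1)"
      using quadratic by simp
    show "7 dvd k" if "28 dvd a 2 * (4 * k)" for k
      using dvd_cancel_coprime[of 7 4 4 k] that
      by (simp add: a coprime_iff_gcd_eq_1 gcd_non_0_nat)
  qed (simp_all add: forall_4 a)
  then show ?thesis
    using dvd_cancel_coprime[of 7 4 31 m]
    by (simp add: sum_4 a coprime_iff_gcd_eq_1 gcd_non_0_nat)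
qed

text \<open>The powers 1, 2, 4 of a primitive ninth root have exponent sum 7, prime to 9, so the
  determinant has full order 9; the choice 1, 4, 7 would give only order 3. At a root z of
  \<open>phi4\<close> the value of \<open>phi9\<close> is -z.\<close>

lemma dim_4_dvd_9:
  assumes "\<And>(\<Lambda> :: (complex ^ 4) set) G. hyperelliptic \<Lambda> G \<Longrightarrow>
    trivial_line_bundle (hyperelliptic_atlas \<Lambda> G) (tensor_power m canonical_bundle)"
  shows "9 dvd m"
proof -
  define a :: "4 \<Rightarrow> nat" where "a = ($) (vector [9, 4, 8, 16])"
  have a: "a 1 = 9" "a 2 = 4" "a 3 = 8" "a 4 = 16"
    by (simp_all add: a_def vector_4)
  have roots: "ipoly phi4 (unity_root 36 ^ 9) = 0" "ipoly phi9 (unity_root 36 ^ 4) = 0" "ipoly phi9 (unity_root 36 ^ 8) = 0" "ipoly phi9 (unity_root 36 ^ 16) = 0"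
    by (rule ipoly_phi_unity_root; simp)+
  have unit: "ipoly ([:0, 1:]) z * ipoly (phi9) z = 1" if "z\<^sup>2 = -1" for z
    by (simp add: phi_defs) (use that in \<open>Groebner_Basis.algebra\<close>)
  have quadratic: "(unity_root 36 ^ a 1)\<^sup>2 = -1"
    using roots(1) by (simp add: a phi4_def) Groebner_Basis.algebra
  have "36 dvd sum a UNIV * 4 * m"
  proof (rule triviality_order_dvd[OF assms, where M = "phi4 * phi9" and d = 9 and q = "phi9"
        and u = "[:0, 1:]" and j = 1 and s = "0" and p = "-1" and i = 2])
    show "root_lattice (\<lambda>i. unity_root 36 ^ a i) (phi4 * phi9)"
      by (rule unity_root_root_lattice)
         (simp_all only: lead_coeff_mult phi_monic mult_1_left,
          simp_all add: forall_4 a roots degree_mult_eq phi_degree phi_nonzero)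
    show "\<forall>i. 36 dvd a i * 4 \<or> ipoly (phi9) (unity_root 36 ^ a i) = 0"
      by (simp add: forall_4 a roots)
    show "ipoly ([:0, 1:]) (unity_root 36 ^ a 1) * ipoly (phi9) (unity_root 36 ^ a 1) = 1"
      by (rule unit[OF quadratic])
    show "(unity_root 36 ^ a 1)\<^sup>2 = of_int (0) * unity_root 36 ^ a 1 + of_int (-1)"
      using quadratic by simp
    show "9 dvd k" if "36 dvd a 2 * (4 * k)" for k
      using dvd_cancel_coprime[of 9 4 4 k] that
      by (simp add: a coprime_iff_gcd_eq_1 gcd_non_0_nat)
  qed (simp_all add: forall_4 a)
  then show ?thesis
    using dvd_cancel_coprime[of 9 4 37 m]
    by (simp add: sum_4 a coprime_iff_gcd_eq_1 gcd_non_0_nat)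
qed

section \<open>From divisibility to the minimum\<close>

lemma tau_eqI:
  assumes "1 \<le> N"
    and "\<And>(\<Lambda> :: (complex ^ 'n::finite) set) G. hyperelliptic \<Lambda> G \<Longrightarrow>
      trivial_line_bundle (hyperelliptic_atlas \<Lambda> G) (tensor_power N canonical_bundle)"
    and dvd: "\<And>m. (\<And>(\<Lambda> :: (complex ^ 'n) set) G. hyperelliptic \<Lambda> G \<Longrightarrow>
      trivial_line_bundle (hyperelliptic_atlas \<Lambda> G) (tensor_power m canonical_bundle)) \<Longrightarrow> N dvd m"
  shows "tau TYPE('n) = N"
  unfolding tau_def
proof (rule cInf_eq_minimum)
  fix m assume "m \<in> {m. 1 \<le> m \<and> (\<forall>(\<Lambda> :: (complex ^ 'n) set) G. hyperelliptic \<Lambda> G \<longrightarrow>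
      trivial_line_bundle (hyperelliptic_atlas \<Lambda> G) (tensor_power m canonical_bundle))}"
  then show "N \<le> m"
    using dvd[of m] by (auto intro: dvd_imp_le)
qed (use assms(1,2) in blast)

theorem theorem2:
  shows "tau TYPE(2) = 12 \<and> tau TYPE(3) = 60 \<and> tau TYPE(4) = 1260"
proof (intro conjI)
  have mult: "a * b dvd m" if "a dvd m" "b dvd m" "gcd a b = 1" for a b m :: nat
    using divides_mult[OF that(1,2)] that(3) by (simp add: coprime_iff_gcd_eq_1)
  show "tau TYPE(2) = 12"
  proof (rule tau_eqI)
    fix m assume triv: "\<And>(\<Lambda> :: (complex ^ 2) set) G. hyperelliptic \<Lambda> G \<Longrightarrow>
      trivial_line_bundle (hyperelliptic_atlas \<Lambda> G) (tensor_power m canonical_bundle)"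
    have d0: "4 dvd m"
      by (rule dim_2_dvd_4) (rule triv)
    have d1: "3 dvd m"
      by (rule dim_2_dvd_3) (rule triv)
    show "12 dvd m"
      using mult[of 4 m 3] d0 d1 by (simp add: gcd_non_0_nat)
  qed (simp_all add: trivial_dim_2)
  show "tau TYPE(3) = 60"
  proof (rule tau_eqI)
    fix m assume triv: "\<And>(\<Lambda> :: (complex ^ 3) set) G. hyperelliptic \<Lambda> G \<Longrightarrow>
      trivial_line_bundle (hyperelliptic_atlas \<Lambda> G) (tensor_power m canonical_bundle)"
    have d0: "3 dvd m"
      by (rule dim_3_dvd_3) (rule triv)
    have d1: "4 dvd m"
      by (rule dim_3_dvd_4) (rule triv)
    have d2: "5 dvd m"
      by (rule dim_3_dvd_5) (rule triv)
    show "60 dvd m"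
      using mult[of 4 m 3] mult[of 12 m 5] d0 d1 d2 by (simp add: gcd_non_0_nat)
  qed (simp_all add: trivial_dim_3)
  show "tau TYPE(4) = 1260"
  proof (rule tau_eqI)
    fix m assume triv: "\<And>(\<Lambda> :: (complex ^ 4) set) G. hyperelliptic \<Lambda> G \<Longrightarrow>
      trivial_line_bundle (hyperelliptic_atlas \<Lambda> G) (tensor_power m canonical_bundle)"
    have d0: "4 dvd m"
      by (rule dim_4_dvd_4) (rule triv)
    have d1: "5 dvd m"
      by (rule dim_4_dvd_5) (rule triv)
    have d2: "7 dvd m"
      by (rule dim_4_dvd_7) (rule triv)
    have d3: "9 dvd m"
      by (rule dim_4_dvd_9) (rule triv)
    show "1260 dvd m"
      using mult[of 4 m 5] mult[of 20 m 7] mult[of 140 m 9] d0 d1 d2 d3 by (simp add: gcd_non_0_nat)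
  qed (simp_all add: trivial_dim_4)
qed

end
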